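(* There is an absolute constant $C>0$ such that the following holds. Let $n$ be a positive integer, $r>0$ real, let $A\subseteq S_n$ be a non-empty $r$-global set, let $f=1_A/\mu(A)$, and let $d\ge 0$ be an integer with $d\le\min\left(\tfrac18\log(1/\mu(A)),\,n/10^5\right)$. Then $$\|T_f\|_{V_{=d}}\le\left(Cr^4n^{-1}\log(1/\mu(A))\right)^{d/2},$$ where for $d=0$ the right-hand side is read as $1$.
   Context: $L^2(S_n)$ is the space of real functions on $S_n$ with the uniform probability measure $\mu$, $\langle f,g\rangle=\mathbb{E}_{\sigma\in S_n}[f(\sigma)g(\sigma)]$, and $\|f\|_p=(\mathbb{E}|f|^p)^{1/p}$. $\log$ is natural. Globalness: let $[n]_t$ be the set of $t$-tuples of distinct elements of $[n]$. For $I,J\in[n]_t$ let $U_{I\to J}=\{\sigma\in S_n:\sigma(I_s)=J_s \text{ for all } s\}$ and let $f_{I\to J}$ be the restriction of $f$ to $U_{I\to J}$, with norms taken with respect to the uniform probability measure on $U_{I\to J}$. $f$ is $(r,\gamma)$-global if $\|f_{I\to J}\|_2\le r^t\gamma$ for every $t$ and all $I,J\in[n]_t$; it is $r$-global if it is $(r,\|f\|_2)$-global. A set $A\subseteq S_n$ is $r$-global if its indicator function $1_A$ is. Degree decomposition: let $x_{i\to j}(\sigma)=1$ if $\sigma(i)=j$ and $0$ otherwise. $V_{\le d}\le L^2(S_n)$ is the space of functions expressible as polynomials of degree at most $d$ in the $n^2$ functions $x_{i\to j}$ (with $V_{\le -1}=0$), and $V_{=d}$ is the orthogonal complement of $V_{\le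 d-1}$ in $V_{\le d}$. Convolution: $(f*g)(\sigma)=\mathbb{E}_{\tau\sim S_n}[f(\tau)g(\tau^{-1}\sigma)]$ and $T_f(g)=f*g$. For a subspace $V\le L^2(S_n)$, $\|T_f\|_{V}=\sup\{\|T_fg\|_2:g\in V,\|g\|_2=1\}$. *)

theory Defs
  imports "HOL-Probability.Probability" "HOL-Combinatorics.Permutations" "HOL-Library.Poly_Mapping"
begin

definition Sn :: "nat \<Rightarrow> (nat \<Rightarrow> nat) set" where
  "Sn n = {\<sigma>. \<sigma> permutes {1..n}}"

text \<open>
  Functions on \<open>Sn n\<close> are total functions whose values outside \<open>Sn n\<close> are irrelevant: every
  notion below depends only on the values on \<open>Sn n\<close>. In particular the subspaces
  \<open>deg_le\<close> and \<open>deg_eq\<close> contain, with a function, all functions agreeing with it on \<open>Sn n\<close>.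
\<close>

definition expect :: "(nat \<Rightarrow> nat) set \<Rightarrow> ((nat \<Rightarrow> nat) \<Rightarrow> real) \<Rightarrow> real" where
  "expect U f = measure_pmf.expectation (pmf_of_set U) f"

definition mu :: "nat \<Rightarrow> (nat \<Rightarrow> nat) set \<Rightarrow> real" where
  "mu n A = measure_pmf.prob (pmf_of_set (Sn n)) A"

definition l2norm :: "(nat \<Rightarrow> nat) set \<Rightarrow> ((nat \<Rightarrow> nat) \<Rightarrow> real) \<Rightarrow> real" where
  "l2norm U f = sqrt (expect U (\<lambda>\<sigma>. (f \<sigma>)\<^sup>2))"

definition l2inner :: "nat \<Rightarrow> ((nat \<Rightarrow> nat) \<Rightarrow> real) \<Rightarrow> ((nat \<Rightarrow> nat) \<Rightarrow> real) \<Rightarrow> real" where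
  "l2inner n f g = expect (Sn n) (\<lambda>\<sigma>. f \<sigma> * g \<sigma>)"

definition tuples :: "nat \<Rightarrow> nat \<Rightarrow> nat list set" where
  "tuples n t = {I. length I = t \<and> distinct I \<and> set I \<subseteq> {1..n}}"

definition umvirate :: "nat \<Rightarrow> nat list \<Rightarrow> nat list \<Rightarrow> (nat \<Rightarrow> nat) set" where
  "umvirate n I J = {\<sigma> \<in> Sn n. \<forall>s < length I. \<sigma> (I ! s) = J ! s}"

definition global_with :: "nat \<Rightarrow> real \<Rightarrow> real \<Rightarrow> ((nat \<Rightarrow> nat) \<Rightarrow> real) \<Rightarrow> bool" where
  "global_with n r \<gamma> f \<longleftrightarrow>
     (\<forall>t. \<forall>I \<in> tuples n t. \<forall>J \<in> tuples n t. l2norm (umvirate n I J) f \<le> r ^ t * \<gamma>)"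

definition global_fun :: "nat \<Rightarrow> real \<Rightarrow> ((nat \<Rightarrow> nat) \<Rightarrow> real) \<Rightarrow> bool" where
  "global_fun n r f \<longleftrightarrow> global_with n r (l2norm (Sn n) f) f"

definition global_set :: "nat \<Rightarrow> real \<Rightarrow> (nat \<Rightarrow> nat) set \<Rightarrow> bool" where
  "global_set n r A \<longleftrightarrow> global_fun n r (indicator A)"

definition dictator :: "nat \<times> nat \<Rightarrow> (nat \<Rightarrow> nat) \<Rightarrow> real" where
  "dictator v \<sigma> = (if \<sigma> (fst v) = snd v then 1 else 0)"

text \<open>
  A real polynomial in variables indexed by \<open>nat \<times> nat\<close> is a finitely supported map from monomials
  to coefficients, a monomial being a finitely supported map from variables to exponents.
\<close>

type_synonym monomial = "(nat \<times> nat) \<Rightarrow>\<^sub>0 nat"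
type_synonym polynomial = "monomial \<Rightarrow>\<^sub>0 real"

definition monomial_degree :: "monomial \<Rightarrow> nat" where
  "monomial_degree m = (\<Sum>v \<in> Poly_Mapping.keys m. Poly_Mapping.lookup m v)"

definition eval_poly :: "polynomial \<Rightarrow> (nat \<times> nat \<Rightarrow> real) \<Rightarrow> real" where
  "eval_poly P x = (\<Sum>m \<in> Poly_Mapping.keys P. Poly_Mapping.lookup P m *
     (\<Prod>v \<in> Poly_Mapping.keys m. x v ^ Poly_Mapping.lookup m v))"

text \<open>
  The degree bound is an integer, so that \<open>deg_le n (-1)\<close> is the zero space: the only admissible
  polynomial is then the zero polynomial.
\<close>

definition deg_le :: "nat \<Rightarrow> int \<Rightarrow> ((nat \<Rightarrow> nat) \<Rightarrow> real) set" where
  "deg_le n d = {f. \<exists>P :: polynomial.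
     (\<forall>m \<in> Poly_Mapping.keys P.
        Poly_Mapping.keys m \<subseteq> {1..n} \<times> {1..n} \<and> int (monomial_degree m) \<le> d) \<and>
     (\<forall>\<sigma> \<in> Sn n. f \<sigma> = eval_poly P (\<lambda>v. dictator v \<sigma>))}"

definition deg_eq :: "nat \<Rightarrow> int \<Rightarrow> ((nat \<Rightarrow> nat) \<Rightarrow> real) set" where
  "deg_eq n d = {f \<in> deg_le n d. \<forall>g \<in> deg_le n (d - 1). l2inner n f g = 0}"

definition conv ::
  "nat \<Rightarrow> ((nat \<Rightarrow> nat) \<Rightarrow> real) \<Rightarrow> ((nat \<Rightarrow> nat) \<Rightarrow> real) \<Rightarrow> (nat \<Rightarrow> nat) \<Rightarrow> real" where
  "conv n f g \<sigma> = expect (Sn n) (\<lambda>\<tau>. f \<tau> * g (inv \<tau> \<circ> \<sigma>))"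

text \<open>
  The supremum is taken in \<open>[0, \<infinity>]\<close>, so that the norm on the zero space is 0 rather than
  the unspecified real \<open>Sup {}\<close>.
\<close>

definition op_norm_on ::
  "nat \<Rightarrow> (((nat \<Rightarrow> nat) \<Rightarrow> real) \<Rightarrow> ((nat \<Rightarrow> nat) \<Rightarrow> real)) \<Rightarrow>
     ((nat \<Rightarrow> nat) \<Rightarrow> real) set \<Rightarrow> ennreal" where
  "op_norm_on n T V = (SUP g \<in> {g \<in> V. l2norm (Sn n) g = 1}. ennreal (l2norm (Sn n) (T g)))"

end

theory Submission
  imports Defs
begin

text \<open>
  \<^bold>\<open>Idea of the proof.\<close> For \<open>d \<ge> 1\<close> write \<open>L = ln (1 / mu n A)\<close>.
  As a module over the left translations, \<open>V\<^bsub>=d\<^esub>\<close> is a sum of copies of a single space: the functions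
  of the restriction of \<open>\<sigma>\<close> to a \<open>d\<close>-set \<open>I\<close> that have mean zero in each of the \<open>d\<close> values.
  Hence it suffices to bound the operator on one copy, and there its Hilbert-Schmidt norm is already
  small enough, so that no dimension bounds for irreducible representations are needed.

  On such a copy, taking differences across \<open>d\<close> disjoint transpositions loses only a factor
  \<open>exp (O d)\<close>, so one has to bound, for a fixed family of disjoint pairs \<open>(a k, b k)\<close>, the sum \<open>Z\<close> of
  the squares of the level \<open>d\<close> differences of \<open>A\<close>. This is a level inequality, proved by induction on \<open>d\<close>:
  \<open>Z\<close> is the pairing of \<open>A\<close> with a function \<open>U\<close> that is a homogeneous Rademacher chaos on each orbit of
  the group generated by the swaps of \<open>a k\<close> and \<open>b k\<close>. Bonami's inequality with exponent of order
  \<open>L / d\<close> reduces the moments of \<open>U\<close> to those of a sum of nonnegative terms. These are computed by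
  revealing the permutation step by step; each conditional expectation is controlled by partial sums
  of \<open>Z\<close>, which are instances of the inequality at lower level for restrictions of \<open>A\<close>, and it is
  here that globalness enters.
\<close>

section \<open>Moment inequalities on the discrete cube\<close>

text \<open>Convolution by \<open>A\<close> averages left translations, so it commutes with right
  translations. Hence one copy of the space can be moved to any \<open>d\<close>-set
  \<open>D\<close> inside \<open>{1..h}\<close>, \<open>h = n div 2\<close>, and the differences can
  be taken on the right, between the positions \<open>k\<close> and \<open>h + k\<close>. For a
  fixed \<open>\<sigma>\<close> they become differences of \<open>A\<close> between the values
  \<open>\<sigma> k\<close> and \<open>\<sigma> (h + k)\<close>: these are the disjoint pairs. A
  single \<open>D\<close> sees only a small part of \<open>Z\<close>, so the estimates for all
  \<open>h choose d\<close> sets \<open>D\<close> are added, and only a factor \<open>4 ^ d\<close>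
  is lost.

  The level inequality has to cover all restrictions of \<open>A\<close> by prescribed values:
  revealing where some pairs sit leaves differences over fewer pairs, of a restricted set. One
  prescribed value multiplies the density by at most \<open>r\<^sup>2\<close>; the inequality is
  quadratic in the density, whence \<open>r ^ 4\<close>.

  Revealing pairs is harmless only while most points stay free. This is automatic in the relevant
  range: if the claimed bound is below 1, then \<open>8 * L \<le> n\<close>, and only
  \<open>O(L)\<close> points are ever revealed; otherwise the operator norm is at most 1
  anyway.\<close>

lemma binomial_double_le:
  assumes "0 < p"
  shows "real ((2 * p) choose (2 * j)) \<le> real (2 * p - 1) ^ j * real (p choose j)"
proof (induction j)
  case 0
  then show ?case by simp
next
  case (Suc j)
  show ?case
  proof (cases "j < p")
    case False
    then show ?thesis by (simp add: binomial_eq_0)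
  next
    case True
    have e1: "real (Suc m) * real (n choose Suc m) = (real n - real m) * real (n choose m)" for n m :: nat
    proof (cases "m \<le> n")
      case True
      have "Suc m * (n choose Suc m) = (n - m) * (n choose m)"
        by (metis binomial_absorb_comp binomial_absorption mult.commute)
      then show ?thesis using True by (metis of_nat_diff of_nat_mult)
    qed (simp add: binomial_eq_0)
    let ?a = "real ((2 * p) choose (2 * j))" and ?c = "real ((2 * p) choose (2 * Suc j))"
    let ?d = "real (p choose j)" and ?e = "real (p choose Suc j)"
    have a1: "real (2*j+2) * ?c = (real (2*p) - real (2*j+1)) * real ((2 * p) choose (2*j+1))"
      using e1[of "2*j+1" "2*p"] by simp
    have a2: "real (2*j+1) * real ((2 * p) choose (2*j+1)) = (real (2*p) - real (2*j)) * ?a"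
      using e1[of "2*j" "2*p"] by simp
    have a3: "real (j+1) * ?e = (real p - real j) * ?d"
      using e1[of j p] by simp
    \<comment> \<open>The ratios of consecutive terms are (2p-2j)(2p-2j-1) / ((2j+1)(2j+2)) and
      (p-j) / (j+1). Their quotient (2p-2j-1) / (2j+1) is at most 2p-1.\<close>
    have "real (2*j+1) * (real (2*j+2) * ?c)
        = (real (2*p) - real (2*j+1)) * (real (2*j+1) * real ((2 * p) choose (2*j+1)))"
      unfolding a1 by (simp only: mult.left_commute)
    also have "\<dots> = (real (2*p) - real (2*j+1)) * ((real (2*p) - real (2*j)) * ?a)"
      unfolding a2 ..
    finally have "real (2*j+1) * real (2*j+2) * ?c
        = (real (2*p) - real (2*j+1)) * (2 * (real p - real j)) * ?a"
      by (simp add: algebra_simps)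
    also have "\<dots> \<le> (real (2*p) - real (2*j+1)) * (2 * (real p - real j)) * (real (2*p-1) ^ j * ?d)"
      using Suc.IH True by (intro mult_left_mono) auto
    also have "\<dots> = (real (2*p) - real (2*j+1)) * real (2*p-1) ^ j * (2 * ((real p - real j) * ?d))"
      by (simp add: mult_ac)
    also have "\<dots> = (real (2*p) - real (2*j+1)) * real (2*p-1) ^ j * (2 * (real (j+1) * ?e))"
      unfolding a3 ..
    also have "\<dots> \<le> real (2*j+1) * real (2*p-1) * real (2*p-1) ^ j * (2 * (real (j+1) * ?e))"
    proof (intro mult_right_mono)
      have "real (2*p) - real (2*j+1) \<le> real (2*p-1)" using assms by simp
      also have "\<dots> \<le> real (2*j+1) * real (2*p-1)" by (simp add: algebra_simps)
      finally show "real (2*p) - real (2*j+1) \<le> real (2*j+1) * real (2*p-1)" .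
    qed auto
    also have "\<dots> = real (2*j+1) * real (2*j+2) * (real (2*p-1) ^ Suc j * ?e)"
      by (simp add: algebra_simps)
    finally show ?thesis
      by (subst (asm) mult_le_cancel_left_pos) auto
  qed
qed

text \<open>Weighted arithmetic-geometric mean inequality. Zero arguments are treated apart because
  the powers are rewritten through \<open>powr\<close>, which needs positive bases.\<close>

lemma power_product_le:
  fixes x y :: real
  assumes "0 \<le> x" "0 \<le> y" "j \<le> p" "0 < p"
  shows "x ^ (p - j) * y ^ j \<le> real (p - j) / real p * x ^ p + real j / real p * y ^ p"
proof (cases "x = 0 \<or> y = 0")
  case True
  show ?thesis
  proof (cases "j = 0 \<or> j = p")
    case True
    then show ?thesis using assms by auto
  next
    case False
    then have "x ^ (p - j) * y ^ j = 0" using True assms by auto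
    moreover have "0 \<le> real (p - j) / real p * x ^ p + real j / real p * y ^ p"
      using assms by (intro add_nonneg_nonneg mult_nonneg_nonneg) auto
    ultimately show ?thesis by linarith
  qed
next
  case False
  then have xy: "0 < x" "0 < y" using assms by auto
  have "(x ^ p) powr (real (p-j) / real p) * (y ^ p) powr (real j / real p)
      \<le> real (p - j) / real p * x ^ p + real j / real p * y ^ p"
  proof (rule Youngs_inequality_0)
    show "real (p - j) / real p + real j / real p = 1"
      using assms by (simp add: field_simps of_nat_diff)
  qed (use xy in auto)
  moreover have "(x ^ p) powr (real (p-j) / real p) = x ^ (p - j)"
    using xy assms by (simp add: powr_powr flip: powr_realpow)
  moreover have "(y ^ p) powr (real j / real p) = y ^ j"
    using xy assms by (simp add: powr_powr flip: powr_realpow)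
  ultimately show ?thesis by simp
qed

text \<open>Hoelder's inequality in normalised form: after division of \<open>g\<^sup>2\<close> by
  \<open>\<alpha>\<close> and of \<open>h\<^sup>2\<close> by \<open>\<beta>\<close>, both sums of
  \<open>p\<close>-th powers are at most \<open>N\<close> and the weighted mean inequality applies
  termwise. If \<open>\<alpha>\<close> or \<open>\<beta>\<close> is zero, the corresponding function
  vanishes on \<open>S\<close>.\<close>

lemma sum_power_product_le:
  fixes g h :: "'a \<Rightarrow> real"
  assumes "finite S" "j \<le> p" "0 < p" "0 \<le> \<alpha>" "0 \<le> \<beta>" "0 \<le> N"
    and g: "(\<Sum>x\<in>S. g x ^ (2 * p)) \<le> N * \<alpha> ^ p"
    and h: "(\<Sum>x\<in>S. h x ^ (2 * p)) \<le> N * \<beta> ^ p"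
  shows "(\<Sum>x\<in>S. g x ^ (2 * (p - j)) * h x ^ (2 * j)) \<le> N * (\<alpha> ^ (p - j) * \<beta> ^ j)"
proof (cases "\<alpha> = 0 \<or> \<beta> = 0")
  case True
  have z: "(\<forall>x\<in>S. f x = 0)" if "(\<Sum>x\<in>S. f x ^ (2 * p)) \<le> N * 0 ^ p" for f :: "'a \<Rightarrow> real"
  proof -
    have "(\<Sum>x\<in>S. f x ^ (2 * p)) = 0"
      using that assms by (intro antisym sum_nonneg) (auto simp: zero_power)
    then show ?thesis
      using assms by (subst (asm) sum_nonneg_eq_0_iff) auto
  qed
  consider "j = 0" | "j = p" | "0 < j" "j < p" using assms by linarith
  then show ?thesis
  proof cases
    case 3
    have "\<forall>x\<in>S. g x ^ (2 * (p - j)) * h x ^ (2 * j) = 0"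
      using z[of g] z[of h] g h True 3 by auto
    then show ?thesis using assms by (simp add: sum.neutral)
  qed (use g h in auto)
next
  case False
  then have pos: "0 < \<alpha>" "0 < \<beta>" using assms by auto
  have e: "u ^ (2 * i) / \<gamma> ^ i = (u\<^sup>2 / \<gamma>) ^ i" for u \<gamma> :: real and i
    by (simp add: power_mult power_divide)
  have "(\<Sum>x\<in>S. g x ^ (2 * (p - j)) * h x ^ (2 * j)) / (\<alpha> ^ (p - j) * \<beta> ^ j)
      = (\<Sum>x\<in>S. ((g x)\<^sup>2 / \<alpha>) ^ (p - j) * ((h x)\<^sup>2 / \<beta>) ^ j)"
    by (simp add: sum_divide_distrib flip: e)
  also have "\<dots> \<le> (\<Sum>x\<in>S. real (p - j) / real p * ((g x)\<^sup>2 / \<alpha>) ^ p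
      + real j / real p * ((h x)\<^sup>2 / \<beta>) ^ p)"
    using assms by (intro sum_mono power_product_le) auto
  also have "\<dots> = real (p - j) / real p * ((\<Sum>x\<in>S. g x ^ (2 * p)) / \<alpha> ^ p)
      + real j / real p * ((\<Sum>x\<in>S. h x ^ (2 * p)) / \<beta> ^ p)"
    by (simp add: sum.distrib sum_divide_distrib sum_distrib_left flip: e)
  also have "\<dots> \<le> real (p - j) / real p * N + real j / real p * N"
    using g h pos by (intro add_mono mult_left_mono) (auto simp: pos_divide_le_eq)
  also have "\<dots> = N"
    using assms by (simp add: field_simps of_nat_diff)
  finally show ?thesis using pos by (simp add: pos_divide_le_eq)
qed

lemma power_even_symmetrized:
  fixes g h :: real
  shows "(g + h) ^ (2 * p) + (g - h) ^ (2 * p)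
    = 2 * (\<Sum>j\<le>p. real ((2 * p) choose (2 * j)) * (g ^ (2 * (p - j)) * h ^ (2 * j)))"
proof -
  let ?t = "\<lambda>i. real ((2 * p) choose i) * h ^ i * g ^ (2 * p - i)"
  have "(g + h) ^ (2 * p) = (\<Sum>i\<le>2 * p. ?t i)"
    using binomial_ring[of h g "2 * p"] by (simp add: add.commute)
  moreover have "(g - h) ^ (2 * p) = (\<Sum>i\<le>2 * p. real ((2 * p) choose i) * (- h) ^ i * g ^ (2 * p - i))"
    using binomial_ring[of "- h" g "2 * p"] by simp
  ultimately have "(g + h) ^ (2 * p) + (g - h) ^ (2 * p)
      = (\<Sum>i\<le>2 * p. ?t i + real ((2 * p) choose i) * (- h) ^ i * g ^ (2 * p - i))"
    by (simp add: sum.distrib)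
  also have "\<dots> = (\<Sum>i\<le>2 * p. if even i then 2 * ?t i else 0)"
    by (intro sum.cong) auto
  also have "\<dots> = (\<Sum>i\<in>{i. i \<le> 2 * p \<and> even i}. 2 * ?t i)"
    by (simp add: sum.If_cases Int_def)
  also have "\<dots> = (\<Sum>j\<le>p. 2 * ?t (2 * j))"
    by (intro sum.reindex_bij_witness[of _ "\<lambda>j. 2 * j" "\<lambda>i. i div 2"]) auto
  also have "\<dots> = (\<Sum>j\<le>p. 2 * (real ((2 * p) choose (2 * j)) * (g ^ (2 * (p - j)) * h ^ (2 * j))))"
  proof (intro sum.cong refl)
    fix j
    have "2 * p - 2 * j = 2 * (p - j)" by simp
    then show "2 * ?t (2 * j) = 2 * (real ((2 * p) choose (2 * j)) * (g ^ (2 * (p - j)) * h ^ (2 * j)))"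
      by (simp only: mult_ac)
  qed
  finally show ?thesis
    by (simp add: sum_distrib_left)
qed

text \<open>The sets \<open>K\<close> are the points of the cube,
  \<open>(- 1) ^ card (D \<inter> K)\<close> the Walsh characters and \<open>c D\<close> the
  coefficients. Splitting off one coordinate writes the function as \<open>g\<close> plus or minus
  \<open>q\<close>. Odd powers of \<open>q\<close> cancel, Hoelder's inequality bounds the mixed
  moments by the induction hypotheses for \<open>g\<close> and \<open>q\<close>, and
  \<open>binomial_double_le\<close> turns the resulting sum into the expansion of a
  \<open>p\<close>-th power.\<close>

lemma bonami:
  fixes c :: "'k set \<Rightarrow> real"
  assumes "finite H" "0 < p"
  shows "(\<Sum>K\<in>Pow H. (\<Sum>D\<in>Pow H. (- 1) ^ card (D \<inter> K) * c D) ^ (2 * p))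
    \<le> 2 ^ card H * (\<Sum>D\<in>Pow H. real (2 * p - 1) ^ card D * (c D)\<^sup>2) ^ p"
  using assms(1)
proof (induction H arbitrary: c rule: finite_induct)
  case empty
  then show ?case by (simp add: power_mult)
next
  case (insert h H)
  define g where "g K = (\<Sum>D\<in>Pow H. (- 1) ^ card (D \<inter> K) * c D)" for K
  define q where "q K = (\<Sum>D\<in>Pow H. (- 1) ^ card (D \<inter> K) * c (insert h D))" for K
  define \<alpha> where "\<alpha> = (\<Sum>D\<in>Pow H. real (2 * p - 1) ^ card D * (c D)\<^sup>2)"
  define \<beta> where "\<beta> = (\<Sum>D\<in>Pow H. real (2 * p - 1) ^ card D * (c (insert h D))\<^sup>2)"
  have split: "(\<Sum>D\<in>Pow (insert h H). f D) = (\<Sum>D\<in>Pow H. f D + f (insert h D))"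
    for f :: "'k set \<Rightarrow> real"
  proof -
    have "inj_on (insert h) (Pow H)" using insert.hyps
      by (intro inj_onI) (metis Diff_insert_absorb PowD subsetD)
    moreover have "Pow H \<inter> insert h ` Pow H = {}" using insert.hyps by auto
    ultimately show ?thesis
      using insert.hyps
      by (simp add: Pow_insert sum.union_disjoint sum.reindex sum.distrib)
  qed
  have fin: "finite D" "h \<notin> D" if "D \<subseteq> H" for D
    using that insert.hyps finite_subset by auto
  have s1: "(\<Sum>D\<in>Pow (insert h H). (- 1) ^ card (D \<inter> K) * c D) = g K + q K" if "K \<subseteq> H" for K
  proof -
    have "insert h D \<inter> K = D \<inter> K" for D using that insert.hyps by auto
    then show ?thesis unfolding split g_def q_def by (simp add: sum.distrib)
  qed
  have s2: "(\<Sum>D\<in>Pow (insert h H). (- 1) ^ card (D \<inter> insert h K) * c D) = g K - q K" if "K \<subseteq> H" for K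
  proof -
    have "(- 1) ^ card (insert h D \<inter> insert h K) = - ((- 1) ^ card (D \<inter> K) :: real)"
      "card (D \<inter> insert h K) = card (D \<inter> K)" if "D \<subseteq> H" for D
    proof -
      have "insert h D \<inter> insert h K = insert h (D \<inter> K)" by auto
      then show "(- 1) ^ card (insert h D \<inter> insert h K) = - ((- 1) ^ card (D \<inter> K) :: real)"
        using fin[OF that] by simp
      have "D \<inter> insert h K = D \<inter> K" using fin[OF that] by auto
      then show "card (D \<inter> insert h K) = card (D \<inter> K)" by simp
    qed
    then have "(\<Sum>D\<in>Pow H. (- 1) ^ card (D \<inter> insert h K) * c D
        + (- 1) ^ card (insert h D \<inter> insert h K) * c (insert h D))
      = (\<Sum>D\<in>Pow H. (- 1) ^ card (D \<inter> K) * c D - (- 1) ^ card (D \<inter> K) * c (insert h D))"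
      by (intro sum.cong refl) (metis PowD add_uminus_conv_diff mult_minus_left)
    then show ?thesis unfolding split g_def q_def
      by (simp only: sum_subtractf)
  qed
  have tot: "(\<Sum>D\<in>Pow (insert h H). real (2 * p - 1) ^ card D * (c D)\<^sup>2) = \<alpha> + real (2 * p - 1) * \<beta>"
  proof -
    have "card (insert h D) = Suc (card D)" if "D \<in> Pow H" for D using that fin by auto
    then show ?thesis
      unfolding split \<alpha>_def \<beta>_def sum.distrib sum_distrib_left
      by (intro arg_cong2[where f = "(+)"] sum.cong refl) simp
  qed
  have nn: "0 \<le> \<alpha>" "0 \<le> \<beta>" unfolding \<alpha>_def \<beta>_def by (auto intro!: sum_nonneg)
  have b: "(\<Sum>K\<in>Pow H. g K ^ (2 * p)) \<le> 2 ^ card H * \<alpha> ^ p"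
    "(\<Sum>K\<in>Pow H. q K ^ (2 * p)) \<le> 2 ^ card H * \<beta> ^ p"
    unfolding g_def q_def \<alpha>_def \<beta>_def by (rule insert.IH)+
  have "(\<Sum>K\<in>Pow (insert h H). (\<Sum>D\<in>Pow (insert h H). (- 1) ^ card (D \<inter> K) * c D) ^ (2 * p))
      = (\<Sum>K\<in>Pow H. (g K + q K) ^ (2 * p) + (g K - q K) ^ (2 * p))"
    by (subst split) (auto intro!: sum.cong simp: s1 s2)
  also have "\<dots> = 2 * (\<Sum>j\<le>p. real ((2 * p) choose (2 * j)) *
      (\<Sum>K\<in>Pow H. g K ^ (2 * (p - j)) * q K ^ (2 * j)))"
    unfolding power_even_symmetrized
    by (simp add: sum_distrib_left sum.swap[of _ "Pow H"])
  also have "\<dots> \<le> 2 * (\<Sum>j\<le>p. (real (2 * p - 1) ^ j * real (p choose j)) *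
      (2 ^ card H * (\<alpha> ^ (p - j) * \<beta> ^ j)))"
    using insert.hyps assms b nn
    by (intro mult_left_mono sum_mono mult_mono binomial_double_le sum_power_product_le)
      (auto intro!: sum_nonneg mult_nonneg_nonneg)
  also have "\<dots> = 2 ^ card (insert h H) * (\<Sum>j\<le>p. real (p choose j) * (real (2 * p - 1) * \<beta>) ^ j * \<alpha> ^ (p - j))"
    using insert.hyps by (simp add: sum_distrib_left power_mult_distrib mult_ac)
  also have "\<dots> = 2 ^ card (insert h H) * (real (2 * p - 1) * \<beta> + \<alpha>) ^ p"
    by (simp add: binomial_ring)
  finally show ?case unfolding tot by (simp add: add.commute)
qed

lemma sum_power_le_card:
  fixes u :: "'a \<Rightarrow> real"
  assumes "finite B" "0 < p"
  shows "(\<Sum>x\<in>B. u x) ^ (2 * p) \<le> real (card B) ^ (2 * p - 1) * (\<Sum>x\<in>B. u x ^ (2 * p))"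
proof (cases "B = {}")
  case True
  then show ?thesis using assms by (simp add: zero_power)
next
  case False
  let ?N = "real (card B)"
  have N: "0 < ?N" using False assms by (simp add: card_gt_0_iff)
  have "(\<Sum>x\<in>B. (1 / ?N) *\<^sub>R u x) ^ (2 * p) \<le> (\<Sum>x\<in>B. (1 / ?N) * u x ^ (2 * p))"
    using assms False
    by (intro convex_on_sum[where f = "\<lambda>x. x ^ (2 * p)" and C = UNIV] convex_power_even) auto
  then have "(\<Sum>x\<in>B. u x) ^ (2 * p) / ?N ^ (2 * p) \<le> (\<Sum>x\<in>B. u x ^ (2 * p)) / ?N"
    by (simp add: power_divide flip: sum_divide_distrib)
  then have "(\<Sum>x\<in>B. u x) ^ (2 * p) \<le> (\<Sum>x\<in>B. u x ^ (2 * p)) / ?N * ?N ^ (2 * p)"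
    using N by (simp add: pos_divide_le_eq)
  also have "?N ^ (2 * p) = ?N * ?N ^ (2 * p - 1)"
    using assms by (simp add: power_eq_if)
  finally show ?thesis using N by (simp add: mult_ac)
qed

text \<open>Each of the \<open>u\<close> factors of \<open>fact m / fact (m - u)\<close> is at least
  \<open>c\<close>.\<close>

lemma fact_diff_power_le:
  assumes "u \<le> m" "0 \<le> c" "c \<le> real (m - u)"
  shows "fact (m - u) * c ^ u \<le> (fact m :: real)"
  using assms
proof (induction u)
  case 0
  then show ?case by simp
next
  case (Suc u)
  have "fact (m - Suc u) * c ^ Suc u = (fact (m - Suc u) * c) * c ^ u" by simp
  also have "\<dots> \<le> fact (m - u) * c ^ u"
  proof (intro mult_right_mono)
    have "fact (m - u) = (real (m - u)) * (fact (m - Suc u) :: real)"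
      using Suc.prems by (metis Suc_diff_Suc Suc_le_lessD fact_Suc)
    moreover have "c \<le> real (m - u)" using Suc.prems by linarith
    ultimately show "fact (m - Suc u) * c \<le> (fact (m - u) :: real)"
      by (simp add: mult.commute mult_right_mono)
  qed (use Suc.prems in auto)
  also have "\<dots> \<le> fact m" using Suc by auto
  finally show ?case .
qed

section \<open>Permutations and a family of disjoint pairs\<close>

definition perm_ext :: "'a set \<Rightarrow> ('a \<times> 'a) set \<Rightarrow> ('a \<Rightarrow> 'a) set" where
  "perm_ext X Q = {\<tau>. \<tau> permutes X \<and> (\<forall>e\<in>Q. \<tau> (fst e) = snd e)}"

lemma finite_perm_ext: "finite X \<Longrightarrow> finite (perm_ext X Q)"
  unfolding perm_ext_def by (rule finite_subset[OF _ finite_permutations]) auto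

lemma perm_ext_insert: "perm_ext X (insert (i, j) Q) = {\<tau> \<in> perm_ext X Q. \<tau> i = j}"
  unfolding perm_ext_def by auto

lemma perm_extD: "\<tau> \<in> perm_ext X Q \<Longrightarrow> e \<in> Q \<Longrightarrow> \<tau> (fst e) = snd e"
  unfolding perm_ext_def by blast

lemma perm_ext_permutes: "\<tau> \<in> perm_ext X Q \<Longrightarrow> \<tau> permutes X"
  unfolding perm_ext_def by blast

lemma perm_ext_inj_on_fst:
  assumes "\<rho> \<in> perm_ext X Q"
  shows "inj_on fst Q"
proof (rule inj_onI)
  fix e e' assume e: "e \<in> Q" "e' \<in> Q" "fst e = fst e'"
  then have "snd e = snd e'" using perm_extD[OF assms, of e] perm_extD[OF assms, of e'] by simp
  with e(3) show "e = e'" by (simp add: prod_eq_iff)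
qed

text \<open>The permutations with prescribed values form a left coset of the pointwise stabiliser of
  the prescribed positions.\<close>

lemma perm_ext_coset:
  assumes "\<rho> \<in> perm_ext X Q" "Q \<subseteq> X \<times> X"
  shows "bij_betw (\<lambda>\<pi>. \<rho> \<circ> \<pi>) {\<pi>. \<pi> permutes (X - fst ` Q)} (perm_ext X Q)"
proof (rule bij_betw_byWitness[where f' = "\<lambda>\<tau>. inv \<rho> \<circ> \<tau>"])
  note \<rho> = perm_ext_permutes[OF assms(1)] and \<rho>Q = perm_extD[OF assms(1)]
  show "\<forall>\<pi>\<in>{\<pi>. \<pi> permutes (X - fst ` Q)}. inv \<rho> \<circ> (\<rho> \<circ> \<pi>) = \<pi>"
    using permutes_inv_o(2)[OF \<rho>] by (simp add: o_assoc)
  show "\<forall>\<tau>\<in>perm_ext X Q. \<rho> \<circ> (inv \<rho> \<circ> \<tau>) = \<tau>"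
    using permutes_inv_o(1)[OF \<rho>] by (simp add: o_assoc)
  show "(\<lambda>\<pi>. \<rho> \<circ> \<pi>) ` {\<pi>. \<pi> permutes (X - fst ` Q)} \<subseteq> perm_ext X Q"
  proof (rule image_subsetI)
    fix \<pi> assume "\<pi> \<in> {\<pi>. \<pi> permutes (X - fst ` Q)}"
    then have \<pi>: "\<pi> permutes (X - fst ` Q)" by simp
    then have "\<pi> permutes X" by (rule permutes_subset) blast
    then have 1: "\<rho> \<circ> \<pi> permutes X" using \<rho> by (rule permutes_compose)
    have 2: "(\<rho> \<circ> \<pi>) (fst e) = snd e" if "e \<in> Q" for e
    proof -
      have "\<pi> (fst e) = fst e" using that by (intro permutes_not_in[OF \<pi>]) blast
      then show ?thesis using \<rho>Q[OF that] by simp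
    qed
    show "\<rho> \<circ> \<pi> \<in> perm_ext X Q" unfolding perm_ext_def using 1 2 by blast
  qed
  show "(\<lambda>\<tau>. inv \<rho> \<circ> \<tau>) ` perm_ext X Q \<subseteq> {\<pi>. \<pi> permutes (X - fst ` Q)}"
  proof (rule image_subsetI)
    fix \<tau> assume "\<tau> \<in> perm_ext X Q"
    then have \<tau>: "\<tau> permutes X" and \<tau>Q: "\<And>e. e \<in> Q \<Longrightarrow> \<tau> (fst e) = snd e"
      unfolding perm_ext_def by blast+
    have "inv \<rho> \<circ> \<tau> permutes X"
      using \<tau> permutes_inv[OF \<rho>] by (rule permutes_compose)
    then have "inv \<rho> \<circ> \<tau> permutes (X - fst ` Q)"
    proof (rule permutes_superset)
      fix x assume "x \<in> X - (X - fst ` Q)"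
      then obtain e where e: "e \<in> Q" "x = fst e" by blast
      have "(inv \<rho> \<circ> \<tau>) x = inv \<rho> (\<rho> x)" using \<tau>Q[OF e(1)] \<rho>Q[OF e(1)] e(2) by simp
      then show "(inv \<rho> \<circ> \<tau>) x = x" using permutes_inverses(2)[OF \<rho>] by simp
    qed
    then show "inv \<rho> \<circ> \<tau> \<in> {\<pi>. \<pi> permutes (X - fst ` Q)}" by simp
  qed
qed

lemma card_perm_ext:
  assumes "finite X" "Q \<subseteq> X \<times> X" "perm_ext X Q \<noteq> {}"
  shows "card (perm_ext X Q) = fact (card X - card Q)"
proof -
  obtain \<rho> where \<rho>: "\<rho> \<in> perm_ext X Q" using assms by auto
  have "card (perm_ext X Q) = card {\<pi>. \<pi> permutes (X - fst ` Q)}"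
    using perm_ext_coset[OF \<rho> assms(2)] by (simp add: bij_betw_same_card)
  also have "\<dots> = fact (card (X - fst ` Q))"
    using assms by (intro card_permutations) auto
  also have "card (X - fst ` Q) = card X - card Q"
  proof -
    have "finite Q" using assms by (meson finite_SigmaI finite_subset)
    then have "card (fst ` Q) = card Q" "finite (fst ` Q)"
      using perm_ext_inj_on_fst[OF \<rho>] by (auto simp: card_image)
    moreover have "fst ` Q \<subseteq> X" using assms by auto
    ultimately show ?thesis by (simp add: card_Diff_subset)
  qed
  finally show ?thesis .
qed

text \<open>Contradictory prescriptions give the empty set, for which the bound is still true. So
  restrictions can be formed without checking that a new pair is compatible with the old
  ones.\<close>

lemma card_perm_ext_le:
  assumes "finite X" "Q \<subseteq> X \<times> X"
  shows "real (card (perm_ext X Q)) \<le> fact (card X - card Q)"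
proof (cases "perm_ext X Q = {}")
  case False
  then show ?thesis using card_perm_ext[OF assms False] by (simp only: of_nat_fact)
qed simp

section \<open>Disjoint pairs of values, signs and swaps\<close>

locale matching =
  fixes X :: "'a set" and H0 :: "'k set" and a b :: "'k \<Rightarrow> 'a"
  assumes finite_X: "finite X" and finite_H0: "finite H0"
    and inj_a: "inj_on a H0" and inj_b: "inj_on b H0"
    and disj: "a ` H0 \<inter> b ` H0 = {}" and sub_a: "a ` H0 \<subseteq> X" and sub_b: "b ` H0 \<subseteq> X"
begin

text \<open>The points \<open>a k\<close> and \<open>b k\<close> are values of the permutations, not
  positions. Values already prescribed by \<open>Q\<close> are kept away from the pairs with index
  in \<open>H\<close>, so that swapping such pairs maps \<open>perm_ext X Q\<close> to
  itself.\<close>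

definition avoids :: "('a \<times> 'a) set \<Rightarrow> 'k set \<Rightarrow> bool" where
  "avoids Q H \<longleftrightarrow> Q \<subseteq> X \<times> X \<and> H \<subseteq> H0 \<and> snd ` Q \<inter> (a ` H \<union> b ` H) = {}"

text \<open>A set \<open>E\<close> of pairs \<open>(k, i)\<close> on which \<open>fst\<close> is injective is the graph of a map \<open>k \<mapsto> i\<close>. The
  product \<open>sgp E\<close> changes sign whenever \<open>a k\<close> and \<open>b k\<close> are swapped for some \<open>k \<in> fst ` E\<close>.\<close>

definition sg :: "'k \<times> 'a \<Rightarrow> ('a \<Rightarrow> 'a) \<Rightarrow> real" where
  "sg e \<tau> = of_bool (\<tau> (snd e) = a (fst e)) - of_bool (\<tau> (snd e) = b (fst e))"

definition sgp :: "('k \<times> 'a) set \<Rightarrow> ('a \<Rightarrow> 'a) \<Rightarrow> real" where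
  "sgp E \<tau> = (\<Prod>e\<in>E. sg e \<tau>)"

definition hit :: "('k \<times> 'a) set \<Rightarrow> ('a \<Rightarrow> 'a) \<Rightarrow> bool" where
  "hit E \<tau> \<longleftrightarrow> (\<forall>e\<in>E. \<tau> (snd e) = a (fst e) \<or> \<tau> (snd e) = b (fst e))"

text \<open>For a permutation \<open>\<tau>\<close> these are the pairs \<open>(k, i)\<close> with
  \<open>k \<in> D\<close> such that \<open>\<tau>\<close> sends \<open>i\<close> to
  \<open>a k\<close> or \<open>b k\<close>. The set is described through preimages because these are
  what is revealed and conditioned on later.\<close>

definition hits :: "('a \<Rightarrow> 'a) \<Rightarrow> 'k set \<Rightarrow> ('k \<times> 'a) set" where
  "hits \<tau> D = (\<lambda>k. (k, inv \<tau> (a k))) ` D \<union> (\<lambda>k. (k, inv \<tau> (b k))) ` D"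

definition Es :: "'k set \<Rightarrow> nat \<Rightarrow> ('k \<times> 'a) set set" where
  "Es H d = {E. E \<subseteq> H \<times> X \<and> card E = d \<and> inj_on fst E}"

lemma ab_neq: "k \<in> H0 \<Longrightarrow> l \<in> H0 \<Longrightarrow> a k \<noteq> b l"
  using disj by blast

lemma finite_H: "H \<subseteq> H0 \<Longrightarrow> finite H"
  using finite_H0 finite_subset by blast

lemma finite_Es: "H \<subseteq> H0 \<Longrightarrow> finite (Es H d)"
  using finite_H finite_X by (intro finite_subset[of "Es H d" "Pow (H \<times> X)"]) (auto simp: Es_def)

lemma finite_E: "H \<subseteq> H0 \<Longrightarrow> E \<subseteq> H \<times> X \<Longrightarrow> finite E"
  using finite_H finite_X by (meson finite_SigmaI finite_subset)

lemma avoids_finite: "avoids Q H \<Longrightarrow> finite Q"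
  unfolding avoids_def using finite_X by (meson finite_SigmaI finite_subset)

lemma avoids_mono: "avoids Q H \<Longrightarrow> H' \<subseteq> H \<Longrightarrow> avoids Q H'"
  unfolding avoids_def by blast

text \<open>Since the pairs are disjoint, prescribing a value in pair \<open>k\<close> uses up the
  index \<open>k\<close> only; and since that value was not prescribed before, the number of
  prescriptions grows by exactly one.\<close>

lemma avoids_insert:
  assumes "avoids Q H" "k \<in> H" "i \<in> X" "H' \<subseteq> H - {k}" "j = a k \<or> j = b k"
  shows "avoids (insert (i, j) Q) H'" and "card (insert (i, j) Q) = Suc (card Q)"
proof -
  have Q: "Q \<subseteq> X \<times> X" "H \<subseteq> H0" "\<And>e l. e \<in> Q \<Longrightarrow> l \<in> H \<Longrightarrow> snd e \<noteq> a l \<and> snd e \<noteq> b l"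
    using assms(1) unfolding avoids_def by blast+
  have j: "j \<in> X" using assms(2,5) Q(2) sub_a sub_b by blast
  have l: "j \<noteq> a l \<and> j \<noteq> b l" if "l \<in> H'" for l
  proof -
    have "l \<in> H0" "k \<in> H0" "l \<noteq> k" using that assms(2,4) Q(2) by blast+
    then show ?thesis
      using assms(5) ab_neq[of k l] ab_neq[of l k] inj_onD[OF inj_a, of k l] inj_onD[OF inj_b, of k l]
      by metis
  qed
  have "insert (i, j) Q \<subseteq> X \<times> X" using Q(1) j assms(3) by blast
  moreover have "H' \<subseteq> H" using assms(4) by blast
  moreover have "snd e \<noteq> a m \<and> snd e \<noteq> b m" if "e \<in> insert (i, j) Q" "m \<in> H'" for e m
    using that l[OF that(2)] Q(3)[of e m] \<open>H' \<subseteq> H\<close> by auto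
  ultimately show "avoids (insert (i, j) Q) H'"
    unfolding avoids_def using Q(2) by blast
  have "(i, j) \<notin> Q" using Q(3)[of "(i, j)" k] assms(2,5) by auto
  then show "card (insert (i, j) Q) = Suc (card Q)"
    using avoids_finite[OF assms(1)] by simp
qed

text \<open>Each element of \<open>E\<close> leaves two possible values for its position. Fixing one
  of them is one more prescription, and its index is removed from \<open>H\<close> so that the
  others remain free.\<close>

lemma card_hit_le:
  assumes "avoids Q H" "E \<subseteq> H \<times> X" "inj_on fst E"
  shows "real (card {\<tau> \<in> perm_ext X Q. hit E \<tau>}) \<le> 2 ^ card E * fact (card X - card Q - card E)"
proof -
  have "finite E" using assms finite_E by (auto simp: avoids_def)
  then show ?thesis using assms
  proof (induction E arbitrary: Q H rule: finite_induct)
    case empty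
    then show ?case
      using card_perm_ext_le[OF finite_X, of Q] by (simp add: hit_def avoids_def)
  next
    case (insert e E)
    obtain k i where e: "e = (k, i)" by (cases e)
    let ?Q = "\<lambda>j. insert (i, j) Q"
    let ?S = "\<lambda>Q E. {\<tau> \<in> perm_ext X Q. hit E \<tau>}"
    have ki: "k \<in> H" "i \<in> X" using insert.prems e by auto
    have E: "E \<subseteq> (H - {k}) \<times> X" "inj_on fst E"
    proof -
      show "inj_on fst E" using insert.prems(3) by (rule inj_on_subset) blast
      have "fst x \<noteq> k" if "x \<in> E" for x
        using inj_onD[OF insert.prems(3), of x e] that insert.hyps(2) e by auto
      then show "E \<subseteq> (H - {k}) \<times> X" using insert.prems(2) by force
    qed
    have fin: "finite (?S Q E)" for Q E using finite_perm_ext[OF finite_X] by simp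
    have sub: "?S Q (insert e E) \<subseteq> ?S (?Q (a k)) E \<union> ?S (?Q (b k)) E"
      by (auto simp: hit_def e perm_ext_insert)
    have "real (card (?S Q (insert e E))) \<le> real (card (?S (?Q (a k)) E)) + real (card (?S (?Q (b k)) E))"
    proof -
      have "card (?S Q (insert e E)) \<le> card (?S (?Q (a k)) E \<union> ?S (?Q (b k)) E)"
        using sub fin by (intro card_mono) auto
      also have "\<dots> \<le> card (?S (?Q (a k)) E) + card (?S (?Q (b k)) E)"
        by (rule card_Un_le)
      finally show ?thesis by linarith
    qed
    also have "\<dots> \<le> 2 ^ card E * fact (card X - Suc (card Q) - card E)
        + 2 ^ card E * fact (card X - Suc (card Q) - card E)"
      using insert.IH[OF avoids_insert(1)[OF insert.prems(1) ki subset_refl] E, of "a k"]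
        insert.IH[OF avoids_insert(1)[OF insert.prems(1) ki subset_refl] E, of "b k"]
        avoids_insert(2)[OF insert.prems(1) ki subset_refl, of "a k"]
        avoids_insert(2)[OF insert.prems(1) ki subset_refl, of "b k"]
      by (intro add_mono) auto
    finally show ?case using insert.hyps by simp
  qed
qed

lemma ab_notin:
  assumes "K \<subseteq> H0" "k \<in> H0" "k \<notin> K"
  shows "a k \<notin> a ` K \<union> b ` K" "b k \<notin> a ` K \<union> b ` K"
proof -
  have "a k \<notin> a ` K" "b k \<notin> b ` K"
    using inj_on_image_mem_iff[OF inj_a assms(2,1)] inj_on_image_mem_iff[OF inj_b assms(2,1)] assms(3)
    by simp_all
  moreover have "a k \<notin> b ` K" "b k \<notin> a ` K"
    using disj assms by blast+
  ultimately show "a k \<notin> a ` K \<union> b ` K" "b k \<notin> a ` K \<union> b ` K" by simp_all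
qed

lemma swap_ex:
  assumes "K \<subseteq> H0"
  obtains s where "s permutes a ` K \<union> b ` K" "\<And>k. k \<in> K \<Longrightarrow> s (a k) = b k" "\<And>k. k \<in> K \<Longrightarrow> s (b k) = a k"
proof -
  have "\<exists>s. s permutes a ` K \<union> b ` K \<and> (\<forall>k\<in>K. s (a k) = b k \<and> s (b k) = a k)"
    using finite_H[OF assms] assms
  proof (induction K rule: finite_induct)
    case empty
    then show ?case by (auto simp: permutes_def)
  next
    case (insert k K)
    then obtain s where s: "s permutes a ` K \<union> b ` K" "\<forall>k\<in>K. s (a k) = b k \<and> s (b k) = a k"
      by auto
    let ?s = "Transposition.transpose (a k) (b k) \<circ> s"
    have k: "a k \<notin> a ` K \<union> b ` K" "b k \<notin> a ` K \<union> b ` K" "a k \<noteq> b k"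
      using insert.hyps(2) insert.prems ab_notin[of K k] ab_neq[of k k] by simp_all
    have "?s permutes a ` insert k K \<union> b ` insert k K"
      by (intro permutes_compose permutes_swap_id permutes_subset[OF s(1)]) auto
    moreover have "?s (a k) = b k" "?s (b k) = a k"
      using permutes_not_in[OF s(1) k(1)] permutes_not_in[OF s(1) k(2)] by simp_all
    moreover have "?s (a l) = b l \<and> ?s (b l) = a l" if "l \<in> K" for l
    proof -
      have "a l \<noteq> a k" "a l \<noteq> b k" "b l \<noteq> a k" "b l \<noteq> b k" using k(1,2) that by (blast dest: sym)+
      then show ?thesis using s(2) that by (simp add: Transposition.transpose_def)
    qed
    ultimately show ?case by blast
  qed
  then show thesis using that by blast
qed

text \<open>Left multiplication by \<open>s\<close> is a bijection of \<open>perm_ext X Q\<close>,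
  because \<open>s\<close> fixes every value prescribed by \<open>Q\<close>.\<close>

lemma sum_swap:
  assumes "avoids Q H" "K \<subseteq> H" "s permutes a ` K \<union> b ` K"
  shows "(\<Sum>\<tau>\<in>perm_ext X Q. f (s \<circ> \<tau>)) = (\<Sum>\<tau>\<in>perm_ext X Q. f \<tau>)"
proof -
  have s: "s permutes X"
    using assms(1,2) sub_a sub_b unfolding avoids_def by (intro permutes_subset[OF assms(3)]) blast
  have in1: "s \<circ> \<tau> \<in> perm_ext X Q" if "\<tau> \<in> perm_ext X Q" for \<tau>
  proof -
    have "s (snd e) = snd e" if "e \<in> Q" for e
      using assms(1,2) that unfolding avoids_def by (intro permutes_not_in[OF assms(3)]) blast
    then have "(s \<circ> \<tau>) (fst e) = snd e" if "e \<in> Q" for e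
      using that perm_extD[OF \<open>\<tau> \<in> perm_ext X Q\<close> that] by simp
    moreover have "s \<circ> \<tau> permutes X"
      using perm_ext_permutes[OF that] s by (rule permutes_compose)
    ultimately show ?thesis unfolding perm_ext_def by blast
  qed
  have "inj_on (\<lambda>\<tau>. s \<circ> \<tau>) (perm_ext X Q)"
    using permutes_inj[OF s] by (auto simp: inj_on_def fun_eq_iff)
  moreover from this have "(\<lambda>\<tau>. s \<circ> \<tau>) ` perm_ext X Q = perm_ext X Q"
    by (intro endo_inj_surj finite_perm_ext finite_X) (auto simp: in1)
  ultimately have "bij_betw (\<lambda>\<tau>. s \<circ> \<tau>) (perm_ext X Q) (perm_ext X Q)"
    unfolding bij_betw_def by (rule conjI)
  then show ?thesis by (rule sum.reindex_bij_betw)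
qed

lemma sg_swap:
  assumes "K \<subseteq> H0" "s permutes a ` K \<union> b ` K" "fst e \<in> H0"
    "\<And>k. k \<in> K \<Longrightarrow> s (a k) = b k" "\<And>k. k \<in> K \<Longrightarrow> s (b k) = a k"
  shows "sg e (s \<circ> \<tau>) = (if fst e \<in> K then - 1 else 1) * sg e \<tau>"
proof (cases "fst e \<in> K")
  case True
  have "s y = a (fst e) \<longleftrightarrow> y = b (fst e)" "s y = b (fst e) \<longleftrightarrow> y = a (fst e)" for y
    using inj_eq[OF permutes_inj[OF assms(2)], of y "b (fst e)"]
      inj_eq[OF permutes_inj[OF assms(2)], of y "a (fst e)"] assms(4,5)[OF True] by simp_all
  then show ?thesis using True by (simp add: sg_def)
next
  case False
  have "s (a (fst e)) = a (fst e)" "s (b (fst e)) = b (fst e)"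
    using permutes_not_in[OF assms(2)] ab_notin[OF assms(1,3) False] by simp_all
  then have "s y = a (fst e) \<longleftrightarrow> y = a (fst e)" "s y = b (fst e) \<longleftrightarrow> y = b (fst e)" for y
    using inj_eq[OF permutes_inj[OF assms(2)], of y "b (fst e)"]
      inj_eq[OF permutes_inj[OF assms(2)], of y "a (fst e)"] by simp_all
  then show ?thesis using False by (simp add: sg_def)
qed

lemma sgp_swap:
  assumes "K \<subseteq> H0" "s permutes a ` K \<union> b ` K" "E \<subseteq> H0 \<times> X" "inj_on fst E"
    "\<And>k. k \<in> K \<Longrightarrow> s (a k) = b k" "\<And>k. k \<in> K \<Longrightarrow> s (b k) = a k"
  shows "sgp E (s \<circ> \<tau>) = (- 1) ^ card (fst ` E \<inter> K) * sgp E \<tau>"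
proof -
  have fin: "finite (fst ` E)" using finite_E[OF subset_refl assms(3)] by simp
  have "sgp E (s \<circ> \<tau>) = (\<Prod>e\<in>E. (if fst e \<in> K then - 1 else 1) * sg e \<tau>)"
    unfolding sgp_def using assms by (intro prod.cong refl sg_swap) auto
  also have "\<dots> = (\<Prod>e\<in>E. if fst e \<in> K then - 1 else 1) * sgp E \<tau>"
    by (simp add: prod.distrib sgp_def)
  also have "(\<Prod>e\<in>E. if fst e \<in> K then - 1 else 1 :: real) = (\<Prod>k\<in>fst ` E. if k \<in> K then - 1 else 1)"
    using assms(4) by (simp add: prod.reindex)
  also have "\<dots> = (- 1) ^ card (fst ` E \<inter> K)"
    using fin by (simp add: prod.If_cases)
  finally show ?thesis .
qed

lemma hit_subset_hits:
  assumes "\<tau> permutes X" "hit E \<tau>" "fst ` E \<subseteq> D"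
  shows "E \<subseteq> hits \<tau> D"
proof
  fix e assume e: "e \<in> E"
  have "inv \<tau> (\<tau> (snd e)) = snd e" using assms(1) by (rule permutes_inverses)
  moreover have "\<tau> (snd e) = a (fst e) \<or> \<tau> (snd e) = b (fst e)"
    using assms(2) e unfolding hit_def by blast
  ultimately have "e = (fst e, inv \<tau> (a (fst e))) \<or> e = (fst e, inv \<tau> (b (fst e)))"
    by (auto simp: prod_eq_iff)
  moreover have "fst e \<in> D" using assms(3) e by blast
  ultimately show "e \<in> hits \<tau> D"
    unfolding hits_def by blast
qed

lemma card_hits_le: "finite D \<Longrightarrow> card (hits \<tau> D) \<le> 2 * card D"
  unfolding hits_def mult_2
  by (rule order_trans[OF card_Un_le]) (intro add_mono card_image_le)

lemma finite_hits: "finite D \<Longrightarrow> finite (hits \<tau> D)"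
  unfolding hits_def by simp

lemma sgp_eq_0: "finite E \<Longrightarrow> \<not> hit E \<tau> \<Longrightarrow> sgp E \<tau> = 0"
  unfolding sgp_def hit_def sg_def by (auto simp: prod_zero_iff)

lemma abs_sgp_le_1: "\<bar>sgp E \<tau>\<bar> \<le> 1"
proof -
  have "\<bar>sg e \<tau>\<bar> \<le> 1" for e by (auto simp: sg_def)
  then show ?thesis unfolding sgp_def abs_prod by (intro prod_le_1) auto
qed

section \<open>From the chaos to a sum of nonnegative terms\<close>

definition v :: "(('k \<times> 'a) set \<Rightarrow> real) \<Rightarrow> 'k set \<Rightarrow> nat \<Rightarrow> ('a \<Rightarrow> 'a) \<Rightarrow> real" where
  "v c H d \<tau> = (\<Sum>E\<in>Es H d. (c E)\<^sup>2 * of_bool (hit E \<tau>))"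

text \<open>Only sets contained in \<open>hits \<tau> D\<close>, which has at most
  \<open>2 * d\<close> elements, contribute. So at most \<open>4 ^ d\<close> terms are nonzero, and
  this is the price of Cauchy-Schwarz.\<close>

lemma sum_fibre_square_le:
  assumes "H \<subseteq> H0" "\<tau> permutes X"
  shows "(\<Sum>E\<in>{E \<in> Es H d. fst ` E = D}. c E * sgp E \<tau>)\<^sup>2
    \<le> 4 ^ d * (\<Sum>E\<in>{E \<in> Es H d. fst ` E = D}. (c E)\<^sup>2 * of_bool (hit E \<tau>))"
proof -
  let ?A = "{E \<in> Es H d. fst ` E = D}" and ?F = "{E \<in> Es H d. fst ` E = D \<and> hit E \<tau>}"
  have finA: "finite ?A" "finite ?F" using finite_Es[OF assms(1)] by auto
  show ?thesis
  proof (cases "?A = {}")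
    case True
    show ?thesis unfolding True by simp
  next
    case False
    then obtain E0 where E0: "E0 \<in> Es H d" "fst ` E0 = D" by blast
    then have "E0 \<subseteq> H \<times> X" "card E0 = d" "inj_on fst E0" unfolding Es_def by simp_all
    then have D: "finite D" "card D = d"
      using finite_imageI[OF finite_E[OF assms(1)], of E0 fst] card_image[of fst E0] E0(2) by simp_all
    have "?F \<subseteq> Pow (hits \<tau> D)"
    proof
      fix E assume "E \<in> ?F"
      then have "hit E \<tau>" "fst ` E \<subseteq> D" by simp_all
      then have "E \<subseteq> hits \<tau> D" by (rule hit_subset_hits[OF assms(2)])
      then show "E \<in> Pow (hits \<tau> D)" by simp
    qed
    then have "card ?F \<le> card (Pow (hits \<tau> D))"
      using finite_hits[OF D(1)] by (intro card_mono) auto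
    also have "\<dots> \<le> 2 ^ (2 * d)"
    proof -
      have "card (hits \<tau> D) \<le> 2 * d" using card_hits_le[OF D(1), of \<tau>] D(2) by simp
      then show ?thesis unfolding card_Pow[OF finite_hits[OF D(1)]] by (rule power_increasing) simp
    qed
    also have "\<dots> = 4 ^ d" by (simp add: power_mult)
    finally have "real (card ?F) \<le> real (4 ^ d)" by (rule of_nat_mono)
    then have cF: "real (card ?F) \<le> 4 ^ d" by simp
    have "(\<Sum>E\<in>?A. c E * sgp E \<tau>) = (\<Sum>E\<in>?F. c E * sgp E \<tau>)"
    proof (intro sum.mono_neutral_right finA ballI)
      fix E assume "E \<in> ?A - ?F"
      then have "E \<subseteq> H \<times> X" "\<not> hit E \<tau>" unfolding Es_def by blast+
      then show "c E * sgp E \<tau> = 0" using sgp_eq_0[OF finite_E[OF assms(1)]] by simp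
    qed blast
    then have "(\<Sum>E\<in>?A. c E * sgp E \<tau>)\<^sup>2 \<le> (\<Sum>E\<in>?F. (c E * sgp E \<tau>)\<^sup>2) * card ?F"
      using sum_squared_le_sum_of_squares[of "\<lambda>E. c E * sgp E \<tau>" ?F] by simp
    also have "\<dots> \<le> (\<Sum>E\<in>?F. (c E)\<^sup>2) * 4 ^ d"
    proof (intro mult_mono sum_mono cF)
      fix E
      have "(sgp E \<tau>)\<^sup>2 \<le> 1" using abs_sgp_le_1[of E \<tau>] by (simp only: abs_square_le_1)
      then show "(c E * sgp E \<tau>)\<^sup>2 \<le> (c E)\<^sup>2"
        using mult_left_mono[of "(sgp E \<tau>)\<^sup>2" 1 "(c E)\<^sup>2"] by (simp add: power_mult_distrib)
    qed (auto intro!: sum_nonneg)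
    also have "(\<Sum>E\<in>?F. (c E)\<^sup>2) = (\<Sum>E\<in>?A. (c E)\<^sup>2 * of_bool (hit E \<tau>))"
      by (rule sum.mono_neutral_cong_left) (use finA in auto)
    finally show ?thesis by (simp add: mult.commute)
  qed
qed

text \<open>Averaging over the group generated by the swaps of \<open>a k\<close> and \<open>b k\<close> turns the sum into a
  homogeneous Rademacher chaos on each orbit.\<close>

lemma hypercontractive:
  assumes "avoids Q H" "0 < p"
  shows "(\<Sum>\<tau>\<in>perm_ext X Q. (\<Sum>E\<in>Es H d. c E * sgp E \<tau>) ^ (2 * p))
    \<le> (\<Sum>\<tau>\<in>perm_ext X Q. ((8 * real p) ^ d * v c H d \<tau>) ^ p)"
proof -
  have H: "H \<subseteq> H0" and finH: "finite H" using assms finite_H by (auto simp: avoids_def)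
  define U where "U \<tau> = (\<Sum>E\<in>Es H d. c E * sgp E \<tau>)" for \<tau>
  define cD where "cD \<tau> D = (\<Sum>E\<in>{E \<in> Es H d. fst ` E = D}. c E * sgp E \<tau>)" for \<tau> D
  have img: "(\<lambda>E. fst ` E) ` Es H d \<subseteq> Pow H" by (auto simp: Es_def)
  \<comment> \<open>Swapping the pairs with index in \<open>K\<close> permutes the summands, while
    the part of \<open>U\<close> lying over \<open>D\<close> is multiplied by the Walsh character of
    \<open>D\<close> at \<open>K\<close>. Thus \<open>cD \<tau>\<close> is the coefficient function
    for Bonami's inequality on the orbit of \<open>\<tau>\<close>.\<close>
  have flip: "(\<Sum>\<tau>\<in>perm_ext X Q. U \<tau> ^ (2 * p))
      = (\<Sum>\<tau>\<in>perm_ext X Q. (\<Sum>D\<in>Pow H. (- 1) ^ card (D \<inter> K) * cD \<tau> D) ^ (2 * p))"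
    if K: "K \<in> Pow H" for K
  proof -
    have KH: "K \<subseteq> H0" "K \<subseteq> H" using K H by auto
    from swap_ex[OF KH(1)] obtain s where s: "s permutes a ` K \<union> b ` K"
      "\<And>k. k \<in> K \<Longrightarrow> s (a k) = b k" "\<And>k. k \<in> K \<Longrightarrow> s (b k) = a k" by blast
    have "U (s \<circ> \<tau>) = (\<Sum>D\<in>Pow H. (- 1) ^ card (D \<inter> K) * cD \<tau> D)" for \<tau>
    proof -
      have "U (s \<circ> \<tau>) = (\<Sum>E\<in>Es H d. (- 1) ^ card (fst ` E \<inter> K) * (c E * sgp E \<tau>))"
        unfolding U_def
      proof (intro sum.cong refl)
        fix E assume "E \<in> Es H d"
        then have "E \<subseteq> H0 \<times> X" "inj_on fst E" using H by (auto simp: Es_def)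
        from sgp_swap[OF KH(1) s(1) this s(2,3)]
        show "c E * sgp E (s \<circ> \<tau>) = (- 1) ^ card (fst ` E \<inter> K) * (c E * sgp E \<tau>)" by simp
      qed
      also have "\<dots> = (\<Sum>D\<in>Pow H. \<Sum>E\<in>{E \<in> Es H d. fst ` E = D}. (- 1) ^ card (fst ` E \<inter> K) * (c E * sgp E \<tau>))"
        by (rule sum.group[OF finite_Es[OF H] _ img, symmetric]) (use finH in simp)
      also have "\<dots> = (\<Sum>D\<in>Pow H. (- 1) ^ card (D \<inter> K) * cD \<tau> D)"
        unfolding cD_def sum_distrib_left by (intro sum.cong refl) simp
      finally show ?thesis .
    qed
    then show ?thesis using sum_swap[OF assms(1) KH(2) s(1), of "\<lambda>\<tau>. U \<tau> ^ (2 * p)"] by simp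
  qed
  have "2 ^ card H * (\<Sum>\<tau>\<in>perm_ext X Q. U \<tau> ^ (2 * p)) = (\<Sum>K\<in>Pow H. \<Sum>\<tau>\<in>perm_ext X Q. U \<tau> ^ (2 * p))"
    using finH by (simp add: card_Pow)
  also have "\<dots> = (\<Sum>K\<in>Pow H. \<Sum>\<tau>\<in>perm_ext X Q. (\<Sum>D\<in>Pow H. (- 1) ^ card (D \<inter> K) * cD \<tau> D) ^ (2 * p))"
    by (intro sum.cong refl flip)
  also have "\<dots> = (\<Sum>\<tau>\<in>perm_ext X Q. \<Sum>K\<in>Pow H. (\<Sum>D\<in>Pow H. (- 1) ^ card (D \<inter> K) * cD \<tau> D) ^ (2 * p))"
    by (rule sum.swap)
  also have "\<dots> \<le> (\<Sum>\<tau>\<in>perm_ext X Q. 2 ^ card H * ((8 * real p) ^ d * v c H d \<tau>) ^ p)"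
  proof (intro sum_mono)
    fix \<tau> assume "\<tau> \<in> perm_ext X Q"
    then have \<tau>: "\<tau> permutes X" by (simp add: perm_ext_def)
    have "(\<Sum>K\<in>Pow H. (\<Sum>D\<in>Pow H. (- 1) ^ card (D \<inter> K) * cD \<tau> D) ^ (2 * p))
        \<le> 2 ^ card H * (\<Sum>D\<in>Pow H. real (2 * p - 1) ^ card D * (cD \<tau> D)\<^sup>2) ^ p"
      by (rule bonami[OF finH assms(2)])
    also have "\<dots> \<le> 2 ^ card H * ((8 * real p) ^ d * v c H d \<tau>) ^ p"
    proof (intro mult_left_mono power_mono)
      have "(\<Sum>D\<in>Pow H. real (2 * p - 1) ^ card D * (cD \<tau> D)\<^sup>2)
        \<le> (\<Sum>D\<in>Pow H. (8 * real p) ^ d * (\<Sum>E\<in>{E \<in> Es H d. fst ` E = D}. (c E)\<^sup>2 * of_bool (hit E \<tau>)))"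
      proof (intro sum_mono)
        fix D
        show "real (2 * p - 1) ^ card D * (cD \<tau> D)\<^sup>2
          \<le> (8 * real p) ^ d * (\<Sum>E\<in>{E \<in> Es H d. fst ` E = D}. (c E)\<^sup>2 * of_bool (hit E \<tau>))"
        proof (cases "card D = d")
          case False
          have "card (fst ` E) = d" if "E \<in> Es H d" for E
            using that unfolding Es_def by (simp add: card_image)
          then have empty: "{E \<in> Es H d. fst ` E = D} = {}" using False by blast
          show ?thesis unfolding cD_def empty by simp
        next
          case True
          \<comment> \<open>Per level, Bonami's inequality costs 2p-1, at most 2p, and
            Cauchy-Schwarz on the fibre over \<open>D\<close> costs 4; hence 8p.\<close>
          have "real (2 * p - 1) ^ card D * (cD \<tau> D)\<^sup>2 \<le> real (2 * p) ^ d *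
              (4 ^ d * (\<Sum>E\<in>{E \<in> Es H d. fst ` E = D}. (c E)\<^sup>2 * of_bool (hit E \<tau>)))"
            unfolding True cD_def
            by (intro mult_mono power_mono sum_fibre_square_le H \<tau> mult_nonneg_nonneg sum_nonneg) simp_all
          also have "\<dots> = (8 * real p) ^ d * (\<Sum>E\<in>{E \<in> Es H d. fst ` E = D}. (c E)\<^sup>2 * of_bool (hit E \<tau>))"
          proof -
            have "real (2 * p) ^ d * 4 ^ d = (8 * real p) ^ d"
              unfolding power_mult_distrib[symmetric] by simp
            then show ?thesis unfolding mult.assoc[symmetric] by simp
          qed
          finally show ?thesis .
        qed
      qed
      also have "\<dots> = (8 * real p) ^ d * v c H d \<tau>"
        unfolding v_def sum_distrib_left[symmetric]
        by (subst sum.group[OF finite_Es[OF H] _ img]) (use finH in simp_all)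
      finally show "(\<Sum>D\<in>Pow H. real (2 * p - 1) ^ card D * (cD \<tau> D)\<^sup>2) \<le> (8 * real p) ^ d * v c H d \<tau>" .
    qed (auto intro!: sum_nonneg)
    finally show "(\<Sum>K\<in>Pow H. (\<Sum>D\<in>Pow H. (- 1) ^ card (D \<inter> K) * cD \<tau> D) ^ (2 * p))
      \<le> 2 ^ card H * ((8 * real p) ^ d * v c H d \<tau>) ^ p" .
  qed
  also have "\<dots> = 2 ^ card H * (\<Sum>\<tau>\<in>perm_ext X Q. ((8 * real p) ^ d * v c H d \<tau>) ^ p)"
    by (simp add: sum_distrib_left)
  finally show ?thesis by (simp add: U_def)
qed

section \<open>Conditioning on the positions of revealed pairs, and moments\<close>

definition atom :: "('a \<times> 'a) set \<Rightarrow> 'k set \<Rightarrow> ('a \<Rightarrow> 'a) \<Rightarrow> ('a \<times> 'a) set" where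
  "atom Q O' \<rho> = Q \<union> ((\<lambda>k. (inv \<rho> (a k), a k)) ` O' \<union> (\<lambda>k. (inv \<rho> (b k), b k)) ` O')"

text \<open>The sets \<open>perm_ext X (atom Q O' \<rho>)\<close> are the classes of
  \<open>perm_ext X Q\<close> under having the same preimages of all points \<open>a k\<close>,
  \<open>b k\<close> with \<open>k \<in> O'\<close>. Conditioning on revealed positions is therefore
  again a restriction by prescribed values.\<close>

lemma perm_ext_atom_iff:
  assumes "\<rho> \<in> perm_ext X Q" "O' \<subseteq> H0"
  shows "\<tau> \<in> perm_ext X (atom Q O' \<rho>) \<longleftrightarrow>
    \<tau> \<in> perm_ext X Q \<and> (\<forall>k\<in>O'. inv \<tau> (a k) = inv \<rho> (a k) \<and> inv \<tau> (b k) = inv \<rho> (b k))"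
proof -
  have i: "\<tau> x = y \<longleftrightarrow> inv \<tau> y = x" if "\<tau> permutes X" for x y
    using permutes_inv_eq[OF that] by blast
  have *: "\<tau> \<in> perm_ext X (atom Q O' \<rho>) \<longleftrightarrow> \<tau> \<in> perm_ext X Q \<and>
      (\<forall>k\<in>O'. \<tau> (inv \<rho> (a k)) = a k \<and> \<tau> (inv \<rho> (b k)) = b k)"
    unfolding perm_ext_def atom_def by (simp add: ball_Un ball_conj_distrib)
  show ?thesis
  proof (cases "\<tau> \<in> perm_ext X Q")
    case True
    show ?thesis unfolding * i[OF perm_ext_permutes[OF True]] ..
  qed (simp add: *)
qed

lemma card_atom:
  assumes "\<rho> \<in> perm_ext X Q" "avoids Q H" "O' \<subseteq> H"
  shows "card (atom Q O' \<rho>) = card Q + 2 * card O'" and "avoids (atom Q O' \<rho>) (H - O')"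
proof -
  have av: "Q \<subseteq> X \<times> X" "H \<subseteq> H0" "\<And>e l. e \<in> Q \<Longrightarrow> l \<in> H \<Longrightarrow> snd e \<noteq> a l \<and> snd e \<noteq> b l"
    using assms(2) unfolding avoids_def by blast+
  have O': "O' \<subseteq> H0" "finite O'" using av(2) assms(3) finite_H by blast+
  let ?A = "(\<lambda>k. (inv \<rho> (a k), a k)) ` O'" and ?B = "(\<lambda>k. (inv \<rho> (b k), b k)) ` O'"
  have inj: "inj_on (\<lambda>k. (g k, h k)) O'" if "inj_on h O'" for g h :: "'k \<Rightarrow> 'a"
  proof (rule inj_onI)
    fix x y assume "x \<in> O'" "y \<in> O'" "(g x, h x) = (g y, h y)"
    then show "x = y" using inj_onD[OF that, of x y] by simp
  qed
  have cA: "card ?A = card O'" by (rule card_image[OF inj[OF inj_on_subset[OF inj_a O'(1)]]])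
  have cB: "card ?B = card O'" by (rule card_image[OF inj[OF inj_on_subset[OF inj_b O'(1)]]])
  have mem: "\<exists>k\<in>O'. e = (inv \<rho> (a k), a k) \<or> e = (inv \<rho> (b k), b k)" if "e \<in> ?A \<union> ?B" for e
    using that by (elim UnE imageE) (simp, blast)+
  have d1: "?A \<inter> ?B = {}"
  proof (rule equals0I)
    fix e assume "e \<in> ?A \<inter> ?B"
    then obtain k l where "k \<in> O'" "l \<in> O'" "snd e = a k" "snd e = b l"
      by (elim IntE imageE) simp
    then show False using ab_neq[of k l] O'(1) by auto
  qed
  have d2: "Q \<inter> (?A \<union> ?B) = {}"
  proof (rule equals0I)
    fix e assume "e \<in> Q \<inter> (?A \<union> ?B)"
    then have e: "e \<in> Q" "e \<in> ?A \<union> ?B" by simp_all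
    from mem[OF e(2)] obtain k where "k \<in> O'" "snd e = a k \<or> snd e = b k" by auto
    then show False using av(3)[OF e(1), of k] assms(3) by auto
  qed
  show "card (atom Q O' \<rho>) = card Q + 2 * card O'"
  proof -
    have "card (?A \<union> ?B) = 2 * card O'"
      using card_Un_disjoint[OF finite_imageI[OF O'(2)] finite_imageI[OF O'(2)] d1] cA cB by simp
    then show ?thesis
      unfolding atom_def using card_Un_disjoint[OF avoids_finite[OF assms(2)] _ d2] O'(2) by simp
  qed
  have inv: "inv \<rho> x \<in> X" if "x \<in> X" for x
    using permutes_in_image[OF permutes_inv[OF perm_ext_permutes[OF assms(1)]]] that by simp
  have abX: "a k \<in> X" "b k \<in> X" if "k \<in> O'" for k using that O'(1) sub_a sub_b by blast+
  have "e \<in> X \<times> X" if "e \<in> atom Q O' \<rho>" for e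
  proof (cases "e \<in> Q")
    case True then show ?thesis using av(1) by (rule rev_subsetD)
  next
    case False
    then have "e \<in> ?A \<union> ?B" using that unfolding atom_def by simp
    from mem[OF this] obtain k where "k \<in> O'" "e = (inv \<rho> (a k), a k) \<or> e = (inv \<rho> (b k), b k)" by (rule bexE)
    then show ?thesis using inv abX[of k] by (elim disjE) simp_all
  qed
  moreover have "snd e \<notin> a ` (H - O') \<union> b ` (H - O')" if "e \<in> atom Q O' \<rho>" for e
  proof (cases "e \<in> Q")
    case True then show ?thesis using av(3)[OF True] by auto
  next
    case False
    then have "e \<in> ?A \<union> ?B" using that unfolding atom_def by simp
    from mem[OF this] obtain k where k: "k \<in> O'" "snd e = a k \<or> snd e = b k" by auto
    have "H - O' \<subseteq> H0" "k \<in> H0" "k \<notin> H - O'" using k(1) O'(1) av(2) by blast+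
    from ab_notin[OF this] k(2) show ?thesis by (elim disjE) simp_all
  qed
  ultimately show "avoids (atom Q O' \<rho>) (H - O')"
    using av(2) unfolding avoids_def by (intro conjI subsetI equals0I) (blast, blast, elim IntE imageE, simp)
qed

lemma hits_cong:
  assumes "\<And>k. k \<in> O' \<Longrightarrow> inv \<tau> (a k) = inv \<rho> (a k)" "\<And>k. k \<in> O' \<Longrightarrow> inv \<tau> (b k) = inv \<rho> (b k)"
  shows "hits \<tau> O' = hits \<rho> O'"
  unfolding hits_def by (intro arg_cong2[where f = "(\<union>)"] image_cong refl) (simp_all add: assms)

lemma hits_subset:
  assumes "\<rho> permutes X" "O' \<subseteq> H0"
  shows "hits \<rho> O' \<subseteq> O' \<times> X"
proof -
  have "inv \<rho> x \<in> X" if "x \<in> X" for x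
    using permutes_in_image[OF permutes_inv[OF assms(1)]] that by blast
  then show ?thesis unfolding hits_def using assms(2) sub_a sub_b by blast
qed

lemma sum_v:
  assumes "H \<subseteq> H0" "finite P"
  shows "(\<Sum>\<tau>\<in>P. v c H d \<tau>) = (\<Sum>E\<in>Es H d. (c E)\<^sup>2 * real (card {\<tau> \<in> P. hit E \<tau>}))"
proof -
  have "(\<Sum>\<tau>\<in>P. v c H d \<tau>) = (\<Sum>E\<in>Es H d. \<Sum>\<tau>\<in>P. (c E)\<^sup>2 * of_bool (hit E \<tau>))"
    unfolding v_def by (rule sum.swap)
  also have "\<dots> = (\<Sum>E\<in>Es H d. (c E)\<^sup>2 * real (card {\<tau> \<in> P. hit E \<tau>}))"
    using assms(2) by (simp add: sum_distrib_left[symmetric] Int_def of_bool_def sum.If_cases)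
  finally show ?thesis .
qed

text \<open>Given the preimages of all the points \<open>a k\<close>, \<open>b k\<close> with \<open>k \<in> O'\<close>, the part of \<open>E\<close> lying
  over \<open>O'\<close> is one of boundedly many sets, and the rest of \<open>E\<close> is hit with its typical probability.\<close>

lemma sum_v_atom_le:
  fixes c :: "('k \<times> 'a) set \<Rightarrow> real" and R :: "nat \<Rightarrow> real"
  assumes av: "avoids Q H" and O': "O' \<subseteq> H" and \<rho>: "\<rho> \<in> perm_ext X Q"
    and size: "real (card X) / 2 + real (card Q + 2 * card O' + d) \<le> real (card X)" and X: "X \<noteq> {}"
    and R0: "\<And>t. 0 \<le> R t"
    and R: "\<And>T. T \<subseteq> O' \<times> X \<Longrightarrow> inj_on fst T \<Longrightarrow> card T \<le> d \<Longrightarrow>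
      (\<Sum>E\<in>Es (H - O') (d - card T). (c (T \<union> E))\<^sup>2) \<le> R (card T)"
  shows "(\<Sum>\<tau>\<in>perm_ext X (atom Q O' \<rho>). v c H d \<tau>) \<le> real (card (perm_ext X (atom Q O' \<rho>))) *
    (\<Sum>t\<le>d. real ((2 * card O') choose t) * (4 / real (card X)) ^ (d - t) * R t)"
proof -
  let ?n = "real (card X)" and ?P = "perm_ext X (atom Q O' \<rho>)"
  define N where "N = card X - (card Q + 2 * card O')"
  \<comment> \<open>\<open>\<Theta>\<close> contains every possible part over \<open>O'\<close> of a
    set that is hit by some permutation of the atom. \<open>g t\<close> bounds the number of
    permutations in the atom that hit a set with \<open>t\<close> elements over
    \<open>O'\<close>.\<close>
  define \<Theta> where "\<Theta> = {T \<in> Pow (hits \<rho> O'). inj_on fst T \<and> card T \<le> d}"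
  define g where "g t = fact N * (4 / ?n) ^ (d - t)" for t
  have H: "H \<subseteq> H0" using av by (simp add: avoids_def)
  have O0: "O' \<subseteq> H0" "finite O'" using H O' finite_H by blast+
  have n: "0 < ?n" using X finite_X by (simp add: card_gt_0_iff)
  have fP: "finite ?P" by (rule finite_perm_ext[OF finite_X])
  have "\<rho> \<in> ?P" using perm_ext_atom_iff[OF \<rho> O0(1)] \<rho> by blast
  then have ne: "?P \<noteq> {}" by blast
  note cat = card_atom[OF \<rho> av O']
  have atX: "atom Q O' \<rho> \<subseteq> X \<times> X" using cat(2) by (simp add: avoids_def)
  have cP: "real (card ?P) = fact N"
    unfolding card_perm_ext[OF finite_X atX ne] cat(1) N_def by simp
  have hP: "hits \<rho> O' \<subseteq> O' \<times> X" by (rule hits_subset[OF perm_ext_permutes[OF \<rho>] O0(1)])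
  have fh: "finite (hits \<rho> O')" by (rule finite_hits[OF O0(2)])
  have g0: "0 \<le> g t" for t unfolding g_def by simp
  have cnt: "real (card {\<tau> \<in> ?P. hit E \<tau>})
      \<le> (if E \<inter> (O' \<times> X) \<in> \<Theta> then g (card (E \<inter> (O' \<times> X))) else 0)"
    if E: "E \<in> Es H d" for E
  proof -
    define T where "T = E \<inter> (O' \<times> X)"
    define F where "F = E - (O' \<times> X)"
    have EH: "E \<subseteq> H \<times> X" "card E = d" "inj_on fst E" using E unfolding Es_def by blast+
    have fE: "finite E" by (rule finite_E[OF H EH(1)])
    have cT: "card T \<le> d" unfolding T_def EH(2)[symmetric] by (rule card_mono[OF fE]) blast
    have cF: "card F = d - card T"
      unfolding F_def T_def using card_Diff_subset_Int[of E "O' \<times> X"] fE EH(2) by simp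
    have "card {\<tau> \<in> ?P. hit E \<tau>} = 0" if "T \<notin> \<Theta>"
    proof (rule ccontr)
      assume "card {\<tau> \<in> ?P. hit E \<tau>} \<noteq> 0"
      then have "{\<tau> \<in> ?P. hit E \<tau>} \<noteq> {}" by (metis card.empty)
      then obtain \<tau> where \<tau>: "\<tau> \<in> ?P" "hit E \<tau>" by blast
      have "hit T \<tau>" using \<tau>(2) unfolding hit_def T_def by blast
      moreover have "fst ` T \<subseteq> O'" unfolding T_def by auto
      ultimately have "T \<subseteq> hits \<tau> O'" using hit_subset_hits[OF perm_ext_permutes[OF \<tau>(1)]] by blast
      also have "hits \<tau> O' = hits \<rho> O'"
        using \<tau>(1) unfolding perm_ext_atom_iff[OF \<rho> O0(1)] by (intro hits_cong) blast+
      finally have "T \<in> \<Theta>" unfolding \<Theta>_def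
        using cT inj_on_subset[OF EH(3), of T] unfolding T_def by blast
      then show False using that by blast
    qed
    moreover have "real (card {\<tau> \<in> ?P. hit E \<tau>}) \<le> g (card T)"
    proof -
      have "{\<tau> \<in> ?P. hit E \<tau>} \<subseteq> {\<tau> \<in> ?P. hit F \<tau>}" unfolding hit_def F_def by blast
      then have "real (card {\<tau> \<in> ?P. hit E \<tau>}) \<le> real (card {\<tau> \<in> ?P. hit F \<tau>})"
        using fP by (intro of_nat_mono card_mono) simp_all
      also have "\<dots> \<le> 2 ^ card F * fact (card X - card (atom Q O' \<rho>) - card F)"
      proof (rule card_hit_le[OF cat(2)])
        show "F \<subseteq> (H - O') \<times> X" using EH(1) unfolding F_def by auto
        show "inj_on fst F" using EH(3) unfolding F_def by (rule inj_on_subset) blast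
      qed
      also have "\<dots> = 2 ^ (d - card T) * fact (N - (d - card T))"
        unfolding cF cat(1) N_def by simp
      also have "\<dots> \<le> g (card T)"
      proof -
        \<comment> \<open>At least half of the points stay free, so each of the
          \<open>d - card T\<close> unrevealed elements is hit with conditional probability at most
          2 / (n/2) = 4/n, where n is \<open>card X\<close>.\<close>
        have "real (d - card T) + ?n / 2 + real (card Q + 2 * card O') \<le> ?n" using size by linarith
        then have "d - card T \<le> N" "?n / 2 \<le> real (N - (d - card T))" unfolding N_def by linarith+
        from fact_diff_power_le[OF this(1) _ this(2)]
        have "fact (N - (d - card T)) * (?n / 2) ^ (d - card T) \<le> fact N" by simp
        then have "fact (N - (d - card T)) \<le> fact N / (?n / 2) ^ (d - card T)"
          using n by (simp add: pos_le_divide_eq)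
        also have "\<dots> = fact N * (2 / ?n) ^ (d - card T)" by (simp add: power_divide)
        finally have "2 ^ (d - card T) * fact (N - (d - card T))
            \<le> 2 ^ (d - card T) * (fact N * (2 / ?n) ^ (d - card T))"
          by (rule mult_left_mono) simp
        also have "\<dots> = g (card T)" unfolding g_def by (simp flip: power_mult_distrib)
        finally show ?thesis .
      qed
      finally show ?thesis .
    qed
    ultimately show ?thesis unfolding T_def[symmetric] by (cases "T \<in> \<Theta>") simp_all
  qed
  have f\<Theta>: "finite \<Theta>" unfolding \<Theta>_def using fh by simp
  have fEs: "finite (Es H d)" by (rule finite_Es[OF H])
  let ?E\<Theta> = "{E \<in> Es H d. E \<inter> (O' \<times> X) \<in> \<Theta>}"
  have "(\<Sum>\<tau>\<in>?P. v c H d \<tau>) = (\<Sum>E\<in>Es H d. (c E)\<^sup>2 * real (card {\<tau> \<in> ?P. hit E \<tau>}))"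
    by (rule sum_v[OF H fP])
  also have "\<dots> \<le> (\<Sum>E\<in>Es H d. (c E)\<^sup>2 *
      (if E \<inter> (O' \<times> X) \<in> \<Theta> then g (card (E \<inter> (O' \<times> X))) else 0))"
    by (intro sum_mono mult_left_mono cnt) simp_all
  also have "\<dots> = (\<Sum>E\<in>?E\<Theta>. (c E)\<^sup>2 * g (card (E \<inter> (O' \<times> X))))"
    by (rule sum.mono_neutral_cong_right) (use fEs in auto)
  also have "\<dots> = (\<Sum>T\<in>\<Theta>. \<Sum>E\<in>{E \<in> ?E\<Theta>. E \<inter> (O' \<times> X) = T}. (c E)\<^sup>2 * g (card (E \<inter> (O' \<times> X))))"
    by (rule sum.group[symmetric]) (use fEs f\<Theta> in auto)
  also have "\<dots> \<le> (\<Sum>T\<in>\<Theta>. R (card T) * g (card T))"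
  proof (rule sum_mono)
    fix T assume T: "T \<in> \<Theta>"
    then have TT: "T \<subseteq> O' \<times> X" "inj_on fst T" "card T \<le> d" unfolding \<Theta>_def using hP by blast+
    let ?ET = "{E \<in> ?E\<Theta>. E \<inter> (O' \<times> X) = T}" and ?F = "Es (H - O') (d - card T)"
    have fF: "finite ?F" using H by (intro finite_Es) blast
    have sub: "?ET \<subseteq> (\<lambda>F. T \<union> F) ` ?F"
    proof
      fix E assume "E \<in> ?ET"
      then have E: "E \<subseteq> H \<times> X" "card E = d" "inj_on fst E" "E \<inter> (O' \<times> X) = T"
        unfolding Es_def by blast+
      let ?D = "E - O' \<times> X"
      have "card ?D = d - card T"
        using card_Diff_subset_Int[of E "O' \<times> X"] finite_subset[of T E] finite_E[OF H E(1)] E(2,4) by auto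
      moreover have "inj_on fst ?D" using E(3) by (rule inj_on_subset) blast
      moreover have "?D \<subseteq> (H - O') \<times> X" using E(1) by auto
      ultimately have "?D \<in> ?F" unfolding Es_def by blast
      moreover have "E = T \<union> ?D" using E(4) by blast
      ultimately show "E \<in> (\<lambda>F. T \<union> F) ` ?F" by blast
    qed
    have "(\<Sum>E\<in>?ET. (c E)\<^sup>2 * g (card (E \<inter> (O' \<times> X)))) = (\<Sum>E\<in>?ET. (c E)\<^sup>2) * g (card T)"
      unfolding sum_distrib_right by (rule sum.cong) simp_all
    also have "\<dots> \<le> R (card T) * g (card T)"
    proof (rule mult_right_mono[OF _ g0])
      have "(\<Sum>E\<in>?ET. (c E)\<^sup>2) \<le> (\<Sum>E\<in>(\<lambda>F. T \<union> F) ` ?F. (c E)\<^sup>2)"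
        using fF sub by (intro sum_mono2) simp_all
      also have "\<dots> \<le> (\<Sum>F\<in>?F. (c (T \<union> F))\<^sup>2)"
        using sum_image_le[OF fF, of "\<lambda>E. (c E)\<^sup>2" "\<lambda>F. T \<union> F"] by (simp add: o_def)
      also have "\<dots> \<le> R (card T)" by (rule R[OF TT])
      finally show "(\<Sum>E\<in>?ET. (c E)\<^sup>2) \<le> R (card T)" .
    qed
    finally show "(\<Sum>E\<in>?ET. (c E)\<^sup>2 * g (card (E \<inter> (O' \<times> X)))) \<le> R (card T) * g (card T)" .
  qed
  also have "\<dots> \<le> (\<Sum>T\<in>{T \<in> Pow (hits \<rho> O'). card T \<le> d}. R (card T) * g (card T))"
    by (rule sum_mono2) (use fh R0 g0 in \<open>auto simp: \<Theta>_def\<close>)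
  also have "\<dots> = (\<Sum>t\<in>{..d}. \<Sum>T\<in>{T \<in> {T \<in> Pow (hits \<rho> O'). card T \<le> d}. card T = t}. R (card T) * g (card T))"
    by (rule sum.group[symmetric]) (use fh in auto)
  also have "\<dots> = (\<Sum>t\<le>d. real (card (hits \<rho> O') choose t) * (R t * g t))"
  proof (rule sum.cong[OF refl])
    fix t assume "t \<in> {..d}"
    then have "{T \<in> {T \<in> Pow (hits \<rho> O'). card T \<le> d}. card T = t} = {T. T \<subseteq> hits \<rho> O' \<and> card T = t}"
      by auto
    then show "(\<Sum>T\<in>{T \<in> {T \<in> Pow (hits \<rho> O'). card T \<le> d}. card T = t}. R (card T) * g (card T))
      = real (card (hits \<rho> O') choose t) * (R t * g t)"
      using n_subsets[OF fh, of t] by simp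
  qed
  also have "\<dots> \<le> (\<Sum>t\<le>d. real ((2 * card O') choose t) * (R t * g t))"
    using card_hits_le[OF O0(2), of \<rho>] R0 g0
    by (intro sum_mono mult_right_mono of_nat_mono binomial_right_mono) simp_all
  also have "\<dots> = real (card ?P) *
      (\<Sum>t\<le>d. real ((2 * card O') choose t) * (4 / real (card X)) ^ (d - t) * R t)"
    unfolding cP g_def sum_distrib_left by (simp add: mult_ac)
  finally show ?thesis .
qed

text \<open>Measurability with respect to the preimages of the points of the pairs with index in
  \<open>O'\<close>: the weight is constant on every atom.\<close>

definition meas :: "('a \<times> 'a) set \<Rightarrow> 'k set \<Rightarrow> (('a \<Rightarrow> 'a) \<Rightarrow> real) \<Rightarrow> bool" where
  "meas Q O' w \<longleftrightarrow> (\<forall>\<rho>\<in>perm_ext X Q. \<forall>\<tau>\<in>perm_ext X (atom Q O' \<rho>). w \<tau> = w \<rho>)"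

text \<open>This is the tower property: a measurable weight is taken out of the average over each
  atom, where \<open>f\<close> averages to at most \<open>B\<close>.\<close>

lemma sum_meas_le:
  assumes "meas Q O' w" "\<And>\<tau>. 0 \<le> w \<tau>" "O' \<subseteq> H0"
    and f: "\<And>\<rho>. \<rho> \<in> perm_ext X Q \<Longrightarrow> (\<Sum>\<tau>\<in>perm_ext X (atom Q O' \<rho>). f \<tau>)
      \<le> real (card (perm_ext X (atom Q O' \<rho>))) * B"
  shows "(\<Sum>\<tau>\<in>perm_ext X Q. w \<tau> * f \<tau>) \<le> B * (\<Sum>\<tau>\<in>perm_ext X Q. w \<tau>)"
proof -
  \<comment> \<open>The value \<open>undefined\<close> outside \<open>O'\<close> makes equality of
    keys compare the indices in \<open>O'\<close> only.\<close>
  define key where "key \<tau> = (\<lambda>k. if k \<in> O' then (inv \<tau> (a k), inv \<tau> (b k)) else undefined)" for \<tau> :: "'a \<Rightarrow> 'a"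
  have fin: "finite (perm_ext X Q)" by (rule finite_perm_ext[OF finite_X])
  have k: "{\<tau> \<in> perm_ext X Q. key \<tau> = key \<rho>} = perm_ext X (atom Q O' \<rho>)" if "\<rho> \<in> perm_ext X Q" for \<rho>
  proof (rule set_eqI)
    fix \<tau>
    have "key \<tau> = key \<rho> \<longleftrightarrow> (\<forall>k\<in>O'. inv \<tau> (a k) = inv \<rho> (a k) \<and> inv \<tau> (b k) = inv \<rho> (b k))"
      unfolding key_def fun_eq_iff by auto
    then show "\<tau> \<in> {\<tau> \<in> perm_ext X Q. key \<tau> = key \<rho>} \<longleftrightarrow> \<tau> \<in> perm_ext X (atom Q O' \<rho>)"
      unfolding perm_ext_atom_iff[OF that assms(3)] by blast
  qed
  have "(\<Sum>\<tau>\<in>perm_ext X Q. w \<tau> * f \<tau>)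
      = (\<Sum>y\<in>key ` perm_ext X Q. \<Sum>\<tau>\<in>{\<tau> \<in> perm_ext X Q. key \<tau> = y}. w \<tau> * f \<tau>)"
    by (rule sum.image_gen[OF fin])
  also have "\<dots> \<le> (\<Sum>y\<in>key ` perm_ext X Q. \<Sum>\<tau>\<in>{\<tau> \<in> perm_ext X Q. key \<tau> = y}. B * w \<tau>)"
  proof (rule sum_mono)
    fix y assume "y \<in> key ` perm_ext X Q"
    then obtain \<rho> where \<rho>: "\<rho> \<in> perm_ext X Q" "y = key \<rho>" by blast
    have w: "w \<tau> = w \<rho>" if "\<tau> \<in> perm_ext X (atom Q O' \<rho>)" for \<tau>
      using assms(1) \<rho>(1) that unfolding meas_def by blast
    have "(\<Sum>\<tau>\<in>perm_ext X (atom Q O' \<rho>). w \<tau> * f \<tau>) = w \<rho> * (\<Sum>\<tau>\<in>perm_ext X (atom Q O' \<rho>). f \<tau>)"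
      unfolding sum_distrib_left by (rule sum.cong[OF refl]) (simp add: w)
    also have "\<dots> \<le> w \<rho> * (real (card (perm_ext X (atom Q O' \<rho>))) * B)"
      by (intro mult_left_mono f \<rho> assms(2))
    also have "\<dots> = (\<Sum>\<tau>\<in>perm_ext X (atom Q O' \<rho>). B * w \<tau>)"
      by (simp add: w)
    finally show "(\<Sum>\<tau>\<in>{\<tau> \<in> perm_ext X Q. key \<tau> = y}. w \<tau> * f \<tau>)
        \<le> (\<Sum>\<tau>\<in>{\<tau> \<in> perm_ext X Q. key \<tau> = y}. B * w \<tau>)"
      unfolding \<rho>(2) k[OF \<rho>(1)] .
  qed
  also have "\<dots> = B * (\<Sum>\<tau>\<in>perm_ext X Q. w \<tau>)"
    unfolding sum_distrib_left by (rule sum.image_gen[OF fin, symmetric])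
  finally show ?thesis .
qed

lemma meas_hit:
  assumes "meas Q O' w" "O' \<subseteq> H0" "E \<subseteq> H0 \<times> X"
  shows "meas Q (O' \<union> fst ` E) (\<lambda>\<tau>. w \<tau> * of_bool (hit E \<tau>))"
  unfolding meas_def
proof (intro ballI)
  fix \<rho> \<tau> assume \<rho>: "\<rho> \<in> perm_ext X Q" and \<tau>: "\<tau> \<in> perm_ext X (atom Q (O' \<union> fst ` E) \<rho>)"
  have "O' \<union> fst ` E \<subseteq> H0" using assms by auto
  note * = \<tau>[unfolded perm_ext_atom_iff[OF \<rho> this]]
  then have "\<tau> \<in> perm_ext X (atom Q O' \<rho>)" unfolding perm_ext_atom_iff[OF \<rho> assms(2)] by blast
  then have "w \<tau> = w \<rho>" using assms(1) \<rho> unfolding meas_def by blast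
  moreover have "hit E \<tau> = hit E \<rho>"
  proof -
    have "\<tau> x = y \<longleftrightarrow> inv \<tau> y = x" "\<rho> x = y \<longleftrightarrow> inv \<rho> y = x" for x y
      using permutes_inv_eq[of \<tau> X y x] permutes_inv_eq[of \<rho> X y x] perm_ext_permutes * \<rho> by blast+
    then show ?thesis unfolding hit_def using * by auto
  qed
  ultimately show "w \<tau> * of_bool (hit E \<tau>) = w \<rho> * of_bool (hit E \<rho>)" by simp
qed

text \<open>One factor \<open>v\<close> is expanded over \<open>E\<close>. Once the \<open>d\<close>
  indices of \<open>E\<close> are revealed, \<open>hit E\<close> is determined, so \<open>w\<close>
  times its indicator is an admissible weight for the remaining factors. After the induction
  hypothesis the sum over \<open>E\<close> reassembles to \<open>w * v\<close>, whose conditional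
  averages are at most \<open>B\<close>. Each factor reveals at most \<open>d\<close> new indices,
  which is why \<open>p * d\<close> is compared with \<open>K\<close>.\<close>

lemma moment_v_le:
  assumes H: "H \<subseteq> H0" and B: "0 \<le> B"
    and f: "\<And>O' \<rho>. O' \<subseteq> H \<Longrightarrow> card O' \<le> K \<Longrightarrow> \<rho> \<in> perm_ext X Q \<Longrightarrow>
      (\<Sum>\<tau>\<in>perm_ext X (atom Q O' \<rho>). v c H d \<tau>) \<le> real (card (perm_ext X (atom Q O' \<rho>))) * B"
    and "meas Q O' w" "\<And>\<tau>. 0 \<le> w \<tau>" "O' \<subseteq> H" "card O' + p * d \<le> K"
  shows "(\<Sum>\<tau>\<in>perm_ext X Q. w \<tau> * v c H d \<tau> ^ p) \<le> B ^ p * (\<Sum>\<tau>\<in>perm_ext X Q. w \<tau>)"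
  using assms(4-)
proof (induction p arbitrary: O' w)
  case 0
  then show ?case by simp
next
  case (Suc p)
  let ?P = "perm_ext X Q"
  have "(\<Sum>\<tau>\<in>?P. w \<tau> * v c H d \<tau> ^ Suc p)
      = (\<Sum>\<tau>\<in>?P. \<Sum>E\<in>Es H d. (c E)\<^sup>2 * ((w \<tau> * of_bool (hit E \<tau>)) * v c H d \<tau> ^ p))"
  proof (rule sum.cong[OF refl])
    fix \<tau>
    have "w \<tau> * v c H d \<tau> ^ Suc p = v c H d \<tau> * (w \<tau> * v c H d \<tau> ^ p)" by simp
    also have "\<dots> = (\<Sum>E\<in>Es H d. (c E)\<^sup>2 * of_bool (hit E \<tau>) * (w \<tau> * v c H d \<tau> ^ p))"
      by (subst (1) v_def) (rule sum_distrib_right)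
    finally show "w \<tau> * v c H d \<tau> ^ Suc p
        = (\<Sum>E\<in>Es H d. (c E)\<^sup>2 * ((w \<tau> * of_bool (hit E \<tau>)) * v c H d \<tau> ^ p))"
      by (simp only: mult_ac)
  qed
  also have "\<dots> = (\<Sum>E\<in>Es H d. (c E)\<^sup>2 * (\<Sum>\<tau>\<in>?P. (w \<tau> * of_bool (hit E \<tau>)) * v c H d \<tau> ^ p))"
    unfolding sum_distrib_left by (rule sum.swap)
  also have "\<dots> \<le> (\<Sum>E\<in>Es H d. (c E)\<^sup>2 * (B ^ p * (\<Sum>\<tau>\<in>?P. w \<tau> * of_bool (hit E \<tau>))))"
  proof (intro sum_mono mult_left_mono)
    fix E assume "E \<in> Es H d"
    then have E: "E \<subseteq> H \<times> X" "card E = d" "inj_on fst E" unfolding Es_def by blast+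
    show "(\<Sum>\<tau>\<in>?P. (w \<tau> * of_bool (hit E \<tau>)) * v c H d \<tau> ^ p) \<le> B ^ p * (\<Sum>\<tau>\<in>?P. w \<tau> * of_bool (hit E \<tau>))"
    proof (rule Suc.IH)
      show "meas Q (O' \<union> fst ` E) (\<lambda>\<tau>. w \<tau> * of_bool (hit E \<tau>))"
        using Suc.prems(1,3) H E(1) by (intro meas_hit) blast+
      show "0 \<le> w \<tau> * of_bool (hit E \<tau>)" for \<tau> using Suc.prems(2) by simp
      show "O' \<union> fst ` E \<subseteq> H" using Suc.prems(3) E(1) by auto
      have "card (O' \<union> fst ` E) \<le> card O' + card (fst ` E)" by (rule card_Un_le)
      also have "card (fst ` E) = d" using E(2,3) by (simp add: card_image)
      finally show "card (O' \<union> fst ` E) + p * d \<le> K" using Suc.prems(4) by simp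
    qed
  qed simp
  also have "\<dots> = B ^ p * (\<Sum>\<tau>\<in>?P. w \<tau> * v c H d \<tau>)"
  proof -
    have "(\<Sum>\<tau>\<in>?P. w \<tau> * v c H d \<tau>) = (\<Sum>E\<in>Es H d. \<Sum>\<tau>\<in>?P. (c E)\<^sup>2 * (w \<tau> * of_bool (hit E \<tau>)))"
      unfolding v_def sum_distrib_left by (subst sum.swap) (simp only: mult_ac)
    then show ?thesis by (simp only: sum_distrib_left mult_ac)
  qed
  also have "\<dots> \<le> B ^ p * (B * (\<Sum>\<tau>\<in>?P. w \<tau>))"
  proof (intro mult_left_mono sum_meas_le[OF Suc.prems(1,2)] f)
    show "O' \<subseteq> H0" using Suc.prems(3) H by blast
    show "card O' \<le> K" using Suc.prems(4) by simp
  qed (use Suc.prems(3) B in simp_all)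
  finally show ?case by (simp only: power_Suc2 mult.assoc)
qed

end

section \<open>The level inequality\<close>

text \<open>\<open>\<gamma>\<close> plays the role of the density of \<open>A\<close>, and
  \<open>L\<close> of the logarithm of its inverse. \<open>D0\<close> bounds the number of
  prescribed values plus the level: in the induction, prescribing \<open>t\<close> further values
  lowers the level by \<open>t\<close>, so this sum does not grow.\<close>

locale level = matching X H0 a b
  for X :: "'a set" and H0 :: "'k set" and a b :: "'k \<Rightarrow> 'a" +
  fixes A :: "('a \<Rightarrow> 'a) set" and \<gamma> r L :: real and D0 :: nat
  assumes \<gamma>: "0 < \<gamma>" "exp (- L) \<le> \<gamma>" and r: "1 \<le> r"
    and glob: "\<And>Q. Q \<subseteq> X \<times> X \<Longrightarrow>
      real (card (A \<inter> perm_ext X Q)) \<le> \<gamma> * r ^ (2 * card Q) * fact (card X - card Q)"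
    and D0: "8 * real D0 \<le> L" and LX: "8 * L \<le> real (card X)"
begin

definition S :: "('a \<times> 'a) set \<Rightarrow> ('k \<times> 'a) set \<Rightarrow> real" where
  "S Q E = (\<Sum>\<tau>\<in>A \<inter> perm_ext X Q. sgp E \<tau>)"

definition Z :: "('a \<times> 'a) set \<Rightarrow> 'k set \<Rightarrow> nat \<Rightarrow> real" where
  "Z Q H d = (\<Sum>E\<in>Es H d. (S Q E)\<^sup>2)"

text \<open>Hypercontractivity contributes 8p, the average of \<open>v\<close> contributes 8/n with
  n = \<open>card X\<close>, and \<open>exp 16\<close> pays for the inverse density to the power
  1/p. With p at most L/(8d) the product is at most \<open>Y / d\<close>. The factor
  \<open>r ^ 4\<close> is the growth of the squared density under one prescribed value.\<close>

definition Y :: real where "Y = 8 * exp 16 * r ^ 4 * L / real (card X)"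

text \<open>This is the square of the bound on the count of \<open>A\<close> with \<open>s\<close>
  prescribed values, times \<open>Y ^ d / fact d\<close>. Dividing by \<open>fact d\<close> makes
  the contributions of the induction hypothesis add up to a binomial expansion.\<close>

definition W :: "nat \<Rightarrow> nat \<Rightarrow> real" where
  "W s d = (fact (card X - s))\<^sup>2 * (\<gamma> * r ^ (2 * s))\<^sup>2 * Y ^ d / fact d"

lemma fin_A: "finite (A \<inter> perm_ext X Q)"
  using finite_perm_ext[OF finite_X] by blast

lemma S_insert:
  assumes "finite E" "(k, i) \<notin> E"
  shows "S Q (insert (k, i) E) = S (insert (i, a k) Q) E - S (insert (i, b k) Q) E"
proof -
  have *: "(\<Sum>\<tau>\<in>A \<inter> perm_ext X Q. of_bool (\<tau> i = j) * sgp E \<tau>) = S (insert (i, j) Q) E" for j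
  proof -
    have "A \<inter> perm_ext X (insert (i, j) Q) = {\<tau> \<in> A \<inter> perm_ext X Q. \<tau> i = j}"
      unfolding perm_ext_insert by blast
    then have "S (insert (i, j) Q) E = (\<Sum>\<tau>\<in>{\<tau> \<in> A \<inter> perm_ext X Q. \<tau> i = j}. sgp E \<tau>)"
      unfolding S_def by (rule arg_cong)
    also have "\<dots> = (\<Sum>\<tau>\<in>A \<inter> perm_ext X Q. if \<tau> i = j then sgp E \<tau> else 0)"
      by (rule sum.inter_filter[OF fin_A])
    also have "\<dots> = (\<Sum>\<tau>\<in>A \<inter> perm_ext X Q. of_bool (\<tau> i = j) * sgp E \<tau>)"
      by (rule sum.cong[OF refl]) simp
    finally show ?thesis by (rule sym)
  qed
  have "sgp (insert (k, i) E) \<tau> = of_bool (\<tau> i = a k) * sgp E \<tau> - of_bool (\<tau> i = b k) * sgp E \<tau>" for \<tau>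
    unfolding sgp_def prod.insert[OF assms] by (simp add: sg_def left_diff_distrib)
  then show ?thesis unfolding *[symmetric] by (simp only: S_def sum_subtractf)
qed

text \<open>By \<open>S_insert\<close> each element of \<open>T\<close> is traded for two
  restrictions with one more prescribed value. Squaring a difference costs a factor 2 and there are
  two restrictions, hence 4 per element.\<close>

lemma marginal_le:
  assumes "finite T" "avoids Q H" "T \<subseteq> H \<times> X" "inj_on fst T" "H' \<subseteq> H - fst ` T"
    and "\<And>Q' H'. avoids Q' H' \<Longrightarrow> card Q' = card Q + card T \<Longrightarrow> Z Q' H' u \<le> W0"
  shows "(\<Sum>E\<in>Es H' u. (S Q (T \<union> E))\<^sup>2) \<le> 4 ^ card T * W0"
  using assms
proof (induction T arbitrary: Q H rule: finite_induct)
  case empty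
  have "avoids Q H'" using empty.prems(1,4) by (intro avoids_mono[of Q H H']) simp_all
  then show ?case using empty.prems(5)[of Q H'] by (simp add: Z_def)
next
  case (insert e T)
  obtain k i where e: "e = (k, i)" by (cases e)
  have ki: "k \<in> H" "i \<in> X" using insert.prems(2) e by auto
  have H: "H \<subseteq> H0" using insert.prems(1) by (simp add: avoids_def)
  have kT: "fst x \<noteq> k" if "x \<in> T" for x
    using inj_onD[OF insert.prems(3), of x e] that insert.hyps(2) e by auto
  have T: "T \<subseteq> (H - {k}) \<times> X" using insert.prems(2) kT by force
  have iT: "inj_on fst T" using insert.prems(3) by (rule inj_on_subset) blast
  have H': "H' \<subseteq> (H - {k}) - fst ` T" using insert.prems(4) e by auto
  have H'0: "H' \<subseteq> H0" using H' H by blast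
  have IH: "(\<Sum>E\<in>Es H' u. (S (insert (i, j) Q) (T \<union> E))\<^sup>2) \<le> 4 ^ card T * W0" if j: "j = a k \<or> j = b k" for j
  proof (rule insert.IH[OF _ T iT H'])
    show "avoids (insert (i, j) Q) (H - {k})"
      by (rule avoids_insert(1)[OF insert.prems(1) ki subset_refl j])
    fix Q' H'' assume "avoids Q' H''" "card Q' = card (insert (i, j) Q) + card T"
    then show "Z Q' H'' u \<le> W0"
      using insert.prems(5)[of Q' H''] insert.hyps
        avoids_insert(2)[OF insert.prems(1) ki subset_refl j] by simp
  qed
  have "(\<Sum>E\<in>Es H' u. (S Q (insert e T \<union> E))\<^sup>2)
      \<le> (\<Sum>E\<in>Es H' u. 2 * (S (insert (i, a k) Q) (T \<union> E))\<^sup>2 + 2 * (S (insert (i, b k) Q) (T \<union> E))\<^sup>2)"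
  proof (rule sum_mono)
    fix E assume "E \<in> Es H' u"
    then have E: "E \<subseteq> H' \<times> X" unfolding Es_def by blast
    have "k \<notin> H'" using H' by blast
    then have "(k, i) \<notin> T \<union> E" using insert.hyps(2) e E by blast
    moreover have "finite (T \<union> E)" using insert.hyps(1) finite_E[OF H'0 E] by simp
    ultimately have "S Q (insert e T \<union> E) = S (insert (i, a k) Q) (T \<union> E) - S (insert (i, b k) Q) (T \<union> E)"
      using S_insert[of "T \<union> E" k i Q] e by simp
    moreover have "(x - y)\<^sup>2 \<le> 2 * x\<^sup>2 + 2 * y\<^sup>2" for x y :: real
      using zero_le_power2[of "x + y"] by (simp add: power2_diff power2_sum)
    ultimately show "(S Q (insert e T \<union> E))\<^sup>2
      \<le> 2 * (S (insert (i, a k) Q) (T \<union> E))\<^sup>2 + 2 * (S (insert (i, b k) Q) (T \<union> E))\<^sup>2" by simp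
  qed
  also have "\<dots> \<le> 2 * (4 ^ card T * W0) + 2 * (4 ^ card T * W0)"
    unfolding sum.distrib sum_distrib_left[symmetric] using IH[of "a k"] IH[of "b k"]
    by (intro add_mono mult_left_mono) simp_all
  also have "\<dots> = 4 ^ card (insert e T) * W0" using insert.hyps by simp
  finally show ?case .
qed

lemma L_nonneg: "0 \<le> L"
  using D0 by linarith

lemma Y_nonneg: "0 \<le> Y"
  unfolding Y_def using L_nonneg r by simp

lemma W_nonneg: "0 \<le> W s d"
  unfolding W_def using Y_nonneg by simp

lemma Lr_le_Y: "L * r ^ 4 / real (card X) \<le> Y"
proof -
  have "(1::real) \<le> 8 * exp 16" using exp_ge_zero[of "16::real"] exp_ge_add_one_self[of "16::real"] by linarith
  then have "1 * (L * r ^ 4 / real (card X)) \<le> 8 * exp 16 * (L * r ^ 4 / real (card X))"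
    using L_nonneg r by (intro mult_right_mono) simp_all
  then show ?thesis unfolding Y_def by (simp add: mult_ac)
qed

text \<open>Write n for \<open>card X\<close>. Choosing \<open>t\<close> elements costs
  \<open>(L / 4) ^ t / fact t\<close>, passing to restrictions costs
  \<open>4 ^ t * r ^ (4 * t)\<close>, and the smaller factorials gain
  \<open>(2 / n) ^ (2 * t)\<close>. Together this is
  \<open>(4 / n) ^ t * (L * r ^ 4 / n) ^ t / fact t\<close>, whose second factor is absorbed by
  \<open>Y ^ t\<close>, while the two remaining factorials give \<open>d choose t\<close>.\<close>

lemma level_weight_le:
  assumes t: "t \<le> d" and X: "0 < card X" and sd: "s + d \<le> D0" and N: "real N \<le> L / 4"
  shows "real (N choose t) * (4 / real (card X)) ^ (d - t) * (4 ^ t * W (s + t) (d - t))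
    \<le> (4 / real (card X)) ^ d * real (d choose t) * W s d"
proof -
  let ?n = "real (card X)"
  define f0 f1 :: real where "f0 = fact (card X - s)" and "f1 = fact (card X - (s + t))"
  have n: "0 < ?n" using X by simp
  have f: "f1\<^sup>2 * (?n / 2) ^ (2 * t) \<le> f0\<^sup>2"
  proof -
    have "8 * real (s + d) \<le> L" using sd D0 by (meson mult_left_mono of_nat_mono order_trans zero_le_numeral)
    then have *: "64 * real (s + d) \<le> ?n" using LX by linarith
    then have "64 * (s + d) \<le> card X" by linarith
    moreover have "s + t \<le> 64 * (s + d)" using t by simp
    ultimately have "s + t \<le> card X" by (rule order_trans[rotated])
    then have "t \<le> card X - s" "real (card X - s - t) = ?n - real s - real t"
      by (simp_all add: of_nat_diff)
    moreover from this(2) have "?n / 2 \<le> real (card X - s - t)" using * t by simp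
    ultimately have "t \<le> card X - s" "?n / 2 \<le> real (card X - s - t)" by simp_all
    from fact_diff_power_le[OF this(1) _ this(2)]
    have "f1 * (?n / 2) ^ t \<le> f0" unfolding f0_def f1_def by simp
    then have "(f1 * (?n / 2) ^ t)\<^sup>2 \<le> f0\<^sup>2" unfolding f1_def by (intro power_mono) simp_all
    then show ?thesis by (simp only: power_mult_distrib power_mult[symmetric] mult.commute[of t 2])
  qed
  have c: "real (N choose t) \<le> (L / 4) ^ t / fact t"
  proof -
    have "real ((N choose t) * fact t) \<le> real (N ^ t)" by (intro of_nat_mono binomial_fact_pow)
    also have "\<dots> \<le> (L / 4) ^ t" using N by (simp only: of_nat_power) (intro power_mono, simp_all)
    finally show ?thesis by (simp add: pos_le_divide_eq)
  qed
  have dt: "real (d choose t) / fact d = 1 / (fact t * fact (d - t))"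
    using binomial_fact[OF t, where ?'a = real] by (simp add: field_simps)
  define G where "G = \<gamma>\<^sup>2 * (r ^ (2 * s))\<^sup>2"
  have G: "0 \<le> G" unfolding G_def by simp
  have rr: "(\<gamma> * r ^ (2 * (s + t)))\<^sup>2 = G * (r ^ 4) ^ t"
    unfolding G_def by (simp add: power_mult_distrib power_add algebra_simps flip: power_mult)
  have "real (N choose t) * (4 / ?n) ^ (d - t) * (4 ^ t * W (s + t) (d - t))
      \<le> (L / 4) ^ t / fact t * (4 / ?n) ^ (d - t) * (4 ^ t * W (s + t) (d - t))"
    using W_nonneg by (intro mult_right_mono c) simp_all
  also have "\<dots> = L ^ t * (4 / ?n) ^ (d - t) * f1\<^sup>2 * (r ^ 4) ^ t * Y ^ (d - t) * G / (fact t * fact (d - t))"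
    unfolding W_def rr f1_def[symmetric] by (simp add: power_divide mult_ac)
  also have "\<dots> \<le> (4 / ?n) ^ d * f0\<^sup>2 * Y ^ d * G / (fact t * fact (d - t))"
  proof (intro divide_right_mono mult_right_mono G)
    have "f1\<^sup>2 \<le> f0\<^sup>2 * (4 / ?n) ^ t * (1 / ?n) ^ t"
    proof -
      have "f1\<^sup>2 * (?n / 2) ^ (2 * t) * ((4 / ?n) ^ t * (1 / ?n) ^ t) \<le> f0\<^sup>2 * ((4 / ?n) ^ t * (1 / ?n) ^ t)"
        using f n by (intro mult_right_mono) simp_all
      moreover have "(?n / 2) ^ (2 * t) * ((4 / ?n) ^ t * (1 / ?n) ^ t) = 1"
        using n by (simp add: power_mult power_mult_distrib[symmetric] power2_eq_square)
      ultimately show ?thesis by (simp add: mult.assoc)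
    qed
    then have "L ^ t * (4 / ?n) ^ (d - t) * f1\<^sup>2 * (r ^ 4) ^ t * Y ^ (d - t)
        \<le> L ^ t * (4 / ?n) ^ (d - t) * (f0\<^sup>2 * (4 / ?n) ^ t * (1 / ?n) ^ t) * (r ^ 4) ^ t * Y ^ (d - t)"
      using L_nonneg Y_nonneg r by (intro mult_right_mono mult_left_mono) simp_all
    also have "\<dots> = ((4 / ?n) ^ (d - t) * (4 / ?n) ^ t) * f0\<^sup>2 * ((L * r ^ 4 / ?n) ^ t * Y ^ (d - t))"
      by (simp add: power_mult_distrib power_divide mult_ac)
    also have "\<dots> \<le> ((4 / ?n) ^ (d - t) * (4 / ?n) ^ t) * f0\<^sup>2 * (Y ^ t * Y ^ (d - t))"
      using Lr_le_Y Y_nonneg L_nonneg r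
      by (intro mult_left_mono mult_right_mono power_mono) simp_all
    also have "\<dots> = (4 / ?n) ^ d * f0\<^sup>2 * Y ^ d"
      using t by (simp only: power_add[symmetric]) simp
    finally show "L ^ t * (4 / ?n) ^ (d - t) * f1\<^sup>2 * (r ^ 4) ^ t * Y ^ (d - t) \<le> (4 / ?n) ^ d * f0\<^sup>2 * Y ^ d" .
  qed simp
  also have "\<dots> = (4 / ?n) ^ d * f0\<^sup>2 * Y ^ d * G * (real (d choose t) / fact d)"
    unfolding dt by simp
  also have "\<dots> = (4 / ?n) ^ d * real (d choose t) * W s d"
    unfolding W_def G_def f0_def by (simp add: power_mult_distrib)
  finally show ?thesis .
qed

lemma Z_eq_sum:
  assumes "H \<subseteq> H0"
  shows "Z Q H d = (\<Sum>\<tau>\<in>A \<inter> perm_ext X Q. \<Sum>E\<in>Es H d. S Q E * sgp E \<tau>)"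
  unfolding Z_def power2_eq_square by (subst (2) S_def) (simp add: sum_distrib_left sum.swap[of _ "Es H d"])

lemma level_inequality_0: "avoids Q H \<Longrightarrow> Z Q H 0 \<le> W (card Q) 0"
proof -
  assume av: "avoids Q H"
  then have "Es H 0 = {{}}" unfolding Es_def using finite_E by (auto simp: avoids_def)
  then have "Z Q H 0 = (real (card (A \<inter> perm_ext X Q)))\<^sup>2" unfolding Z_def S_def sgp_def by simp
  also have "\<dots> \<le> (\<gamma> * r ^ (2 * card Q) * fact (card X - card Q))\<^sup>2"
    using av by (intro power_mono glob) (simp_all add: avoids_def)
  also have "\<dots> = W (card Q) 0" unfolding W_def by (simp add: power_mult_distrib)
  finally show ?thesis .
qed

text \<open>The level inequality comes from testing \<open>A\<close> against the sum \<open>U\<close> whose expectation over \<open>A\<close> is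
  \<open>Z\<close> itself. The exponent is chosen of order \<open>L / d\<close>, so that \<open>\<gamma> powr (- 1 / p)\<close> costs only \<open>exp (O d)\<close>.
  In the moment bound, the induction hypothesis controls every partial sum except the full one, which
  is \<open>Z\<close>; if \<open>Z\<close> exceeds the claimed bound, it dominates the moment bound and can be cancelled.\<close>

lemma level_inequality:
  "avoids Q H \<Longrightarrow> card Q + d \<le> D0 \<Longrightarrow> Z Q H d \<le> W (card Q) d"
proof (induction d arbitrary: Q H rule: less_induct)
  case (less d)
  let ?n = "real (card X)" and ?s = "card Q" and ?P = "perm_ext X Q"
  have H: "H \<subseteq> H0" using less.prems(1) by (simp add: avoids_def)
  show ?case
  proof (rule ccontr)
    assume "\<not> ?thesis"
    then have gt: "W ?s d < Z Q H d" by simp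
    then have Zp: "0 < Z Q H d" using W_nonneg[of ?s d] by linarith
    have d: "0 < d"
    proof (rule ccontr)
      assume "\<not> 0 < d"
      then show False using gt level_inequality_0[OF less.prems(1)] by simp
    qed
    have "8 * real (?s + d) \<le> 8 * real D0" using less.prems(2) by simp
    then have sdL: "8 * real (?s + d) \<le> L" using D0 by linarith
    have n: "0 < ?n" "0 < L" using sdL LX d by simp_all
    then have X: "0 < card X" "X \<noteq> {}" by auto
    \<comment> \<open>Rounding down loses at most a factor 2 because \<open>8 * d \<le> L\<close>.
      The bound \<open>8 * p * d \<le> L\<close> keeps the number of revealed indices small, and
      \<open>L \<le> 16 * d * p\<close> bounds the inverse density by
      \<open>(exp 16 ^ d) ^ p\<close>.\<close>
    define p where "p = nat \<lfloor>L / (8 * real d)\<rfloor>"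
    have dL: "1 \<le> L / (8 * real d)" using sdL d by simp
    have p: "0 < p" "real p \<le> L / (8 * real d)" "L / (8 * real d) \<le> 2 * real p"
    proof -
      define x where "x = L / (8 * real d)"
      have "1 \<le> \<lfloor>x\<rfloor>" using dL unfolding x_def by simp
      then have "real p = of_int \<lfloor>x\<rfloor>" "0 < p" unfolding p_def x_def[symmetric] by simp_all
      moreover have "of_int \<lfloor>x\<rfloor> \<le> x" "x < of_int \<lfloor>x\<rfloor> + 1" by linarith+
      ultimately show "0 < p" "real p \<le> L / (8 * real d)" "L / (8 * real d) \<le> 2 * real p"
        unfolding x_def[symmetric] using \<open>1 \<le> \<lfloor>x\<rfloor>\<close> by linarith+
    qed
    have pd: "8 * (real p * real d) \<le> L" "L \<le> 16 * (real d * real p)"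
      using p(2,3) d by (simp_all add: field_simps)
    \<comment> \<open>The 8 is 4, from the hitting probability, times 2, from summing
      \<open>d choose t\<close> over \<open>t\<close>.\<close>
    define B where "B = (8 / ?n) ^ d * Z Q H d"
    define U where "U \<tau> = (\<Sum>E\<in>Es H d. S Q E * sgp E \<tau>)" for \<tau>
    have B0: "0 \<le> B" unfolding B_def using Zp by simp
    have atom_le: "(\<Sum>\<tau>\<in>perm_ext X (atom Q O' \<rho>). v (S Q) H d \<tau>) \<le> real (card (perm_ext X (atom Q O' \<rho>))) * B"
      if O': "O' \<subseteq> H" and cO: "card O' \<le> p * d" and \<rho>: "\<rho> \<in> ?P" for O' \<rho>
    proof -
      \<comment> \<open>Only \<open>t = 0\<close> is beyond the induction hypothesis; there the
        partial sum is bounded by \<open>Z\<close> itself.\<close>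
      define R where "R t = (if t = 0 then Z Q H d else 4 ^ t * W (?s + t) (d - t))" for t
      have R0: "0 \<le> R t" for t unfolding R_def using Zp W_nonneg by simp
      have "real (card O') \<le> real (p * d)" using cO by (rule of_nat_mono)
      then have cO': "real (2 * card O') \<le> L / 4" using pd(1) by simp
      have "(\<Sum>\<tau>\<in>perm_ext X (atom Q O' \<rho>). v (S Q) H d \<tau>) \<le> real (card (perm_ext X (atom Q O' \<rho>))) *
        (\<Sum>t\<le>d. real ((2 * card O') choose t) * (4 / ?n) ^ (d - t) * R t)"
      proof (rule sum_v_atom_le[OF less.prems(1) O' \<rho> _ X(2) R0])
        show "?n / 2 + real (?s + 2 * card O' + d) \<le> ?n" using cO' sdL LX by simp
        fix T assume T: "T \<subseteq> O' \<times> X" "inj_on fst T" "card T \<le> d"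
        have fT: "finite T" using T(1) O' H by (intro finite_E[of O']) blast+
        show "(\<Sum>E\<in>Es (H - O') (d - card T). (S Q (T \<union> E))\<^sup>2) \<le> R (card T)"
        proof (cases "card T = 0")
          case True
          then have "T = {}" using fT by simp
          moreover have "(\<Sum>E\<in>Es (H - O') d. (S Q E)\<^sup>2) \<le> Z Q H d"
            unfolding Z_def using finite_Es[OF H] by (intro sum_mono2) (auto simp: Es_def)
          ultimately show ?thesis unfolding R_def by simp
        next
          case False
          have "(\<Sum>E\<in>Es (H - O') (d - card T). (S Q (T \<union> E))\<^sup>2) \<le> 4 ^ card T * W (?s + card T) (d - card T)"
          proof (rule marginal_le[OF fT less.prems(1) _ T(2)])
            show "T \<subseteq> H \<times> X" using T(1) O' by blast
            show "H - O' \<subseteq> H - fst ` T" using T(1) by auto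
            fix Q' H' assume Q': "avoids Q' H'" "card Q' = ?s + card T"
            have "d - card T < d" using False d by simp
            from less.IH[OF this Q'(1)] show "Z Q' H' (d - card T) \<le> W (?s + card T) (d - card T)"
              unfolding Q'(2) using less.prems(2) T(3) by simp
          qed
          then show ?thesis unfolding R_def using False by simp
        qed
      qed
      also have "(\<Sum>t\<le>d. real ((2 * card O') choose t) * (4 / ?n) ^ (d - t) * R t)
          \<le> (\<Sum>t\<le>d. (4 / ?n) ^ d * real (d choose t) * Z Q H d)"
      proof (rule sum_mono)
        fix t assume "t \<in> {..d}"
        then have t: "t \<le> d" by simp
        show "real ((2 * card O') choose t) * (4 / ?n) ^ (d - t) * R t \<le> (4 / ?n) ^ d * real (d choose t) * Z Q H d"
        proof (cases "t = 0")
          case True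
          then show ?thesis unfolding R_def by simp
        next
          case False
          have "real ((2 * card O') choose t) * (4 / ?n) ^ (d - t) * R t \<le> (4 / ?n) ^ d * real (d choose t) * W ?s d"
            unfolding R_def using level_weight_le[OF t X(1) less.prems(2) cO'] False by simp
          also have "\<dots> \<le> (4 / ?n) ^ d * real (d choose t) * Z Q H d"
            using gt by (intro mult_left_mono) simp_all
          finally show ?thesis .
        qed
      qed
      also have "\<dots> = B"
      proof -
        have "(\<Sum>t\<le>d. (4 / ?n) ^ d * real (d choose t) * Z Q H d)
            = (4 / ?n) ^ d * Z Q H d * real (\<Sum>t\<le>d. d choose t)"
          by (simp add: sum_distrib_left sum_distrib_right mult_ac)
        also have "\<dots> = (4 / ?n) ^ d * Z Q H d * 2 ^ d"
          by (simp add: choose_row_sum)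
        also have "\<dots> = B" unfolding B_def by (simp add: power_divide flip: power_mult_distrib)
        finally show ?thesis .
      qed
      finally show ?thesis by (simp add: mult_left_mono)
    qed
    have mom: "(\<Sum>\<tau>\<in>?P. v (S Q) H d \<tau> ^ p) \<le> B ^ p * real (card ?P)"
    proof -
      have "meas Q {} (\<lambda>\<tau>. 1)" unfolding meas_def by simp
      from moment_v_le[OF H B0 atom_le this, where K = "p * d" and p = p]
      show ?thesis by simp
    qed
    define N :: real where "N = fact (card X - ?s)"
    define g where "g = \<gamma> * r ^ (2 * ?s)"
    have N0: "0 < N" unfolding N_def by simp
    have g\<gamma>: "\<gamma> \<le> g" unfolding g_def using \<gamma>(1) r by simp
    then have g0: "0 < g" using \<gamma>(1) by linarith
    have QX: "Q \<subseteq> X \<times> X" using less.prems(1) by (simp add: avoids_def)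
    have cP: "real (card ?P) \<le> N" unfolding N_def by (rule card_perm_ext_le[OF finite_X QX])
    have cA: "real (card (A \<inter> ?P)) \<le> g * N" unfolding g_def N_def by (rule glob[OF QX])
    have "1 / g \<le> 1 / \<gamma>" using g\<gamma> \<gamma>(1) by (simp add: frac_le)
    also have "1 / \<gamma> \<le> exp L" using \<gamma> by (simp add: exp_minus field_simps)
    also have "\<dots> \<le> exp (16 * (real d * real p))" using pd(2) by simp
    also have "\<dots> = (exp 16 ^ d) ^ p"
      by (simp add: exp_of_nat2_mult[symmetric] power_mult[symmetric] mult_ac)
    finally have ge: "1 / g \<le> (exp 16 ^ d) ^ p" .
    have "(Z Q H d) ^ (2 * p) = (\<Sum>\<tau>\<in>A \<inter> ?P. U \<tau>) ^ (2 * p)" unfolding Z_eq_sum[OF H] U_def ..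
    \<comment> \<open>Moments on \<open>A\<close> are compared with moments on the whole of
      \<open>?P\<close>. The exponent \<open>2 * p - 1\<close>, one short of \<open>2 * p\<close>,
      is the source of the factor \<open>1 / g\<close>.\<close>
    also have "\<dots> \<le> real (card (A \<inter> ?P)) ^ (2 * p - 1) * (\<Sum>\<tau>\<in>A \<inter> ?P. U \<tau> ^ (2 * p))"
      by (rule sum_power_le_card[OF fin_A p(1)])
    also have "\<dots> \<le> (g * N) ^ (2 * p - 1) * (((8 * real p) ^ d * B) ^ p * N)"
    proof (intro mult_mono power_mono cA)
      have "(\<Sum>\<tau>\<in>A \<inter> ?P. U \<tau> ^ (2 * p)) \<le> (\<Sum>\<tau>\<in>?P. U \<tau> ^ (2 * p))"
        using finite_perm_ext[OF finite_X] by (intro sum_mono2) simp_all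
      also have "\<dots> \<le> (\<Sum>\<tau>\<in>?P. ((8 * real p) ^ d * v (S Q) H d \<tau>) ^ p)"
        unfolding U_def by (rule hypercontractive[OF less.prems(1) p(1)])
      also have "\<dots> = ((8 * real p) ^ d) ^ p * (\<Sum>\<tau>\<in>?P. v (S Q) H d \<tau> ^ p)"
        unfolding power_mult_distrib[of "(8 * real p) ^ d"] sum_distrib_left ..
      also have "\<dots> \<le> ((8 * real p) ^ d) ^ p * (B ^ p * N)"
        using mom cP mult_left_mono[OF cP, of "B ^ p"] B0 by (intro mult_left_mono) simp_all
      also have "\<dots> = ((8 * real p) ^ d * B) ^ p * N" by (simp add: power_mult_distrib)
      finally show "(\<Sum>\<tau>\<in>A \<inter> ?P. U \<tau> ^ (2 * p)) \<le> ((8 * real p) ^ d * B) ^ p * N" .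
    qed (use g0 N0 in \<open>auto intro!: sum_nonneg\<close>)
    also have "\<dots> = (g * N) ^ (2 * p) * (1 / g) * ((8 * real p) ^ d * B) ^ p"
    proof -
      have "(g * N) ^ (2 * p) = (g * N) ^ (2 * p - 1) * (g * N)"
        using p(1) by (simp flip: power_Suc2)
      then show ?thesis using g0 by simp
    qed
    also have "\<dots> \<le> (g * N) ^ (2 * p) * (exp 16 ^ d) ^ p * ((8 * real p) ^ d * B) ^ p"
      using ge g0 N0 B0 by (intro mult_right_mono mult_left_mono) simp_all
    also have "\<dots> = ((g * N)\<^sup>2 * exp 16 ^ d * ((8 * real p) ^ d * B)) ^ p"
      by (simp only: power_mult power_mult_distrib)
    finally have "((Z Q H d)\<^sup>2) ^ p \<le> ((g * N)\<^sup>2 * exp 16 ^ d * ((8 * real p) ^ d * B)) ^ p"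
      by (simp only: power_mult)
    \<comment> \<open>After the \<open>p\<close>-th root the right-hand side is linear in
      \<open>Z\<close>, because \<open>B\<close> is, so one factor \<open>Z\<close> cancels.\<close>
    then have "(Z Q H d)\<^sup>2 \<le> (g * N)\<^sup>2 * exp 16 ^ d * ((8 * real p) ^ d * B)"
      using p(1) B0 by (subst (asm) power_mono_iff) simp_all
    also have "\<dots> = (g * N)\<^sup>2 * (exp 16 * (8 * real p) * (8 / ?n)) ^ d * Z Q H d"
      unfolding B_def by (simp only: power_mult_distrib mult.assoc)
    finally have "Z Q H d \<le> (g * N)\<^sup>2 * (exp 16 * (8 * real p) * (8 / ?n)) ^ d"
      using Zp by (simp add: power2_eq_square)
    also have "\<dots> \<le> (g * N)\<^sup>2 * (Y ^ d / fact d)"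
    proof (rule mult_left_mono)
      have Y': "exp 16 * (8 * real p) * (8 / ?n) \<le> Y / real d"
      proof -
        have "exp 16 * (8 * real p) * (8 / ?n) \<le> exp 16 * (8 * (L / (8 * real d))) * (8 / ?n)"
          using p(2) n by (intro mult_right_mono mult_left_mono) simp_all
        also have "\<dots> = 8 * exp 16 * L / ?n / real d * 1" by (simp add: mult_ac)
        also have "\<dots> \<le> 8 * exp 16 * L / ?n / real d * r ^ 4"
          using n r by (intro mult_left_mono) simp_all
        also have "\<dots> = Y / real d" unfolding Y_def by simp
        finally show ?thesis .
      qed
      have "(exp 16 * (8 * real p) * (8 / ?n)) ^ d \<le> (Y / real d) ^ d"
        using Y' by (intro power_mono) simp_all
      also have "\<dots> = Y ^ d / real (d ^ d)" by (simp add: power_divide)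
      \<comment> \<open>The power \<open>d ^ d\<close> produced by the choice of \<open>p\<close> is
        weakened to \<open>fact d\<close>, the form that the induction reproduces.\<close>
      also have "\<dots> \<le> Y ^ d / fact d"
      proof (rule divide_left_mono)
        have "fact d \<le> d ^ d" by (rule fact_le_power[of d, where ?'a = nat, simplified])
        then show "fact d \<le> real (d ^ d)" by (metis of_nat_fact of_nat_mono)
      qed (use Y_nonneg d in simp_all)
      finally show "(exp 16 * (8 * real p) * (8 / ?n)) ^ d \<le> Y ^ d / fact d" .
    qed simp
    also have "\<dots> = W ?s d" unfolding W_def g_def N_def by (simp add: power_mult_distrib mult_ac)
    finally show False using gt by simp
  qed
qed

end

section \<open>Convolution on functions of few values\<close>

lemma Sn_iff: "\<sigma> \<in> Sn n \<longleftrightarrow> \<sigma> permutes {1..n}"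
  unfolding Sn_def by simp

lemma Sn_perm_ext: "Sn n = perm_ext {1..n} {}"
  unfolding Sn_def perm_ext_def by simp

lemma finite_Sn: "finite (Sn n)"
  unfolding Sn_def by (rule finite_permutations) simp

lemma card_Sn: "card (Sn n) = fact n"
  unfolding Sn_def by (rule card_permutations) simp_all

lemma Sn_nonempty: "Sn n \<noteq> {}"
  using permutes_id unfolding Sn_def by blast

lemma Sn_comp: "\<sigma> \<in> Sn n \<Longrightarrow> \<tau> \<in> Sn n \<Longrightarrow> \<sigma> \<circ> \<tau> \<in> Sn n"
  unfolding Sn_iff by (rule permutes_compose)

lemma Sn_inv: "\<sigma> \<in> Sn n \<Longrightarrow> inv \<sigma> \<in> Sn n"
  unfolding Sn_iff by (rule permutes_inv)

lemma Sn_sub: "\<pi> permutes Y \<Longrightarrow> Y \<subseteq> {1..n} \<Longrightarrow> \<pi> \<in> Sn n"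
  unfolding Sn_iff by (rule permutes_subset)

lemma Sn_transpose: "i \<in> {1..n} \<Longrightarrow> j \<in> {1..n} \<Longrightarrow> Transposition.transpose i j \<in> Sn n"
  unfolding Sn_iff by (rule permutes_swap_id)

lemma Sn_inv_comp: "\<sigma> \<in> Sn n \<Longrightarrow> inv \<sigma> \<circ> \<sigma> = id"
  unfolding Sn_iff by (rule permutes_inv_o)

lemma sum_Sn_left: "\<tau> \<in> Sn n \<Longrightarrow> (\<Sum>\<sigma>\<in>Sn n. f (\<tau> \<circ> \<sigma>)) = (\<Sum>\<sigma>\<in>Sn n. f \<sigma>)"
  unfolding Sn_def by (rule setum_permutations_compose_left[symmetric]) simp

lemma sum_Sn_right: "\<tau> \<in> Sn n \<Longrightarrow> (\<Sum>\<sigma>\<in>Sn n. f (\<sigma> \<circ> \<tau>)) = (\<Sum>\<sigma>\<in>Sn n. f \<sigma>)"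
  unfolding Sn_def by (rule sum_permutations_compose_right[symmetric]) simp

lemma sum_Sn_inv: "(\<Sum>\<sigma>\<in>Sn n. f (inv \<sigma>)) = (\<Sum>\<sigma>\<in>Sn n. f \<sigma>)"
  unfolding Sn_def by (rule sum_permutations_inverse[symmetric])

text \<open>The inner product, the squared norm and the convolution below use the counting measure on
  \<open>Sn n\<close> instead of the uniform probability measure.\<close>

definition ip :: "nat \<Rightarrow> ((nat \<Rightarrow> nat) \<Rightarrow> real) \<Rightarrow> ((nat \<Rightarrow> nat) \<Rightarrow> real) \<Rightarrow> real" where
  "ip n u w = (\<Sum>\<sigma>\<in>Sn n. u \<sigma> * w \<sigma>)"

definition nsq :: "nat \<Rightarrow> ((nat \<Rightarrow> nat) \<Rightarrow> real) \<Rightarrow> real" where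
  "nsq n u = (\<Sum>\<sigma>\<in>Sn n. (u \<sigma>)\<^sup>2)"

definition cv :: "nat \<Rightarrow> ((nat \<Rightarrow> nat) \<Rightarrow> real) \<Rightarrow> ((nat \<Rightarrow> nat) \<Rightarrow> real) \<Rightarrow> (nat \<Rightarrow> nat) \<Rightarrow> real" where
  "cv n f g \<sigma> = (\<Sum>\<tau>\<in>Sn n. f \<tau> * g (inv \<tau> \<circ> \<sigma>))"

lemma nsq_nonneg: "0 \<le> nsq n u"
  unfolding nsq_def by (intro sum_nonneg) simp

lemma nsq_eq_ip: "nsq n u = ip n u u"
  unfolding nsq_def ip_def power2_eq_square ..

lemma ip_Cauchy_Schwarz: "(ip n u w)\<^sup>2 \<le> nsq n u * nsq n w"
  unfolding ip_def nsq_def by (rule Cauchy_Schwarz_ineq_sum)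

lemma nsq_right: "\<tau> \<in> Sn n \<Longrightarrow> nsq n (\<lambda>\<sigma>. g (\<sigma> \<circ> \<tau>)) = nsq n g"
  unfolding nsq_def by (rule sum_Sn_right)

lemma cv_indicator:
  assumes "A \<subseteq> Sn n"
  shows "cv n (indicator A) g \<sigma> = (\<Sum>\<tau>\<in>A. g (inv \<tau> \<circ> \<sigma>))"
proof -
  have "cv n (indicator A) g \<sigma> = (\<Sum>\<tau>\<in>Sn n. if \<tau> \<in> A then g (inv \<tau> \<circ> \<sigma>) else 0)"
    unfolding cv_def by (rule sum.cong) (simp_all add: indicator_def)
  also have "\<dots> = (\<Sum>\<tau>\<in>Sn n \<inter> A. g (inv \<tau> \<circ> \<sigma>))"
    by (rule sum.inter_restrict[OF finite_Sn, symmetric])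
  also have "Sn n \<inter> A = A" using assms by blast
  finally show ?thesis .
qed

lemma cv_right: "cv n f (\<lambda>\<sigma>. g (\<sigma> \<circ> \<tau>)) \<sigma> = cv n f g (\<sigma> \<circ> \<tau>)"
  unfolding cv_def o_assoc ..

text \<open>\<open>right_inv n I\<close> consists of the functions of the restriction of \<open>\<sigma>\<close> to \<open>I\<close>, and \<open>pure n I\<close> of
  those among them that in addition have mean zero in each of the values \<open>\<sigma> k\<close>, \<open>k \<in> I\<close>.\<close>

definition right_inv :: "nat \<Rightarrow> nat set \<Rightarrow> ((nat \<Rightarrow> nat) \<Rightarrow> real) set" where
  "right_inv n I = {g. \<forall>\<sigma>\<in>Sn n. \<forall>\<pi>. \<pi> permutes ({1..n} - I) \<longrightarrow> g (\<sigma> \<circ> \<pi>) = g \<sigma>}"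

definition pure :: "nat \<Rightarrow> nat set \<Rightarrow> ((nat \<Rightarrow> nat) \<Rightarrow> real) set" where
  "pure n I = {g \<in> right_inv n I. \<forall>\<sigma>\<in>Sn n. \<forall>k\<in>I.
     (\<Sum>z\<in>{1..n} - (I - {k}). g (\<sigma> \<circ> Transposition.transpose k z)) = 0}"

lemma right_invD:
  "g \<in> right_inv n I \<Longrightarrow> \<sigma> \<in> Sn n \<Longrightarrow> \<pi> permutes ({1..n} - I) \<Longrightarrow> g (\<sigma> \<circ> \<pi>) = g \<sigma>"
  unfolding right_inv_def by blast

lemma pureD:
  "g \<in> pure n I \<Longrightarrow> \<sigma> \<in> Sn n \<Longrightarrow> k \<in> I \<Longrightarrow>
    (\<Sum>z\<in>{1..n} - (I - {k}). g (\<sigma> \<circ> Transposition.transpose k z)) = 0"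
  unfolding pure_def by blast

lemma pure_right_inv: "g \<in> pure n I \<Longrightarrow> g \<in> right_inv n I"
  unfolding pure_def by blast

lemma cv_right_inv:
  assumes "g \<in> right_inv n I"
  shows "cv n f g \<in> right_inv n I"
  unfolding right_inv_def
proof (intro CollectI ballI allI impI)
  fix \<sigma> \<pi> assume \<sigma>: "\<sigma> \<in> Sn n" and \<pi>: "\<pi> permutes ({1..n} - I)"
  show "cv n f g (\<sigma> \<circ> \<pi>) = cv n f g \<sigma>"
    unfolding cv_def
  proof (rule sum.cong[OF refl])
    fix \<tau> assume "\<tau> \<in> Sn n"
    then have "inv \<tau> \<circ> \<sigma> \<in> Sn n" using \<sigma> by (intro Sn_comp Sn_inv)
    from right_invD[OF assms this \<pi>] show "f \<tau> * g (inv \<tau> \<circ> (\<sigma> \<circ> \<pi>)) = f \<tau> * g (inv \<tau> \<circ> \<sigma>)"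
      unfolding o_assoc by simp
  qed
qed

lemma cv_pure:
  assumes "g \<in> pure n I"
  shows "cv n f g \<in> pure n I"
  unfolding pure_def
proof (intro CollectI conjI ballI cv_right_inv pure_right_inv[OF assms])
  fix \<sigma> k assume \<sigma>: "\<sigma> \<in> Sn n" and k: "k \<in> I"
  let ?Y = "{1..n} - (I - {k})" and ?t = "\<lambda>z. Transposition.transpose k z"
  have "(\<Sum>z\<in>?Y. cv n f g (\<sigma> \<circ> ?t z)) = (\<Sum>\<tau>\<in>Sn n. f \<tau> * (\<Sum>z\<in>?Y. g (inv \<tau> \<circ> \<sigma> \<circ> ?t z)))"
    unfolding cv_def o_assoc sum_distrib_left by (rule sum.swap)
  also have "\<dots> = 0"
  proof (rule sum.neutral, rule ballI)
    fix \<tau> assume "\<tau> \<in> Sn n"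
    then have "inv \<tau> \<circ> \<sigma> \<in> Sn n" using \<sigma> by (intro Sn_comp Sn_inv)
    from pureD[OF assms this k] show "f \<tau> * (\<Sum>z\<in>?Y. g (inv \<tau> \<circ> \<sigma> \<circ> ?t z)) = 0" by simp
  qed
  finally show "(\<Sum>z\<in>?Y. cv n f g (\<sigma> \<circ> ?t z)) = 0" .
qed

text \<open>Right translation identifies the copies belonging to different sets of positions. As
  convolution commutes with it, a function may be moved to every \<open>D\<close> over which the
  final estimate averages.\<close>

lemma pure_relabel:
  assumes g: "g \<in> pure n I" and \<rho>: "\<rho> \<in> Sn n" and D: "\<rho> ` I = D" and I: "I \<subseteq> {1..n}"
  shows "(\<lambda>\<sigma>. g (\<sigma> \<circ> \<rho>)) \<in> pure n D"
proof -
  have \<rho>p: "\<rho> permutes {1..n}" using \<rho> by (simp add: Sn_iff)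
  have i1: "\<rho> (inv \<rho> x) = x" "inv \<rho> (\<rho> x) = x" for x
    using permutes_inverses[OF \<rho>p] by simp_all
  have inD: "\<rho> x \<in> D \<longleftrightarrow> x \<in> I" for x
    unfolding D[symmetric] by (rule inj_image_mem_iff[OF permutes_inj[OF \<rho>p]])
  have r: "(\<lambda>\<sigma>. g (\<sigma> \<circ> \<rho>)) \<in> right_inv n D"
    unfolding right_inv_def
  proof (intro CollectI ballI allI impI)
    fix \<sigma> \<pi> assume \<sigma>: "\<sigma> \<in> Sn n" and \<pi>: "\<pi> permutes ({1..n} - D)"
    have "\<pi> permutes {1..n}" using \<pi> by (rule permutes_subset) blast
    then have "inv \<rho> \<circ> (\<pi> \<circ> \<rho>) permutes {1..n}"
      using \<rho>p by (intro permutes_compose permutes_inv)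
    then have "inv \<rho> \<circ> (\<pi> \<circ> \<rho>) permutes ({1..n} - I)"
    proof (rule permutes_superset)
      fix x assume "x \<in> {1..n} - ({1..n} - I)"
      then have "\<rho> x \<notin> {1..n} - D" using inD by simp
      then show "(inv \<rho> \<circ> (\<pi> \<circ> \<rho>)) x = x" using permutes_not_in[OF \<pi>] i1 by simp
    qed
    from right_invD[OF pure_right_inv[OF g] Sn_comp[OF \<sigma> \<rho>] this]
    show "g (\<sigma> \<circ> \<pi> \<circ> \<rho>) = g (\<sigma> \<circ> \<rho>)" by (simp add: o_def i1)
  qed
  show ?thesis unfolding pure_def
  proof (intro CollectI conjI ballI r)
    fix \<sigma> k assume \<sigma>: "\<sigma> \<in> Sn n" and k: "k \<in> D"
    let ?t = "\<lambda>z. Transposition.transpose k z"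
    define l where "l = inv \<rho> k"
    have l: "\<rho> l = k" unfolding l_def by (rule i1)
    then have lI: "l \<in> I" unfolding inD[symmetric] using k by simp
    have "(\<Sum>z\<in>{1..n} - (D - {k}). g (\<sigma> \<circ> ?t z \<circ> \<rho>))
        = (\<Sum>z\<in>{1..n} - (I - {l}). g (\<sigma> \<circ> \<rho> \<circ> Transposition.transpose l z))"
    proof (rule sum.reindex_bij_witness[of _ \<rho> "inv \<rho>"])
      fix z assume "z \<in> {1..n} - (D - {k})"
      moreover have "inv \<rho> z \<in> {1..n} \<longleftrightarrow> z \<in> {1..n}"
        using permutes_in_image[OF permutes_inv[OF \<rho>p]] .
      moreover have "inv \<rho> z \<in> I \<longleftrightarrow> z \<in> D" using inD[of "inv \<rho> z"] i1 by simp
      moreover have "inv \<rho> z = l \<longleftrightarrow> z = k" using l i1 by auto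
      ultimately show "inv \<rho> z \<in> {1..n} - (I - {l})" by simp
      show "\<rho> (inv \<rho> z) = z" by (rule i1)
      have "Transposition.transpose (\<rho> l) (\<rho> y) (\<rho> x) = \<rho> (Transposition.transpose l y x)" for x y
        using inj_eq[OF permutes_inj[OF \<rho>p]] by (simp add: Transposition.transpose_def)
      from this[of "inv \<rho> z"] have "\<rho> \<circ> Transposition.transpose l (inv \<rho> z) = ?t z \<circ> \<rho>"
        unfolding l i1 fun_eq_iff by simp
      then show "g (\<sigma> \<circ> \<rho> \<circ> Transposition.transpose l (inv \<rho> z)) = g (\<sigma> \<circ> ?t z \<circ> \<rho>)"
        unfolding o_assoc[symmetric] by simp
    next
      fix z assume "z \<in> {1..n} - (I - {l})"
      moreover have "\<rho> z \<in> {1..n} \<longleftrightarrow> z \<in> {1..n}" using permutes_in_image[OF \<rho>p] .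
      moreover have "\<rho> z = k \<longleftrightarrow> z = l" using i1 l by (metis i1(2))
      ultimately show "\<rho> z \<in> {1..n} - (D - {k})" using inD[of z] by simp
      show "inv \<rho> (\<rho> z) = z" by (rule i1)
    qed
    also have "\<dots> = 0" by (rule pureD[OF g Sn_comp[OF \<sigma> \<rho>] lI])
    finally show "(\<Sum>z\<in>{1..n} - (D - {k}). g (\<sigma> \<circ> ?t z \<circ> \<rho>)) = 0" .
  qed
qed

text \<open>Modifying \<open>w\<close> at a point \<open>k\<close> of \<open>D\<close> that it sends outside \<open>D\<close>, the mean zero property expresses
  the correlation for \<open>w\<close> through \<open>s\<close> correlations of the same kind with \<open>s - 1\<close> such points.\<close>

lemma pure_correlation_le:
  assumes g: "g \<in> pure n D" and D: "D \<subseteq> {1..n}" and dn: "2 * card D < n"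
    and w: "w \<in> Sn n"
  shows "\<bar>\<Sum>\<sigma>\<in>Sn n. g \<sigma> * g (\<sigma> \<circ> w)\<bar>
    \<le> fact (card {k \<in> D. w k \<notin> D}) / real (n - 2 * card D) ^ card {k \<in> D. w k \<notin> D} * nsq n g"
  using w
proof (induction "card {k \<in> D. w k \<notin> D}" arbitrary: w)
  case 0
  have "(ip n g (\<lambda>\<sigma>. g (\<sigma> \<circ> w)))\<^sup>2 \<le> nsq n g * nsq n g"
    using ip_Cauchy_Schwarz[of n g "\<lambda>\<sigma>. g (\<sigma> \<circ> w)"] unfolding nsq_right[OF 0(2)] .
  then have "\<bar>ip n g (\<lambda>\<sigma>. g (\<sigma> \<circ> w))\<bar> \<le> nsq n g"
    by (metis abs_le_square_iff abs_of_nonneg nsq_nonneg power2_eq_square)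
  then show ?case unfolding 0(1)[symmetric] ip_def by (simp add: o_def)
next
  case (Suc s w)
  let ?X = "{1..n}" and ?M = "real (n - 2 * card D)" and ?d = "card D"
  define c where "c u = (\<Sum>\<sigma>\<in>Sn n. g \<sigma> * g (\<sigma> \<circ> u))" for u
  have finD: "finite D" using D finite_subset by blast
  have wp: "w permutes ?X" using Suc.prems by (simp add: Sn_iff)
  have "{k \<in> D. w k \<notin> D} \<noteq> {}" using Suc.hyps(2) by (metis card.empty nat.distinct(1))
  then obtain k where k: "k \<in> D" "w k \<notin> D" by blast
  let ?Y = "?X - (D - {k})" and ?t = "\<lambda>z. Transposition.transpose k z"
  \<comment> \<open>The mean zero relation is split by whether \<open>w z\<close> lies in
    \<open>D\<close>. For \<open>z \<in> G\<close> the modified permutation has the same correlation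
    as \<open>w\<close>; for \<open>z \<in> F\<close> one point fewer leaves
    \<open>D\<close>.\<close>
  define G where "G = {z \<in> ?Y. w z \<notin> D}"
  define F where "F = {z \<in> ?Y. w z \<in> D}"
  have F': "F = {z \<in> ?X - D. w z \<in> D}" unfolding F_def using k by blast
  \<comment> \<open>A permutation maps as many points into \<open>D\<close> from outside as it maps
    out of \<open>D\<close>.\<close>
  have cF: "card F = Suc s"
  proof -
    have "w ` {z \<in> ?X. w z \<in> D} = D"
    proof
      show "D \<subseteq> w ` {z \<in> ?X. w z \<in> D}"
      proof
        fix y assume y: "y \<in> D"
        then have "y \<in> w ` ?X" unfolding permutes_image[OF wp] using D by blast
        then show "y \<in> w ` {z \<in> ?X. w z \<in> D}" using y by blast
      qed
    qed blast
    moreover have "inj_on w {z \<in> ?X. w z \<in> D}" using permutes_inj[OF wp] by (rule inj_on_subset) simp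
    ultimately have "card {z \<in> ?X. w z \<in> D} = ?d" using card_image by fastforce
    also have "{z \<in> ?X. w z \<in> D} = F \<union> {z \<in> D. w z \<in> D}" unfolding F' using D by blast
    also have "card \<dots> = card F + card {z \<in> D. w z \<in> D}"
      unfolding F' using finD by (intro card_Un_disjoint) auto
    finally have "card F + card {z \<in> D. w z \<in> D} = ?d" .
    moreover have "?d = card {z \<in> D. w z \<in> D} + card {z \<in> D. w z \<notin> D}"
      using finD by (subst card_Un_disjoint[symmetric]) (auto intro: arg_cong[where f = card])
    ultimately show ?thesis using Suc.hyps(2) by simp
  qed
  have finGF: "finite G" "finite F" unfolding G_def F_def by simp_all
  \<comment> \<open>The set \<open>?Y\<close> has n - (d-1) points, and \<open>F\<close> takes away
    s + 1, which is at most d; here d is \<open>card D\<close>.\<close>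
  have cG: "?M \<le> real (card G)"
  proof -
    have "?Y = G \<union> F" "G \<inter> F = {}" unfolding G_def F_def by blast+
    then have "card ?Y = card G + Suc s" using card_Un_disjoint[OF finGF] cF by simp
    moreover have "card (D - {k}) = ?d - 1" "card (D - {k}) \<le> n" "D - {k} \<subseteq> ?X"
      using k D finD dn by (auto simp: card_Diff_singleton)
    moreover from this have "card ?Y = n - (?d - 1)"
      using finD by (simp add: card_Diff_subset)
    moreover have "Suc s \<le> ?d"
      unfolding Suc.hyps(2) using finD by (intro card_mono) auto
    ultimately show ?thesis by linarith
  qed
  have zero: "(\<Sum>z\<in>?Y. c (w \<circ> ?t z)) = 0"
  proof -
    have "(\<Sum>z\<in>?Y. c (w \<circ> ?t z)) = (\<Sum>\<sigma>\<in>Sn n. g \<sigma> * (\<Sum>z\<in>?Y. g (\<sigma> \<circ> w \<circ> ?t z)))"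
      unfolding c_def o_assoc sum_distrib_left by (rule sum.swap)
    also have "\<dots> = 0"
      using pureD[OF g Sn_comp[OF _ Suc.prems] k(1)] by (intro sum.neutral ballI) simp
    finally show ?thesis .
  qed
  have cw: "c (w \<circ> ?t z) = c w" if z: "z \<in> G" for z
  proof -
    define \<tau> where "\<tau> = Transposition.transpose (w k) (w z)"
    have zX: "z \<in> ?X" "w z \<notin> D" using z unfolding G_def by blast+
    have wX: "w k \<in> ?X" "w z \<in> ?X" using permutes_in_image[OF wp] k(1) D zX(1) by blast+
    have \<tau>: "\<tau> permutes (?X - D)" unfolding \<tau>_def using wX k(2) zX(2) by (intro permutes_swap_id) simp_all
    then have \<tau>S: "\<tau> \<in> Sn n" by (rule Sn_sub) blast
    have \<tau>\<tau>: "\<tau> \<circ> \<tau> = id" unfolding \<tau>_def by (simp add: fun_eq_iff)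
    \<comment> \<open>The transposition is moved to the other side of \<open>w\<close>. There it
      exchanges two points outside \<open>D\<close>, and after a change of variables it is absorbed
      by the invariance of the first factor.\<close>
    have "w \<circ> ?t z = \<tau> \<circ> w"
      unfolding \<tau>_def fun_eq_iff using inj_eq[OF permutes_inj[OF wp]] by (simp add: Transposition.transpose_def)
    then have "c (w \<circ> ?t z) = c (\<tau> \<circ> w)" by simp
    also have "\<dots> = (\<Sum>\<sigma>\<in>Sn n. g \<sigma> * g (\<sigma> \<circ> \<tau> \<circ> w))" unfolding c_def o_assoc ..
    also have "\<dots> = (\<Sum>\<sigma>\<in>Sn n. g (\<sigma> \<circ> \<tau>) * g (\<sigma> \<circ> \<tau> \<circ> \<tau> \<circ> w))"
      by (rule sum_Sn_right[OF \<tau>S, symmetric])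
    also have "\<dots> = c w"
      unfolding c_def
    proof (rule sum.cong[OF refl])
      fix \<sigma> assume \<sigma>: "\<sigma> \<in> Sn n"
      have "\<sigma> \<circ> \<tau> \<circ> \<tau> = \<sigma>" using \<tau>\<tau> by (metis comp_id o_assoc)
      then show "g (\<sigma> \<circ> \<tau>) * g (\<sigma> \<circ> \<tau> \<circ> \<tau> \<circ> w) = g \<sigma> * g (\<sigma> \<circ> w)"
        using right_invD[OF pure_right_inv[OF g] \<sigma> \<tau>] by simp
    qed
    finally show ?thesis .
  qed
  define b where "b = fact s / ?M ^ s * nsq n g"
  have cF': "\<bar>c (w \<circ> ?t z)\<bar> \<le> b" if z: "z \<in> F" for z
  proof -
    have zX: "z \<in> ?X" "z \<notin> D" "w z \<in> D" using z unfolding F' by blast+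
    have S: "w \<circ> ?t z \<in> Sn n" using Suc.prems k(1) D zX(1) by (intro Sn_comp Sn_transpose) blast+
    have "{j \<in> D. (w \<circ> ?t z) j \<notin> D} = {j \<in> D. w j \<notin> D} - {k}"
    proof (rule set_eqI)
      fix j
      have "(w \<circ> ?t z) j = (if j = k then w z else w j)" if "j \<in> D"
        using that zX(2) by (auto simp: Transposition.transpose_def)
      then show "j \<in> {j \<in> D. (w \<circ> ?t z) j \<notin> D} \<longleftrightarrow> j \<in> {j \<in> D. w j \<notin> D} - {k}"
        using zX(3) by (cases "j \<in> D") simp_all
    qed
    also have "card \<dots> = s" using Suc.hyps(2) k finD by (simp add: card_Diff_singleton)
    finally have "card {j \<in> D. (w \<circ> ?t z) j \<notin> D} = s" .
    then show ?thesis using Suc.hyps(1)[OF _ S] unfolding c_def b_def by simp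
  qed
  have "?Y = G \<union> F" "G \<inter> F = {}" unfolding G_def F_def by blast+
  then have "(\<Sum>z\<in>?Y. c (w \<circ> ?t z)) = (\<Sum>z\<in>G. c (w \<circ> ?t z)) + (\<Sum>z\<in>F. c (w \<circ> ?t z))"
    using sum.union_disjoint[OF finGF] by simp
  then have "real (card G) * c w = - (\<Sum>z\<in>F. c (w \<circ> ?t z))"
    using zero cw by simp
  then have "real (card G) * \<bar>c w\<bar> = \<bar>\<Sum>z\<in>F. c (w \<circ> ?t z)\<bar>"
    by (metis abs_minus_cancel abs_mult abs_of_nat)
  also have "\<dots> \<le> (\<Sum>z\<in>F. \<bar>c (w \<circ> ?t z)\<bar>)" by (rule sum_abs)
  also have "\<dots> \<le> real (Suc s) * b" using sum_bounded_above[of F _ b] cF' cF by metis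
  finally have "?M * \<bar>c w\<bar> \<le> real (Suc s) * b"
    using mult_right_mono[OF cG, of "\<bar>c w\<bar>"] by simp
  then have "\<bar>c w\<bar> \<le> real (Suc s) * b / ?M"
    using dn by (simp add: pos_le_divide_eq mult.commute)
  also have "\<dots> = fact (Suc s) / ?M ^ Suc s * nsq n g" unfolding b_def by (simp add: mult_ac)
  finally show ?case unfolding c_def Suc.hyps(2)[symmetric] .
qed

lemma ex_permutes_image:
  assumes "finite X" "I \<subseteq> X" "D \<subseteq> X" "card I = card D"
  obtains \<rho> where "\<rho> permutes X" "\<rho> ` I = D"
proof -
  have fin: "finite I" "finite D" using assms finite_subset by blast+
  obtain f where f: "bij_betw f I D" using finite_same_card_bij[OF fin assms(4)] by blast
  have "card (X - I) = card (X - D)" using assms fin by (simp add: card_Diff_subset)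
  then obtain f' where f': "bij_betw f' (X - I) (X - D)"
    using finite_same_card_bij[of "X - I" "X - D"] assms(1) by blast
  define \<rho> where "\<rho> x = (if x \<in> I then f x else if x \<in> X then f' x else x)" for x
  have 1: "bij_betw \<rho> I D" using f by (rule bij_betw_cong[THEN iffD1, rotated]) (simp add: \<rho>_def)
  have 2: "bij_betw \<rho> (X - I) (X - D)"
    using f' by (rule bij_betw_cong[THEN iffD1, rotated]) (simp add: \<rho>_def)
  have "bij_betw \<rho> (I \<union> (X - I)) (D \<union> (X - D))" by (rule bij_betw_combine[OF 1 2]) blast
  moreover have "I \<union> (X - I) = X" "D \<union> (X - D) = X" using assms by blast+
  ultimately have "bij_betw \<rho> X X" by simp
  then have "\<rho> permutes X" using assms(2) by (intro bij_imp_permutes) (auto simp: \<rho>_def)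
  moreover have "\<rho> ` I = D" using 1 by (rule bij_betw_imp_surj_on)
  ultimately show thesis by (rule that)
qed

section \<open>Differences across disjoint transpositions\<close>

lemma matching_Sn:
  assumes "2 * h \<le> n" "\<sigma> \<in> Sn n"
  shows "matching {1..n} {1..h} \<sigma> (\<lambda>k. \<sigma> (h + k))"
proof
  have p: "\<sigma> permutes {1..n}" using assms by (simp add: Sn_iff)
  have in1: "\<sigma> x \<in> {1..n}" if "x \<in> {1..n}" for x using permutes_in_image[OF p] that by blast
  note inj = inj_eq[OF permutes_inj[OF p]]
  show "inj_on \<sigma> {1..h}" "inj_on (\<lambda>k. \<sigma> (h + k)) {1..h}"
    by (rule inj_onI, simp add: inj)+
  show "\<sigma> ` {1..h} \<inter> (\<lambda>k. \<sigma> (h + k)) ` {1..h} = {}"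
  proof (rule equals0I)
    fix x assume "x \<in> \<sigma> ` {1..h} \<inter> (\<lambda>k. \<sigma> (h + k)) ` {1..h}"
    then obtain k l where "k \<in> {1..h}" "l \<in> {1..h}" "\<sigma> k = \<sigma> (h + l)"
      by (elim IntE imageE) simp
    then show False using inj by simp
  qed
  show "\<sigma> ` {1..h} \<subseteq> {1..n}" "(\<lambda>k. \<sigma> (h + k)) ` {1..h} \<subseteq> {1..n}"
    using assms(1) by (intro image_subsetI in1; simp)+
qed simp_all

text \<open>Only the images of \<open>{1..h}\<close> are fixed, because the functions in question
  depend on the restriction to a subset of \<open>{1..h}\<close>.\<close>

definition swaps :: "nat \<Rightarrow> nat \<Rightarrow> (nat set \<Rightarrow> nat \<Rightarrow> nat) \<Rightarrow> bool" where
  "swaps n h w \<longleftrightarrow> (\<forall>K\<subseteq>{1..h}. w K \<in> Sn n \<and> (\<forall>k\<in>K. w K k = h + k) \<and> (\<forall>k\<in>{1..h} - K. w K k = k))"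

lemma swaps_ex:
  assumes "2 * h \<le> n"
  obtains w where "swaps n h w"
proof -
  have idS: "id \<in> Sn n" by (simp add: Sn_iff permutes_id)
  interpret matching "{1..n}" "{1..h}" id "\<lambda>k. id (h + k)"
    by (rule matching_Sn[OF assms idS])
  have "\<forall>K. \<exists>s. K \<subseteq> {1..h} \<longrightarrow> s \<in> Sn n \<and> (\<forall>k\<in>K. s k = h + k) \<and> (\<forall>k\<in>{1..h} - K. s k = k)"
  proof
    fix K
    show "\<exists>s. K \<subseteq> {1..h} \<longrightarrow> s \<in> Sn n \<and> (\<forall>k\<in>K. s k = h + k) \<and> (\<forall>k\<in>{1..h} - K. s k = k)"
    proof (cases "K \<subseteq> {1..h}")
      case True
      obtain s where s: "s permutes id ` K \<union> (\<lambda>k. id (h + k)) ` K"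
        "\<And>k. k \<in> K \<Longrightarrow> s (id k) = id (h + k)" "\<And>k. k \<in> K \<Longrightarrow> s (id (h + k)) = id k"
      proof (rule swap_ex[OF True])
        fix s assume "s permutes id ` K \<union> (\<lambda>k. id (h + k)) ` K"
          "\<And>k. k \<in> K \<Longrightarrow> s (id k) = id (h + k)" "\<And>k. k \<in> K \<Longrightarrow> s (id (h + k)) = id k"
        then show thesis by (rule that)
      qed
      have "id ` K \<union> (\<lambda>k. id (h + k)) ` K \<subseteq> {1..n}" 
        using order_trans[OF image_mono[OF True] sub_a] order_trans[OF image_mono[OF True] sub_b]
        by (rule Un_least)
      with s(1) have 1: "s \<in> Sn n" by (rule Sn_sub)
      have 2: "s k = k" if k: "k \<in> {1..h} - K" for k
      proof -
        have "k \<in> {1..h}" "k \<notin> K" using k by simp_all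
        from ab_notin(1)[OF True this] show ?thesis using permutes_not_in[OF s(1)] by simp
      qed
      have 3: "s k = h + k" if "k \<in> K" for k using s(2)[OF that] by simp
      show ?thesis by (rule exI[of _ s]) (use 1 2 3 in simp)
    qed simp
  qed
  from choice[OF this] obtain w where "\<forall>K. K \<subseteq> {1..h} \<longrightarrow> w K \<in> Sn n \<and> (\<forall>k\<in>K. w K k = h + k) \<and> (\<forall>k\<in>{1..h} - K. w K k = k)"
    by (rule exE)
  then have "swaps n h w" unfolding swaps_def .
  then show thesis by (rule that)
qed

lemma swapsD:
  assumes "swaps n h w" "K \<subseteq> {1..h}"
  shows "w K \<in> Sn n" "\<And>k. k \<in> K \<Longrightarrow> w K k = h + k" "\<And>k. k \<in> {1..h} \<Longrightarrow> k \<notin> K \<Longrightarrow> w K k = k"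
  using assms unfolding swaps_def by blast+

text \<open>For a function of the restriction to \<open>D \<subseteq> {1..h}\<close> this is the
  product over \<open>k \<in> D\<close> of the operators "identity minus right translation by the
  transposition of \<open>k\<close> and \<open>h + k\<close>".\<close>

definition swap_diff :: "(nat set \<Rightarrow> nat \<Rightarrow> nat) \<Rightarrow> nat set \<Rightarrow> ((nat \<Rightarrow> nat) \<Rightarrow> real) \<Rightarrow> (nat \<Rightarrow> nat) \<Rightarrow> real" where
  "swap_diff w D g \<sigma> = (\<Sum>K\<in>Pow D. (- 1) ^ card K * g (\<sigma> \<circ> w K))"

lemma sum_geometric_third: "0 \<le> q \<Longrightarrow> q \<le> 1 / 3 \<Longrightarrow> (\<Sum>s=1..d. q ^ s) \<le> (1 / 2 :: real)"
proof -
  assume q: "0 \<le> q" "q \<le> 1 / 3"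
  have "(\<Sum>s=1..d. q ^ s) \<le> (\<Sum>s=1..d. (1 / 3) ^ s)" using q by (intro sum_mono power_mono)
  also have "\<dots> = 1 / 2 - (1 / 3) ^ d / 2"
  proof (induction d)
    case (Suc d)
    have "(1 / 3 :: real) ^ Suc d = (1 / 3) * (1 / 3) ^ d" by (rule power_Suc)
    moreover have "(\<Sum>s=1..Suc d. (1 / 3 :: real) ^ s) = (\<Sum>s=1..d. (1 / 3) ^ s) + (1 / 3) ^ Suc d"
      by (rule sum.cl_ivl_Suc[THEN trans]) simp
    ultimately show ?case using Suc by linarith
  qed simp
  also have "\<dots> \<le> 1 / 2" by simp
  finally show ?thesis .
qed

text \<open>The term for \<open>K = {}\<close> is the squared norm. \<open>w K\<close> sends exactly
  the points of \<open>K\<close> out of \<open>D\<close>, so \<open>pure_correlation_le\<close>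
  bounds the term for \<open>K\<close>. With \<open>d choose s\<close> sets of size
  \<open>s\<close>, these terms add up to at most a geometric sum with ratio d/(n-2d), at most 1/3
  when 5d is at most n; it takes away at most half.\<close>

lemma ip_swap_diff_ge:
  assumes g: "g \<in> pure n D" and w: "swaps n h w" and D: "D \<subseteq> {1..h}" and h: "2 * h \<le> n"
    and dn: "5 * card D \<le> n" "0 < n"
  shows "nsq n g / 2 \<le> ip n g (swap_diff w D g)"
proof -
  let ?M = "real (n - 2 * card D)" and ?d = "card D"
  have finD: "finite D" using D finite_subset by blast
  have DX: "D \<subseteq> {1..n}" using D h by auto
  have M: "0 < ?M" "3 * real ?d \<le> ?M" using dn by linarith+
  define c where "c K = (\<Sum>\<sigma>\<in>Sn n. g \<sigma> * g (\<sigma> \<circ> w K))" for K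
  have c_le: "\<bar>c K\<bar> \<le> fact (card K) / ?M ^ card K * nsq n g" if K: "K \<subseteq> D" for K
  proof -
    have Kh: "K \<subseteq> {1..h}" using K D by blast
    have "{k \<in> D. w K k \<notin> D} = K"
    proof (rule set_eqI)
      fix k
      show "k \<in> {k \<in> D. w K k \<notin> D} \<longleftrightarrow> k \<in> K"
      proof (cases "k \<in> K")
        case True
        have "k \<in> {1..h}" using True Kh by blast
        then have "h + k \<notin> D" using D by auto
        then show ?thesis using swapsD(2)[OF w Kh True] True K by auto
      next
        case False
        then show ?thesis using swapsD(3)[OF w Kh, of k] D by auto
      qed
    qed
    then show ?thesis
      using pure_correlation_le[OF g DX _ swapsD(1)[OF w Kh]] dn unfolding c_def by simp
  qed
  have c0: "c {} = nsq n g"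
  proof -
    have w0: "w {} \<in> Sn n" by (rule swapsD(1)[OF w]) simp
    have "w {} permutes {1..n} - D"
    proof (rule permutes_superset[of _ "{1..n}"])
      show "w {} permutes {1..n}" using w0 by (simp add: Sn_iff)
      fix x assume "x \<in> {1..n} - ({1..n} - D)"
      then have "x \<in> {1..h}" using D by blast
      then show "w {} x = x" using swapsD(3)[OF w, of "{}" x] by simp
    qed
    then have "g (\<sigma> \<circ> w {}) = g \<sigma>" if "\<sigma> \<in> Sn n" for \<sigma>
      using right_invD[OF pure_right_inv[OF g] that] by simp
    then show ?thesis unfolding c_def nsq_def power2_eq_square by simp
  qed
  have "ip n g (swap_diff w D g) = (\<Sum>\<sigma>\<in>Sn n. \<Sum>K\<in>Pow D. (- 1) ^ card K * (g \<sigma> * g (\<sigma> \<circ> w K)))"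
    unfolding ip_def swap_diff_def sum_distrib_left by (simp only: mult_ac)
  also have "\<dots> = (\<Sum>K\<in>Pow D. (- 1) ^ card K * c K)"
    unfolding c_def sum_distrib_left by (rule sum.swap)
  also have "\<dots> = nsq n g + (\<Sum>K\<in>Pow D - {{}}. (- 1) ^ card K * c K)"
    using finD by (subst sum.remove[of _ "{}"]) (simp_all add: c0)
  finally have e: "ip n g (swap_diff w D g) = nsq n g + (\<Sum>K\<in>Pow D - {{}}. (- 1) ^ card K * c K)" .
  have "\<bar>\<Sum>K\<in>Pow D - {{}}. (- 1) ^ card K * c K\<bar> \<le> (\<Sum>K\<in>Pow D - {{}}. \<bar>(- 1) ^ card K * c K\<bar>)"
    by (rule sum_abs)
  also have "\<dots> \<le> (\<Sum>K\<in>Pow D - {{}}. fact (card K) / ?M ^ card K * nsq n g)"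
  proof (rule sum_mono)
    fix K assume "K \<in> Pow D - {{}}"
    then show "\<bar>(- 1) ^ card K * c K\<bar> \<le> fact (card K) / ?M ^ card K * nsq n g"
      using c_le[of K] by (simp add: abs_mult power_abs)
  qed
  also have "\<dots> = (\<Sum>s\<in>{1..?d}. \<Sum>K\<in>{K \<in> Pow D - {{}}. card K = s}. fact (card K) / ?M ^ card K * nsq n g)"
  proof (rule sum.group[symmetric])
    show "card ` (Pow D - {{}}) \<subseteq> {1..?d}"
    proof
      fix s assume "s \<in> card ` (Pow D - {{}})"
      then obtain K where K: "K \<subseteq> D" "K \<noteq> {}" "s = card K" by blast
      then have "finite K" using finD finite_subset by blast
      then show "s \<in> {1..?d}" using K card_mono[OF finD K(1)] by (simp add: Suc_le_eq card_gt_0_iff)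
    qed
  qed (use finD in simp_all)
  also have "\<dots> \<le> (\<Sum>s\<in>{1..?d}. (real ?d / ?M) ^ s * nsq n g)"
  proof (rule sum_mono)
    fix s assume s: "s \<in> {1..?d}"
    have "{K \<in> Pow D - {{}}. card K = s} = {K. K \<subseteq> D \<and> card K = s}" using s by auto
    then have "(\<Sum>K\<in>{K \<in> Pow D - {{}}. card K = s}. fact (card K) / ?M ^ card K * nsq n g)
        = real ((?d choose s) * fact s) / ?M ^ s * nsq n g"
      using n_subsets[OF finD, of s] by simp
    also have "\<dots> \<le> real (?d ^ s) / ?M ^ s * nsq n g"
      using M by (intro mult_right_mono divide_right_mono of_nat_mono binomial_fact_pow nsq_nonneg) simp_all
    also have "\<dots> = (real ?d / ?M) ^ s * nsq n g" by (simp add: power_divide)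
    finally show "(\<Sum>K\<in>{K \<in> Pow D - {{}}. card K = s}. fact (card K) / ?M ^ card K * nsq n g)
      \<le> (real ?d / ?M) ^ s * nsq n g" .
  qed
  also have "\<dots> = (\<Sum>s=1..?d. (real ?d / ?M) ^ s) * nsq n g" by (simp add: sum_distrib_right)
  also have "\<dots> \<le> 1 / 2 * nsq n g"
    using M by (intro mult_right_mono sum_geometric_third nsq_nonneg) (simp_all add: field_simps)
  finally show ?thesis using e by linarith
qed

lemma nsq_le_swap_diff:
  assumes "g \<in> pure n D" "swaps n h w" "D \<subseteq> {1..h}" "2 * h \<le> n" "5 * card D \<le> n" "0 < n"
  shows "nsq n g \<le> 4 * nsq n (swap_diff w D g)"
proof (cases "nsq n g = 0")
  case True
  then show ?thesis using nsq_nonneg[of n "swap_diff w D g"] by simp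
next
  case False
  then have pos: "0 < nsq n g" using nsq_nonneg[of n g] by simp
  have "(nsq n g / 2)\<^sup>2 \<le> (ip n g (swap_diff w D g))\<^sup>2"
    using ip_swap_diff_ge[OF assms] pos by (intro power_mono) simp_all
  also have "\<dots> \<le> nsq n g * nsq n (swap_diff w D g)" by (rule ip_Cauchy_Schwarz)
  finally have "nsq n g * nsq n g \<le> nsq n g * (4 * nsq n (swap_diff w D g))"
    by (simp add: power2_eq_square)
  then show ?thesis using pos by simp
qed

text \<open>In the variables \<open>\<sigma>\<close> and \<open>\<rho>\<close> this is the kernel of
  the map from \<open>g\<close> to the swap difference of its convolution with \<open>A\<close>. It
  is also the level coefficient of \<open>A\<close> at the graph of \<open>\<rho>\<close> on
  \<open>D\<close>, for the pairs \<open>\<sigma> k\<close>,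
  \<open>\<sigma> (h + k)\<close>.\<close>

definition graph_sum :: "nat \<Rightarrow> (nat \<Rightarrow> nat) set \<Rightarrow> (nat \<Rightarrow> nat) \<Rightarrow> nat set \<Rightarrow> (nat \<Rightarrow> nat) \<Rightarrow> real" where
  "graph_sum h A \<sigma> D \<rho> = (\<Sum>\<tau>\<in>A. \<Prod>k\<in>D. of_bool (\<tau> (\<rho> k) = \<sigma> k) - of_bool (\<tau> (\<rho> k) = \<sigma> (h + k)))"

lemma sum_right_inv:
  assumes g: "g \<in> right_inv n D" and D: "D \<subseteq> {1..n}" and \<sigma>: "\<sigma> \<in> Sn n"
  shows "(\<Sum>\<rho>\<in>{\<rho> \<in> Sn n. \<forall>k\<in>D. \<rho> k = \<sigma> k}. g \<rho>) = fact (n - card D) * g \<sigma>"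
proof -
  let ?Q = "(\<lambda>k. (k, \<sigma> k)) ` D"
  have \<sigma>p: "\<sigma> permutes {1..n}" using \<sigma> by (simp add: Sn_iff)
  have P: "{\<rho> \<in> Sn n. \<forall>k\<in>D. \<rho> k = \<sigma> k} = perm_ext {1..n} ?Q"
    unfolding perm_ext_def Sn_def by simp
  have QX: "?Q \<subseteq> {1..n} \<times> {1..n}"
    using D permutes_in_image[OF \<sigma>p] by (intro image_subsetI SigmaI) blast+
  have "\<sigma> \<in> perm_ext {1..n} ?Q" using \<sigma> P by blast
  then have ne: "perm_ext {1..n} ?Q \<noteq> {}" by blast
  have "card ?Q = card D" by (rule card_image) (simp add: inj_on_def)
  then have c: "card (perm_ext {1..n} ?Q) = fact (n - card D)"
    using card_perm_ext[OF _ QX ne] by simp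
  have "g \<rho> = g \<sigma>" if "\<rho> \<in> perm_ext {1..n} ?Q" for \<rho>
  proof -
    have \<rho>: "\<rho> permutes {1..n}" "\<And>k. k \<in> D \<Longrightarrow> \<rho> k = \<sigma> k"
      using that unfolding P[symmetric] by (simp_all add: Sn_iff)
    have "inv \<sigma> \<circ> \<rho> permutes {1..n}" using \<rho>(1) permutes_inv[OF \<sigma>p] by (rule permutes_compose)
    then have "inv \<sigma> \<circ> \<rho> permutes {1..n} - D"
    proof (rule permutes_superset)
      fix x assume "x \<in> {1..n} - ({1..n} - D)"
      then show "(inv \<sigma> \<circ> \<rho>) x = x" using \<rho>(2)[of x] permutes_inverses(2)[OF \<sigma>p] by simp
    qed
    from right_invD[OF g \<sigma> this] show ?thesis
      unfolding o_assoc permutes_inv_o(1)[OF \<sigma>p] by simp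
  qed
  then show ?thesis unfolding P using c by simp
qed

text \<open>Since \<open>g\<close> depends on the restriction to \<open>D\<close>, its value is an
  average over all permutations with that restriction. The alternating sum over \<open>K\<close>
  then factors into a product of differences. This kernel form is what the Hilbert-Schmidt bound
  needs.\<close>

lemma swap_diff_cv:
  assumes g: "g \<in> right_inv n D" and w: "swaps n h w" and D: "D \<subseteq> {1..h}" and h: "2 * h \<le> n"
    and \<sigma>: "\<sigma> \<in> Sn n" and A: "A \<subseteq> Sn n"
  shows "fact (n - card D) * swap_diff w D (cv n (indicator A) g) \<sigma> = (\<Sum>\<rho>\<in>Sn n. g \<rho> * graph_sum h A \<sigma> D \<rho>)"
proof -
  have finD: "finite D" using D finite_subset by blast
  have DX: "D \<subseteq> {1..n}" using D h by auto
  have key: "fact (n - card D) * g (inv \<tau> \<circ> (\<sigma> \<circ> w K))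
      = (\<Sum>\<rho>\<in>Sn n. g \<rho> * (\<Prod>k\<in>D. of_bool (\<tau> (\<rho> k) = \<sigma> (w K k))))"
    if \<tau>: "\<tau> \<in> A" and K: "K \<subseteq> D" for \<tau> K
  proof -
    have \<tau>S: "\<tau> \<in> Sn n" using \<tau> A by blast
    then have \<tau>p: "\<tau> permutes {1..n}" by (simp add: Sn_iff)
    have Kh: "K \<subseteq> {1..h}" using K D by blast
    let ?\<sigma> = "inv \<tau> \<circ> (\<sigma> \<circ> w K)"
    have S: "?\<sigma> \<in> Sn n" using \<tau>S \<sigma> swapsD(1)[OF w Kh] by (intro Sn_comp Sn_inv)
    have i: "y = inv \<tau> x \<longleftrightarrow> \<tau> y = x" for x y
      unfolding permutes_inv_eq[OF \<tau>p, symmetric] by (rule eq_commute)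
    have "fact (n - card D) * g ?\<sigma> = (\<Sum>\<rho>\<in>{\<rho> \<in> Sn n. \<forall>k\<in>D. \<rho> k = ?\<sigma> k}. g \<rho>)"
      by (rule sum_right_inv[OF g DX S, symmetric])
    also have "\<dots> = (\<Sum>\<rho>\<in>Sn n. if \<forall>k\<in>D. \<rho> k = ?\<sigma> k then g \<rho> else 0)"
      by (rule sum.inter_filter[OF finite_Sn])
    also have "\<dots> = (\<Sum>\<rho>\<in>Sn n. g \<rho> * (\<Prod>k\<in>D. of_bool (\<tau> (\<rho> k) = \<sigma> (w K k))))"
    proof (rule sum.cong[OF refl])
      fix \<rho>
      have "(\<Prod>k\<in>D. of_bool (\<tau> (\<rho> k) = \<sigma> (w K k)) :: real) = of_bool (\<forall>k\<in>D. \<tau> (\<rho> k) = \<sigma> (w K k))"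
        using finD by (induction D rule: finite_induct) simp_all
      then show "(if \<forall>k\<in>D. \<rho> k = ?\<sigma> k then g \<rho> else 0)
          = g \<rho> * (\<Prod>k\<in>D. of_bool (\<tau> (\<rho> k) = \<sigma> (w K k)))"
        by (simp add: i)
    qed
    finally show ?thesis .
  qed
  have pr: "(\<Sum>K\<in>Pow D. (- 1) ^ card K * (\<Prod>k\<in>D. of_bool (\<tau> (\<rho> k) = \<sigma> (w K k))))
      = (\<Prod>k\<in>D. of_bool (\<tau> (\<rho> k) = \<sigma> k) - of_bool (\<tau> (\<rho> k) = \<sigma> (h + k)) :: real)" for \<tau> \<rho>
  proof -
    have "(\<Prod>k\<in>D. of_bool (\<tau> (\<rho> k) = \<sigma> k) - of_bool (\<tau> (\<rho> k) = \<sigma> (h + k)) :: real)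
        = (\<Prod>k\<in>D. (- 1) * of_bool (\<tau> (\<rho> k) = \<sigma> (h + k)) + of_bool (\<tau> (\<rho> k) = \<sigma> k))"
      by (rule prod.cong) simp_all
    also have "\<dots> = (\<Sum>K\<in>Pow D. (\<Prod>k\<in>K. (- 1) * of_bool (\<tau> (\<rho> k) = \<sigma> (h + k))) * (\<Prod>k\<in>D - K. of_bool (\<tau> (\<rho> k) = \<sigma> k)))"
      by (rule prod_add[OF finD])
    also have "\<dots> = (\<Sum>K\<in>Pow D. (- 1) ^ card K * (\<Prod>k\<in>D. of_bool (\<tau> (\<rho> k) = \<sigma> (w K k))))"
    proof (rule sum.cong[OF refl])
      fix K assume "K \<in> Pow D"
      then have K: "K \<subseteq> D" "K \<subseteq> {1..h}" using D by blast+
      have "(\<Prod>k\<in>D. of_bool (\<tau> (\<rho> k) = \<sigma> (w K k)) :: real)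
          = (\<Prod>k\<in>D - K. of_bool (\<tau> (\<rho> k) = \<sigma> (w K k))) * (\<Prod>k\<in>K. of_bool (\<tau> (\<rho> k) = \<sigma> (w K k)))"
        by (rule prod.subset_diff[OF K(1) finD])
      also have "(\<Prod>k\<in>D - K. of_bool (\<tau> (\<rho> k) = \<sigma> (w K k)) :: real) = (\<Prod>k\<in>D - K. of_bool (\<tau> (\<rho> k) = \<sigma> k))"
        using swapsD(3)[OF w K(2)] D by (intro prod.cong) auto
      also have "(\<Prod>k\<in>K. of_bool (\<tau> (\<rho> k) = \<sigma> (w K k)) :: real) = (\<Prod>k\<in>K. of_bool (\<tau> (\<rho> k) = \<sigma> (h + k)))"
        using swapsD(2)[OF w K(2)] by (intro prod.cong) auto
      finally show "(\<Prod>k\<in>K. (- 1) * of_bool (\<tau> (\<rho> k) = \<sigma> (h + k)) :: real) * (\<Prod>k\<in>D - K. of_bool (\<tau> (\<rho> k) = \<sigma> k))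
          = (- 1) ^ card K * (\<Prod>k\<in>D. of_bool (\<tau> (\<rho> k) = \<sigma> (w K k)))"
        unfolding prod.distrib by simp
    qed
    finally show ?thesis by (rule sym)
  qed
  have "fact (n - card D) * swap_diff w D (cv n (indicator A) g) \<sigma>
      = (\<Sum>K\<in>Pow D. (- 1) ^ card K * (\<Sum>\<tau>\<in>A. fact (n - card D) * g (inv \<tau> \<circ> (\<sigma> \<circ> w K))))"
    unfolding swap_diff_def cv_indicator[OF A] sum_distrib_left by (simp only: mult_ac)
  also have "\<dots> = (\<Sum>K\<in>Pow D. (- 1) ^ card K * (\<Sum>\<tau>\<in>A. \<Sum>\<rho>\<in>Sn n. g \<rho> * (\<Prod>k\<in>D. of_bool (\<tau> (\<rho> k) = \<sigma> (w K k)))))"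
  proof (rule sum.cong[OF refl])
    fix K assume "K \<in> Pow D"
    then have K: "K \<subseteq> D" by blast
    have "(\<Sum>\<tau>\<in>A. fact (n - card D) * g (inv \<tau> \<circ> (\<sigma> \<circ> w K)))
        = (\<Sum>\<tau>\<in>A. \<Sum>\<rho>\<in>Sn n. g \<rho> * (\<Prod>k\<in>D. of_bool (\<tau> (\<rho> k) = \<sigma> (w K k))))"
      by (rule sum.cong[OF refl], rule key[OF _ K])
    then show "(- 1) ^ card K * (\<Sum>\<tau>\<in>A. fact (n - card D) * g (inv \<tau> \<circ> (\<sigma> \<circ> w K)))
      = (- 1) ^ card K * (\<Sum>\<tau>\<in>A. \<Sum>\<rho>\<in>Sn n. g \<rho> * (\<Prod>k\<in>D. of_bool (\<tau> (\<rho> k) = \<sigma> (w K k))))"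
      by (rule arg_cong)
  qed
  also have "\<dots> = (\<Sum>K\<in>Pow D. \<Sum>\<rho>\<in>Sn n. \<Sum>\<tau>\<in>A. g \<rho> * ((- 1) ^ card K * (\<Prod>k\<in>D. of_bool (\<tau> (\<rho> k) = \<sigma> (w K k)))))"
    unfolding sum_distrib_left by (subst sum.swap) (simp only: mult_ac)
  also have "\<dots> = (\<Sum>\<rho>\<in>Sn n. \<Sum>K\<in>Pow D. \<Sum>\<tau>\<in>A. g \<rho> * ((- 1) ^ card K * (\<Prod>k\<in>D. of_bool (\<tau> (\<rho> k) = \<sigma> (w K k)))))"
    by (rule sum.swap)
  also have "\<dots> = (\<Sum>\<rho>\<in>Sn n. \<Sum>\<tau>\<in>A. \<Sum>K\<in>Pow D. g \<rho> * ((- 1) ^ card K * (\<Prod>k\<in>D. of_bool (\<tau> (\<rho> k) = \<sigma> (w K k)))))"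
    by (rule sum.cong[OF refl], rule sum.swap)
  also have "\<dots> = (\<Sum>\<rho>\<in>Sn n. g \<rho> * graph_sum h A \<sigma> D \<rho>)"
    unfolding graph_sum_def sum_distrib_left[symmetric] pr ..
  finally show ?thesis .
qed

section \<open>The operator bound on functions of \<open>d\<close> values\<close>

locale global_indicator =
  fixes n :: nat and A :: "(nat \<Rightarrow> nat) set" and \<mu> r L :: real and d :: nat
  assumes A: "A \<subseteq> Sn n" and \<mu>: "0 < \<mu>" "exp (- L) \<le> \<mu>" and r: "1 \<le> r"
    and glob: "\<And>Q. Q \<subseteq> {1..n} \<times> {1..n} \<Longrightarrow>
      real (card (A \<inter> perm_ext {1..n} Q)) \<le> \<mu> * r ^ (2 * card Q) * fact (n - card Q)"
    and d: "0 < d" "8 * real d \<le> L" and L: "8 * L \<le> real n"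
begin

definition Y :: real where "Y = 8 * exp 16 * r ^ 4 * L / real n"

text \<open>A set \<open>E\<close> is the graph on its domain of at most \<open>fact (n - d)\<close>
  permutations. All \<open>D\<close> are taken together because \<open>Z\<close> runs over the
  graphs on all \<open>d\<close>-sets.\<close>

lemma graph_sum_square_le:
  assumes h: "2 * h \<le> n" and \<sigma>: "\<sigma> \<in> Sn n"
  shows "(\<Sum>D\<in>{D. D \<subseteq> {1..h} \<and> card D = d}. \<Sum>\<rho>\<in>Sn n. (graph_sum h A \<sigma> D \<rho>)\<^sup>2)
    \<le> fact (n - d) * ((fact n)\<^sup>2 * \<mu>\<^sup>2 * Y ^ d / fact d)"
proof -
  interpret matching "{1..n}" "{1..h}" \<sigma> "\<lambda>k. \<sigma> (h + k)"
    by (rule matching_Sn[OF h \<sigma>])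
  interpret lv: level "{1..n}" "{1..h}" \<sigma> "\<lambda>k. \<sigma> (h + k)" A \<mu> r L d
    using \<mu> r glob d L by unfold_locales simp_all
  let ?X = "{1..n}" and ?H = "{1..h}"
  let ?Ds = "{D. D \<subseteq> ?H \<and> card D = d}" and ?G = "\<lambda>\<rho> D. (\<lambda>k. (k, \<rho> k)) ` D"
  have HX: "?H \<subseteq> ?X" using h by auto
  have fEs: "finite (Es ?H d)" by (rule finite_Es) simp
  have gs: "graph_sum h A \<sigma> D \<rho> = lv.S {} (?G \<rho> D)" for D \<rho>
  proof -
    have "inj_on (\<lambda>k. (k, \<rho> k)) D" by (simp add: inj_on_def)
    then have "sgp (?G \<rho> D) \<tau> = (\<Prod>k\<in>D. of_bool (\<tau> (\<rho> k) = \<sigma> k) - of_bool (\<tau> (\<rho> k) = \<sigma> (h + k)))" for \<tau>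
      unfolding sgp_def by (simp add: prod.reindex sg_def)
    moreover have "A \<inter> perm_ext ?X {} = A" using A Sn_perm_ext by blast
    ultimately show ?thesis unfolding graph_sum_def lv.S_def by simp
  qed
  have "(\<Sum>D\<in>?Ds. \<Sum>\<rho>\<in>Sn n. (graph_sum h A \<sigma> D \<rho>)\<^sup>2)
      \<le> (\<Sum>D\<in>?Ds. \<Sum>E\<in>{E \<in> Es ?H d. fst ` E = D}. fact (n - d) * (lv.S {} E)\<^sup>2)"
  proof (rule sum_mono)
    fix D assume "D \<in> ?Ds"
    then have D: "D \<subseteq> ?H" "card D = d" by blast+
    have img: "(\<lambda>\<rho>. ?G \<rho> D) ` Sn n \<subseteq> {E \<in> Es ?H d. fst ` E = D}"
    proof (rule image_subsetI)
      fix \<rho> assume "\<rho> \<in> Sn n"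
      then have p: "\<rho> permutes ?X" by (simp add: Sn_iff)
      have "?G \<rho> D \<subseteq> ?H \<times> ?X"
        using D(1) HX permutes_in_image[OF p] by (intro image_subsetI SigmaI) blast+
      moreover have "card (?G \<rho> D) = d" using D(2) by (subst card_image) (simp_all add: inj_on_def)
      moreover have "inj_on fst (?G \<rho> D)" by (rule inj_onI) auto
      moreover have "fst ` ?G \<rho> D = D" by (simp add: image_image)
      ultimately show "?G \<rho> D \<in> {E \<in> Es ?H d. fst ` E = D}" unfolding Es_def by blast
    qed
    have "(\<Sum>\<rho>\<in>Sn n. (graph_sum h A \<sigma> D \<rho>)\<^sup>2)
        = (\<Sum>E\<in>{E \<in> Es ?H d. fst ` E = D}. \<Sum>\<rho>\<in>{\<rho> \<in> Sn n. ?G \<rho> D = E}. (lv.S {} (?G \<rho> D))\<^sup>2)"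
      unfolding gs by (rule sum.group[symmetric, OF finite_Sn _ img]) (use fEs in simp)
    also have "\<dots> \<le> (\<Sum>E\<in>{E \<in> Es ?H d. fst ` E = D}. fact (n - d) * (lv.S {} E)\<^sup>2)"
    proof (rule sum_mono)
      fix E assume "E \<in> {E \<in> Es ?H d. fst ` E = D}"
      then have E: "E \<subseteq> ?H \<times> ?X" "card E = d" unfolding Es_def by blast+
      have "E \<subseteq> ?X \<times> ?X" using E(1) HX by blast
      from card_perm_ext_le[OF _ this] have c: "real (card (perm_ext ?X E)) \<le> fact (n - d)"
        using E(2) by simp
      have "{\<rho> \<in> Sn n. ?G \<rho> D = E} \<subseteq> perm_ext ?X E"
      proof
        fix \<rho> assume "\<rho> \<in> {\<rho> \<in> Sn n. ?G \<rho> D = E}"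
        then have "\<rho> permutes ?X" "E = ?G \<rho> D" by (simp_all add: Sn_iff)
        then show "\<rho> \<in> perm_ext ?X E" unfolding perm_ext_def by simp
      qed
      then have "card {\<rho> \<in> Sn n. ?G \<rho> D = E} \<le> card (perm_ext ?X E)"
        by (intro card_mono finite_perm_ext) simp_all
      then have "real (card {\<rho> \<in> Sn n. ?G \<rho> D = E}) \<le> fact (n - d)" using c by linarith
      then have "real (card {\<rho> \<in> Sn n. ?G \<rho> D = E}) * (lv.S {} E)\<^sup>2 \<le> fact (n - d) * (lv.S {} E)\<^sup>2"
        by (rule mult_right_mono) simp
      then show "(\<Sum>\<rho>\<in>{\<rho> \<in> Sn n. ?G \<rho> D = E}. (lv.S {} (?G \<rho> D))\<^sup>2) \<le> fact (n - d) * (lv.S {} E)\<^sup>2"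
        by simp
    qed
    finally show "(\<Sum>\<rho>\<in>Sn n. (graph_sum h A \<sigma> D \<rho>)\<^sup>2)
      \<le> (\<Sum>E\<in>{E \<in> Es ?H d. fst ` E = D}. fact (n - d) * (lv.S {} E)\<^sup>2)" .
  qed
  also have "\<dots> = (\<Sum>E\<in>Es ?H d. fact (n - d) * (lv.S {} E)\<^sup>2)"
  proof (rule sum.group[OF fEs])
    show "finite ?Ds" by (rule finite_subset[of _ "Pow ?H"]) auto
    show "(\<lambda>E. fst ` E) ` Es ?H d \<subseteq> ?Ds"
    proof (rule image_subsetI)
      fix E assume "E \<in> Es ?H d"
      then have E: "E \<subseteq> ?H \<times> ?X" "card E = d" "inj_on fst E" unfolding Es_def by blast+
      have "fst ` E \<subseteq> ?H" using E(1) by auto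
      then show "fst ` E \<in> ?Ds" using card_image[OF E(3)] E(2) by simp
    qed
  qed
  also have "\<dots> = fact (n - d) * lv.Z {} ?H d"
    unfolding lv.Z_def sum_distrib_left ..
  also have "\<dots> \<le> fact (n - d) * lv.W 0 d"
  proof (rule mult_left_mono)
    have "avoids {} ?H" unfolding avoids_def by blast
    from lv.level_inequality[OF this, of d] show "lv.Z {} ?H d \<le> lv.W 0 d" by simp
  qed simp
  also have "lv.W 0 d = (fact n)\<^sup>2 * \<mu>\<^sup>2 * Y ^ d / fact d"
    unfolding lv.W_def lv.Y_def Y_def by simp
  finally show ?thesis .
qed

lemma Y_nonneg: "0 \<le> Y"
  unfolding Y_def using d r by simp

text \<open>Both \<open>fact n / fact (n - d)\<close> and \<open>(h choose d) * fact d\<close> are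
  products of \<open>d\<close> factors. Those of the first are at most n, those of the second at
  least n/4, because \<open>d\<close> is small compared with \<open>h\<close>. This is the loss from
  confining \<open>D\<close> to half of the points.\<close>

lemma binomial_ratio_le:
  assumes "h = n div 2"
  shows "fact n \<le> 4 ^ d * (real (h choose d) * fact d * fact (n - d))"
proof -
  have "64 * real d \<le> real n" using d L by linarith
  then have dn: "64 * d \<le> n" by (metis of_nat_le_iff of_nat_mult of_nat_numeral)
  then have hd: "d \<le> h" "real n / 4 \<le> real (h - d)" using assms d(1) by linarith+
  have "fact (h - d) * (real n / 4) ^ d \<le> fact h" by (rule fact_diff_power_le[OF hd(1) _ hd(2)]) simp
  also have "fact h = real (h choose d) * fact d * fact (h - d)"
  proof -
    have "real (fact d * fact (h - d) * (h choose d)) = real (fact h)"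
      by (rule arg_cong[OF binomial_fact_lemma[OF hd(1)]])
    then show ?thesis by (simp add: mult_ac)
  qed
  finally have "(real n / 4) ^ d * fact (h - d) \<le> real (h choose d) * fact d * fact (h - d)"
    by (simp only: mult.commute)
  then have 1: "(real n / 4) ^ d \<le> real (h choose d) * fact d"
    by (rule mult_right_le_imp_le) simp
  have "fact n \<le> real n ^ d * fact (n - d)"
  proof -
    have "fact n div fact (n - d) \<le> n ^ d" using dn by (intro fact_div_fact_le_pow) simp
    moreover have "fact (n - d) dvd (fact n :: nat)" by (rule fact_dvd) simp
    ultimately have "fact n \<le> n ^ d * (fact (n - d) :: nat)"
      using mult_le_mono1[of "fact n div fact (n - d)" "n ^ d" "fact (n - d)"] by simp
    then have "real (fact n) \<le> real (n ^ d * fact (n - d))" by (rule of_nat_mono)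
    then show ?thesis by simp
  qed
  also have "\<dots> = 4 ^ d * ((real n / 4) ^ d * fact (n - d))" by (simp add: power_divide)
  also have "\<dots> \<le> 4 ^ d * (real (h choose d) * fact d * fact (n - d))"
    using 1 by (intro mult_left_mono mult_right_mono) simp_all
  finally show ?thesis .
qed

text \<open>The same norm is estimated through every \<open>D\<close> and the estimates are added,
  so that the right-hand side is the total controlled by \<open>graph_sum_square_le\<close>.
  Division by \<open>h choose d\<close> leaves \<open>4 ^ d\<close>. The factor 4 of the swap
  difference is at most another \<open>4 ^ d\<close>, whence the 16.\<close>

lemma cv_pure_norm_le:
  assumes I: "I \<subseteq> {1..n}" "card I = d" and g: "g \<in> pure n I"
  shows "nsq n (cv n (indicator A) g) \<le> (16 * Y) ^ d * (fact n * \<mu>)\<^sup>2 * nsq n g"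
proof -
  define h where "h = n div 2"
  have h: "2 * h \<le> n" unfolding h_def by simp
  have "64 * real d \<le> real n" using d L by linarith
  then have dn: "64 * d \<le> n" by (metis of_nat_le_iff of_nat_mult of_nat_numeral)
  obtain w where w: "swaps n h w" using swaps_ex[OF h] by blast
  let ?Ds = "{D. D \<subseteq> {1..h} \<and> card D = d}"
  let ?N = "nsq n (cv n (indicator A) g)"
  define F :: real where "F = fact (n - d)"
  have F: "0 < F" unfolding F_def by simp
  have each: "F\<^sup>2 * ?N \<le> 4 * nsq n g * (\<Sum>\<sigma>\<in>Sn n. \<Sum>\<rho>\<in>Sn n. (graph_sum h A \<sigma> D \<rho>)\<^sup>2)" if "D \<in> ?Ds" for D
  proof -
    have D: "D \<subseteq> {1..h}" "card D = d" using that by blast+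
    have DX: "D \<subseteq> {1..n}" using D(1) h by auto
    obtain \<rho> where \<rho>: "\<rho> permutes {1..n}" "\<rho> ` I = D"
      using ex_permutes_image[OF _ I(1) DX] I(2) D(2) by auto
    have \<rho>S: "\<rho> \<in> Sn n" using \<rho>(1) by (simp add: Sn_iff)
    define g' where "g' = (\<lambda>\<sigma>. g (\<sigma> \<circ> \<rho>))"
    have g': "g' \<in> pure n D" unfolding g'_def by (rule pure_relabel[OF g \<rho>S \<rho>(2) I(1)])
    define cg where "cg = cv n (indicator A) g'"
    have "cg = (\<lambda>\<sigma>. cv n (indicator A) g (\<sigma> \<circ> \<rho>))"
      unfolding cg_def g'_def by (rule ext) (rule cv_right)
    then have ncg: "nsq n cg = ?N" using nsq_right[OF \<rho>S] by simp
    have ng: "nsq n g' = nsq n g" unfolding g'_def by (rule nsq_right[OF \<rho>S])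
    have "nsq n cg \<le> 4 * nsq n (swap_diff w D cg)"
      using cv_pure[OF g'] dn D(2) d(1) unfolding cg_def by (intro nsq_le_swap_diff[OF _ w D(1) h]) simp_all
    then have "F\<^sup>2 * ?N \<le> 4 * (F\<^sup>2 * nsq n (swap_diff w D cg))"
      using F unfolding ncg by simp
    also have "F\<^sup>2 * nsq n (swap_diff w D cg) = (\<Sum>\<sigma>\<in>Sn n. (F * swap_diff w D cg \<sigma>)\<^sup>2)"
      unfolding nsq_def sum_distrib_left power_mult_distrib ..
    also have "\<dots> \<le> (\<Sum>\<sigma>\<in>Sn n. nsq n g * (\<Sum>\<rho>\<in>Sn n. (graph_sum h A \<sigma> D \<rho>)\<^sup>2))"
    proof (rule sum_mono)
      fix \<sigma> assume \<sigma>: "\<sigma> \<in> Sn n"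
      have "F * swap_diff w D cg \<sigma> = (\<Sum>\<rho>\<in>Sn n. g' \<rho> * graph_sum h A \<sigma> D \<rho>)"
        using swap_diff_cv[OF pure_right_inv[OF g'] w D(1) h \<sigma> A] unfolding F_def cg_def D(2) .
      then have "(F * swap_diff w D cg \<sigma>)\<^sup>2 \<le> nsq n g' * (\<Sum>\<rho>\<in>Sn n. (graph_sum h A \<sigma> D \<rho>)\<^sup>2)"
        unfolding nsq_def using Cauchy_Schwarz_ineq_sum[of g' "graph_sum h A \<sigma> D" "Sn n"] by simp
      then show "(F * swap_diff w D cg \<sigma>)\<^sup>2 \<le> nsq n g * (\<Sum>\<rho>\<in>Sn n. (graph_sum h A \<sigma> D \<rho>)\<^sup>2)"
        unfolding ng .
    qed
    finally show ?thesis by (simp add: sum_distrib_left mult.assoc)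
  qed
  have cD: "card ?Ds = h choose d" using n_subsets[of "{1..h}" d] by simp
  define V where "V = (fact n)\<^sup>2 * \<mu>\<^sup>2 * Y ^ d / fact d"
  have "real (h choose d) * (F\<^sup>2 * ?N) = (\<Sum>D\<in>?Ds. F\<^sup>2 * ?N)" using cD by simp
  also have "\<dots> \<le> (\<Sum>D\<in>?Ds. 4 * nsq n g * (\<Sum>\<sigma>\<in>Sn n. \<Sum>\<rho>\<in>Sn n. (graph_sum h A \<sigma> D \<rho>)\<^sup>2))"
    by (rule sum_mono) (rule each)
  also have "\<dots> = 4 * nsq n g * (\<Sum>\<sigma>\<in>Sn n. \<Sum>D\<in>?Ds. \<Sum>\<rho>\<in>Sn n. (graph_sum h A \<sigma> D \<rho>)\<^sup>2)"
    unfolding sum_distrib_left[symmetric] by (subst sum.swap) (rule refl)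
  also have "\<dots> \<le> 4 * nsq n g * (\<Sum>\<sigma>\<in>Sn n. F * V)"
    unfolding F_def V_def
    by (intro mult_left_mono sum_mono graph_sum_square_le[OF h]) (simp_all add: nsq_nonneg)
  also have "\<dots> = F * (4 * nsq n g * (fact n * V))" by (simp add: card_Sn)
  finally have "F * (real (h choose d) * F * ?N) \<le> F * (4 * nsq n g * (fact n * V))"
    by (simp add: power2_eq_square mult_ac)
  then have "real (h choose d) * F * ?N \<le> 4 * nsq n g * (fact n * V)"
    using F by simp
  then have "fact d * (real (h choose d) * F * ?N) \<le> fact d * (4 * nsq n g * (fact n * V))"
    by (rule mult_left_mono) simp
  also have "\<dots> = 4 * nsq n g * fact n * ((fact n * \<mu>)\<^sup>2 * Y ^ d)"
    unfolding V_def by (simp add: power_mult_distrib)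
  also have "\<dots> \<le> 4 * nsq n g * (4 ^ d * (real (h choose d) * fact d * F)) * ((fact n * \<mu>)\<^sup>2 * Y ^ d)"
    using binomial_ratio_le[OF h_def] Y_nonneg unfolding F_def
    by (intro mult_right_mono mult_left_mono) (simp_all add: nsq_nonneg)
  finally have "(real (h choose d) * fact d * F) * ?N
      \<le> (real (h choose d) * fact d * F) * (4 * 4 ^ d * Y ^ d * (fact n * \<mu>)\<^sup>2 * nsq n g)"
    by (simp add: mult_ac)
  moreover have "0 < real (h choose d) * fact d * F"
  proof -
    have "0 < 4 ^ d * (real (h choose d) * fact d * F)"
      unfolding F_def by (rule less_le_trans[OF fact_gt_zero binomial_ratio_le[OF h_def]])
    then show ?thesis by (rule zero_less_mult_pos) simp
  qed
  ultimately have "?N \<le> 4 * 4 ^ d * Y ^ d * (fact n * \<mu>)\<^sup>2 * nsq n g"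
    by (rule mult_left_le_imp_le)
  also have "\<dots> \<le> 4 ^ d * 4 ^ d * Y ^ d * (fact n * \<mu>)\<^sup>2 * nsq n g"
  proof (intro mult_right_mono)
    show "(4::real) \<le> 4 ^ d" using power_increasing[of 1 d "4::real"] d(1) by simp
  qed (use Y_nonneg in \<open>simp_all add: nsq_nonneg\<close>)
  also have "\<dots> = (16 * Y) ^ d * (fact n * \<mu>)\<^sup>2 * nsq n g"
  proof -
    have "(4::real) ^ d * 4 ^ d * Y ^ d = (16 * Y) ^ d"
      unfolding power_mult_distrib[symmetric] by simp
    then show ?thesis by simp
  qed
  finally show ?thesis .
qed

end

section \<open>From mean zero functions to the degree decomposition\<close>

definition ind :: "(nat \<times> nat) set \<Rightarrow> (nat \<Rightarrow> nat) \<Rightarrow> real" where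
  "ind Q \<sigma> = of_bool (\<forall>e\<in>Q. \<sigma> (fst e) = snd e)"

lemma prod_dictator: "finite Q \<Longrightarrow> (\<Prod>v\<in>Q. dictator v \<sigma>) = ind Q \<sigma>"
  unfolding ind_def dictator_def by (induction Q rule: finite_induct) simp_all

lemma ind_deg_le:
  assumes "finite Q" "Q \<subseteq> {1..n} \<times> {1..n}" "int (card Q) \<le> d"
  shows "ind Q \<in> deg_le n d"
proof -
  define m :: monomial where "m = Abs_poly_mapping (\<lambda>v. if v \<in> Q then 1 else 0)"
  have l: "Poly_Mapping.lookup m = (\<lambda>v. if v \<in> Q then 1 else 0)"
    unfolding m_def by (rule Abs_poly_mapping_inverse) (use assms(1) in simp)
  have k: "Poly_Mapping.keys m = Q"
    by (rule set_eqI) (simp add: in_keys_iff l)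
  define P :: polynomial where "P = Poly_Mapping.single m 1"
  have kP: "Poly_Mapping.keys P = {m}" unfolding P_def by simp
  have deg: "monomial_degree m = card Q" unfolding monomial_degree_def k l by simp
  have "ind Q \<sigma> = eval_poly P (\<lambda>v. dictator v \<sigma>)" for \<sigma>
  proof -
    have "eval_poly P (\<lambda>v. dictator v \<sigma>) = (\<Prod>v\<in>Q. dictator v \<sigma> ^ Poly_Mapping.lookup m v)"
      unfolding eval_poly_def kP by (simp add: P_def k)
    also have "\<dots> = (\<Prod>v\<in>Q. dictator v \<sigma>)" by (rule prod.cong) (simp_all add: l)
    finally show ?thesis using prod_dictator[OF assms(1)] by simp
  qed
  moreover have "\<forall>m'\<in>Poly_Mapping.keys P. Poly_Mapping.keys m' \<subseteq> {1..n} \<times> {1..n} \<and> int (monomial_degree m') \<le> d"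
    unfolding kP using assms k deg by simp
  ultimately show ?thesis unfolding deg_le_def by blast
qed

text \<open>Dictators take only the values 0 and 1, so a monomial collapses to the indicator of its
  set of variables, whose size is at most the degree.\<close>

lemma deg_le_expansion:
  assumes "g \<in> deg_le n (int d)"
  obtains M :: "monomial set" and c where "finite M"
    "\<And>m. m \<in> M \<Longrightarrow> Poly_Mapping.keys m \<subseteq> {1..n} \<times> {1..n} \<and> card (Poly_Mapping.keys m) \<le> d"
    "\<And>\<sigma>. \<sigma> \<in> Sn n \<Longrightarrow> g \<sigma> = (\<Sum>m\<in>M. c m * ind (Poly_Mapping.keys m) \<sigma>)"
proof -
  from assms obtain P :: polynomial where
    P: "\<forall>m \<in> Poly_Mapping.keys P. Poly_Mapping.keys m \<subseteq> {1..n} \<times> {1..n} \<and> int (monomial_degree m) \<le> int d"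
      "\<forall>\<sigma> \<in> Sn n. g \<sigma> = eval_poly P (\<lambda>v. dictator v \<sigma>)"
    unfolding deg_le_def by blast
  have pos: "1 \<le> Poly_Mapping.lookup m v" if "v \<in> Poly_Mapping.keys m" for m :: monomial and v
    using that by (simp add: in_keys_iff Suc_le_eq)
  have 2: "card (Poly_Mapping.keys m) \<le> monomial_degree m" for m :: monomial
  proof -
    have "(\<Sum>v\<in>Poly_Mapping.keys m. 1) \<le> monomial_degree m"
      unfolding monomial_degree_def by (rule sum_mono) (rule pos)
    then show ?thesis by simp
  qed
  have 3: "(\<Prod>v\<in>Poly_Mapping.keys m. dictator v \<sigma> ^ Poly_Mapping.lookup m v) = ind (Poly_Mapping.keys m) \<sigma>"
    for m :: monomial and \<sigma>
  proof -
    have "(\<Prod>v\<in>Poly_Mapping.keys m. dictator v \<sigma> ^ Poly_Mapping.lookup m v) = (\<Prod>v\<in>Poly_Mapping.keys m. dictator v \<sigma>)"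
    proof (rule prod.cong[OF refl])
      fix v assume "v \<in> Poly_Mapping.keys m"
      then have "0 < Poly_Mapping.lookup m v" using pos[of v m] by simp
      then show "dictator v \<sigma> ^ Poly_Mapping.lookup m v = dictator v \<sigma>"
        unfolding dictator_def by (simp add: zero_power)
    qed
    then show ?thesis using prod_dictator[OF finite_keys] by simp
  qed
  show thesis
  proof (rule that)
    show "finite (Poly_Mapping.keys P)" by (rule finite_keys)
    fix m assume "m \<in> Poly_Mapping.keys P"
    then show "Poly_Mapping.keys m \<subseteq> {1..n} \<times> {1..n} \<and> card (Poly_Mapping.keys m) \<le> d"
      using P(1) 2[of m] by auto
  next
    fix \<sigma> assume "\<sigma> \<in> Sn n"
    then show "g \<sigma> = (\<Sum>m\<in>Poly_Mapping.keys P. Poly_Mapping.lookup P m * ind (Poly_Mapping.keys m) \<sigma>)"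
      using P(2) unfolding eval_poly_def 3 by blast
  qed
qed

lemma ind_right_inv:
  assumes "Q \<subseteq> {1..n} \<times> {1..n}" "fst ` Q \<subseteq> I"
  shows "ind Q \<in> right_inv n I"
  unfolding right_inv_def
proof (intro CollectI ballI allI impI)
  fix \<sigma> \<pi> assume "\<pi> permutes ({1..n} - I)"
  then have "\<pi> (fst e) = fst e" if "e \<in> Q" for e
    using that assms(2) by (intro permutes_not_in) blast+
  then show "ind Q (\<sigma> \<circ> \<pi>) = ind Q \<sigma>" unfolding ind_def by simp
qed

text \<open>For \<open>I \<subseteq> {1..n}\<close> this is the orthogonal projection onto
  \<open>right_inv n I\<close>, that is, the conditional expectation given the restriction to
  \<open>I\<close>.\<close>

definition avg :: "nat \<Rightarrow> nat set \<Rightarrow> ((nat \<Rightarrow> nat) \<Rightarrow> real) \<Rightarrow> (nat \<Rightarrow> nat) \<Rightarrow> real" where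
  "avg n I g \<sigma> = (\<Sum>\<pi>\<in>{\<pi>. \<pi> permutes ({1..n} - I)}. g (\<sigma> \<circ> \<pi>)) / fact (n - card I)"

lemma ip_avg:
  assumes "u \<in> right_inv n I" "I \<subseteq> {1..n}"
  shows "ip n (avg n I g) u = ip n g u"
proof -
  let ?P = "{\<pi>. \<pi> permutes ({1..n} - I)}"
  have "finite I" using assms(2) finite_subset by blast
  then have "card ({1..n} - I) = n - card I" using assms(2) by (simp add: card_Diff_subset)
  then have cP: "card ?P = fact (n - card I)" by (intro card_permutations) simp_all
  have "ip n (avg n I g) u = (\<Sum>\<sigma>\<in>Sn n. \<Sum>\<pi>\<in>?P. g (\<sigma> \<circ> \<pi>) * u \<sigma>) / fact (n - card I)"
    unfolding ip_def avg_def by (simp add: sum_divide_distrib sum_distrib_right)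
  also have "(\<Sum>\<sigma>\<in>Sn n. \<Sum>\<pi>\<in>?P. g (\<sigma> \<circ> \<pi>) * u \<sigma>) = (\<Sum>\<pi>\<in>?P. \<Sum>\<sigma>\<in>Sn n. g (\<sigma> \<circ> \<pi>) * u \<sigma>)"
    by (rule sum.swap)
  also have "\<dots> = (\<Sum>\<pi>\<in>?P. ip n g u)"
  proof (rule sum.cong[OF refl])
    fix \<pi> assume "\<pi> \<in> ?P"
    then have \<pi>: "\<pi> permutes ({1..n} - I)" by simp
    then have \<pi>S: "\<pi> \<in> Sn n" by (rule Sn_sub) blast
    have "(\<Sum>\<sigma>\<in>Sn n. g (\<sigma> \<circ> \<pi>) * u \<sigma>) = (\<Sum>\<sigma>\<in>Sn n. g (\<sigma> \<circ> \<pi>) * u (\<sigma> \<circ> \<pi>))"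
      using right_invD[OF assms(1) _ \<pi>] by (intro sum.cong refl) simp
    also have "\<dots> = ip n g u" unfolding ip_def by (rule sum_Sn_right[OF \<pi>S])
    finally show "(\<Sum>\<sigma>\<in>Sn n. g (\<sigma> \<circ> \<pi>) * u \<sigma>) = ip n g u" .
  qed
  finally show ?thesis using cP by simp
qed

lemma l2inner_eq_ip: "l2inner n f g = ip n f g / fact n"
  unfolding l2inner_def expect_def ip_def
  by (subst integral_pmf_of_set[OF Sn_nonempty finite_Sn]) (simp add: card_Sn)

text \<open>Averaging over the positions outside \<open>I\<close> and then summing over the value at
  \<open>k\<close> amounts to summing over all permutations that agree with \<open>\<sigma>\<close>
  on \<open>I - {k}\<close>. Up to normalisation this is an inner product of \<open>g\<close> with
  an indicator of degree \<open>d - 1\<close>, hence zero.\<close>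

lemma avg_pure:
  assumes g: "g \<in> deg_eq n (int d)" and I: "I \<subseteq> {1..n}" "card I = d"
  shows "avg n I g \<in> pure n I"
proof -
  have r: "avg n I g \<in> right_inv n I"
    unfolding right_inv_def
  proof (intro CollectI ballI allI impI)
    fix \<sigma> \<pi> assume "\<sigma> \<in> Sn n" and \<pi>: "\<pi> permutes ({1..n} - I)"
    have "(\<Sum>\<pi>'\<in>{\<pi>'. \<pi>' permutes ({1..n} - I)}. g (\<sigma> \<circ> \<pi> \<circ> \<pi>'))
        = (\<Sum>\<pi>'\<in>{\<pi>'. \<pi>' permutes ({1..n} - I)}. g (\<sigma> \<circ> \<pi>'))"
      unfolding o_assoc[symmetric] by (rule setum_permutations_compose_left[OF \<pi>, symmetric])
    then show "avg n I g (\<sigma> \<circ> \<pi>) = avg n I g \<sigma>" unfolding avg_def by simp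
  qed
  show ?thesis unfolding pure_def
  proof (intro CollectI conjI ballI r)
    fix \<sigma> k assume \<sigma>: "\<sigma> \<in> Sn n" and k: "k \<in> I"
    have \<sigma>p: "\<sigma> permutes {1..n}" using \<sigma> by (simp add: Sn_iff)
    let ?Y = "{1..n} - (I - {k})" and ?P = "{\<pi>. \<pi> permutes ({1..n} - I)}"
    let ?Q = "(\<lambda>i. (i, \<sigma> i)) ` (I - {k})"
    have finI: "finite I" using I(1) finite_subset by blast
    have Y: "?Y = insert k ({1..n} - I)" using k I(1) by blast
    have QX: "?Q \<subseteq> {1..n} \<times> {1..n}"
      using I(1) permutes_in_image[OF \<sigma>p] by (intro image_subsetI SigmaI) blast+
    have fQ: "fst ` ?Q = I - {k}" by (simp add: image_image)
    have \<sigma>Q: "\<sigma> \<in> perm_ext {1..n} ?Q" unfolding perm_ext_def using \<sigma>p by simp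
    have cQ: "card ?Q = d - 1"
      using k I(2) finI by (subst card_image) (simp_all add: inj_on_def card_Diff_singleton)
    have "0 < d" using k I(2) finI card_gt_0_iff by blast
    then have "int (card ?Q) \<le> int d - 1" using cQ by simp
    with finI QX have "ind ?Q \<in> deg_le n (int d - 1)" by (intro ind_deg_le) simp_all
    then have 0: "ip n g (ind ?Q) = 0"
      using g unfolding deg_eq_def l2inner_eq_ip by simp
    have "(\<Sum>z\<in>?Y. avg n I g (\<sigma> \<circ> Transposition.transpose k z))
        = (\<Sum>z\<in>?Y. \<Sum>\<pi>\<in>?P. g (\<sigma> \<circ> (Transposition.transpose k z \<circ> \<pi>))) / fact (n - card I)"
      unfolding avg_def o_assoc by (rule sum_divide_distrib[symmetric])
    also have "(\<Sum>z\<in>?Y. \<Sum>\<pi>\<in>?P. g (\<sigma> \<circ> (Transposition.transpose k z \<circ> \<pi>)))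
        = (\<Sum>\<pi>\<in>{\<pi>. \<pi> permutes ?Y}. g (\<sigma> \<circ> \<pi>))"
      unfolding Y by (rule sum_over_permutations_insert[symmetric]) (use k in simp_all)
    also have "\<dots> = (\<Sum>\<rho>\<in>perm_ext {1..n} ?Q. g \<rho>)"
      using sum.reindex_bij_betw[OF perm_ext_coset[OF \<sigma>Q QX], of g] unfolding fQ .
    also have "\<dots> = (\<Sum>\<rho>\<in>{\<rho> \<in> Sn n. \<forall>e\<in>?Q. \<rho> (fst e) = snd e}. g \<rho>)"
      unfolding perm_ext_def Sn_def by (rule arg_cong[where f = "sum g"]) simp
    also have "\<dots> = (\<Sum>\<rho>\<in>Sn n. if \<forall>e\<in>?Q. \<rho> (fst e) = snd e then g \<rho> else 0)"
      by (rule sum.inter_filter[OF finite_Sn])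
    also have "\<dots> = ip n g (ind ?Q)"
      unfolding ip_def ind_def by (rule sum.cong[OF refl]) simp
    finally have eq: "(\<Sum>z\<in>?Y. avg n I g (\<sigma> \<circ> Transposition.transpose k z)) = ip n g (ind ?Q) / fact (n - card I)" .
    show "(\<Sum>z\<in>?Y. avg n I g (\<sigma> \<circ> Transposition.transpose k z)) = 0"
      unfolding eq 0 by (rule div_0)
  qed
qed

lemma ip_cv: "ip n (cv n f u) w = ip n u (cv n (\<lambda>\<tau>. f (inv \<tau>)) w)"
proof -
  have "ip n (cv n f u) w = (\<Sum>\<sigma>\<in>Sn n. \<Sum>\<tau>\<in>Sn n. f \<tau> * (u (inv \<tau> \<circ> \<sigma>) * w \<sigma>))"
    unfolding ip_def cv_def sum_distrib_right mult.assoc ..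
  also have "\<dots> = (\<Sum>\<tau>\<in>Sn n. \<Sum>\<sigma>\<in>Sn n. f \<tau> * (u (inv \<tau> \<circ> \<sigma>) * w \<sigma>))"
    by (rule sum.swap)
  also have "\<dots> = (\<Sum>\<tau>\<in>Sn n. \<Sum>\<sigma>\<in>Sn n. f \<tau> * (u \<sigma> * w (\<tau> \<circ> \<sigma>)))"
  proof (rule sum.cong[OF refl])
    fix \<tau> assume \<tau>: "\<tau> \<in> Sn n"
    have "(\<Sum>\<sigma>\<in>Sn n. f \<tau> * (u (inv \<tau> \<circ> \<sigma>) * w \<sigma>)) = (\<Sum>\<sigma>\<in>Sn n. f \<tau> * (u (inv \<tau> \<circ> (\<tau> \<circ> \<sigma>)) * w (\<tau> \<circ> \<sigma>)))"
      by (rule sum_Sn_left[OF \<tau>, symmetric])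
    then show "(\<Sum>\<sigma>\<in>Sn n. f \<tau> * (u (inv \<tau> \<circ> \<sigma>) * w \<sigma>)) = (\<Sum>\<sigma>\<in>Sn n. f \<tau> * (u \<sigma> * w (\<tau> \<circ> \<sigma>)))"
      unfolding o_assoc Sn_inv_comp[OF \<tau>] by simp
  qed
  also have "\<dots> = (\<Sum>\<sigma>\<in>Sn n. \<Sum>\<tau>\<in>Sn n. f \<tau> * (u \<sigma> * w (\<tau> \<circ> \<sigma>)))"
    by (rule sum.swap)
  also have "\<dots> = (\<Sum>\<sigma>\<in>Sn n. \<Sum>\<tau>\<in>Sn n. f (inv \<tau>) * (u \<sigma> * w (inv \<tau> \<circ> \<sigma>)))"
    by (rule sum.cong[OF refl], rule sum_Sn_inv[symmetric])
  also have "\<dots> = ip n u (cv n (\<lambda>\<tau>. f (inv \<tau>)) w)"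
    unfolding ip_def cv_def sum_distrib_left by (simp only: mult.left_commute)
  finally show ?thesis .
qed

lemma ip_commute: "ip n u w = ip n w u"
  unfolding ip_def by (simp only: mult.commute)

text \<open>If \<open>x\<close> exceeded a positive \<open>l\<close>, the powers of
  \<open>x / l\<close> would be unbounded; for \<open>l = 0\<close> the case \<open>j = 0\<close>
  already suffices. Exponents \<open>2 ^ j\<close> are what repeated use of Cauchy-Schwarz
  provides.\<close>

lemma le_of_power_two_powers_le:
  fixes x l K :: real
  assumes "0 \<le> l" "0 \<le> x" and *: "\<And>j :: nat. x ^ (2 ^ j) \<le> l ^ (2 ^ j) * K"
  shows "x \<le> l"
proof (rule ccontr)
  assume "\<not> x \<le> l"
  then have lx: "l < x" by simp
  show False
  proof (cases "l = 0")
    case True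
    then show ?thesis using *[of 0] lx by simp
  next
    case False
    then have l: "0 < l" using assms(1) by simp
    have q: "1 < x / l" using lx l by simp
    obtain j where j: "K < (x / l) ^ j" using real_arch_pow[OF q] by blast
    have "(x / l) ^ j \<le> (x / l) ^ (2 ^ j)" using q by (intro power_increasing) (simp_all add: less_imp_le)
    also have "\<dots> \<le> K" using *[of j] l by (simp add: power_divide pos_divide_le_eq mult.commute)
    finally show False using j by simp
  qed
qed

text \<open>On each \<open>pure n I\<close> the operator \<open>cv n f\<close> is bounded by assumption, but the sum of these spaces
  is not orthogonal. The powers of the positive operator \<open>M\<close> see only its spectrum, and so the
  constants lost when passing from the pieces to \<open>g\<close> disappear in the limit.\<close>

lemma cv_norm_le_of_pure:
  assumes l: "0 \<le> l" and dn: "d \<le> n"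
    and bound: "\<And>I u. I \<subseteq> {1..n} \<Longrightarrow> card I = d \<Longrightarrow> u \<in> pure n I \<Longrightarrow> nsq n (cv n f u) \<le> l * nsq n u"
    and g: "g \<in> deg_eq n (int d)"
  shows "nsq n (cv n f g) \<le> l * nsq n g"
proof (cases "nsq n g = 0")
  case True
  then have "\<forall>\<sigma>\<in>Sn n. g \<sigma> = 0"
    unfolding nsq_def using finite_Sn by (subst (asm) sum_nonneg_eq_0_iff) simp_all
  then have "cv n f g \<sigma> = 0" if "\<sigma> \<in> Sn n" for \<sigma>
    unfolding cv_def using that Sn_comp Sn_inv by (intro sum.neutral ballI) simp
  then show ?thesis using True unfolding nsq_def by simp
next
  case False
  then have gp: "0 < nsq n g" using nsq_nonneg[of n g] by simp
  define f' where "f' = (\<lambda>\<tau>. f (inv \<tau>))"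
  \<comment> \<open>The composition of the operator with its adjoint: self-adjoint, positive, and
    preserving every \<open>pure n I\<close>.\<close>
  define M where "M u = cv n f' (cv n f u)" for u
  have adj: "ip n (cv n f u) w = ip n u (cv n f' w)" for u w
    unfolding f'_def by (rule ip_cv)
  have adj': "ip n (cv n f' u) w = ip n u (cv n f w)" for u w
  proof -
    have "ip n (cv n f' u) w = ip n w (cv n f' u)" by (rule ip_commute)
    also have "\<dots> = ip n (cv n f w) u" by (rule adj[symmetric])
    also have "\<dots> = ip n u (cv n f w)" by (rule ip_commute)
    finally show ?thesis .
  qed
  have M_adj: "ip n (M u) w = ip n u (M w)" for u w
    unfolding M_def adj' adj ..
  have Mp_adj: "ip n ((M ^^ N) u) w = ip n u ((M ^^ N) w)" for N u w
  proof (induction N arbitrary: u w)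
    case (Suc N)
    have "ip n ((M ^^ Suc N) u) w = ip n ((M ^^ N) u) (M w)" by (simp add: M_adj)
    also have "\<dots> = ip n u ((M ^^ N) (M w))" by (rule Suc)
    finally show ?case by (simp add: funpow_swap1)
  qed simp
  have Mp_right_inv: "(M ^^ N) u \<in> right_inv n I" if "u \<in> right_inv n I" for N u I
    using that by (induction N) (simp_all add: M_def cv_right_inv)
  have Mp_pure: "(M ^^ N) u \<in> pure n I" if "u \<in> pure n I" for N u I
    using that by (induction N) (simp_all add: M_def cv_pure)
  \<comment> \<open>Both operators preserve \<open>pure n I\<close>, so the bound passes to the
    adjoint by Cauchy-Schwarz inside that space.\<close>
  have bound': "nsq n (cv n f' u) \<le> l * nsq n u" if I: "I \<subseteq> {1..n}" "card I = d" and u: "u \<in> pure n I" for I u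
  proof (cases "nsq n (cv n f' u) = 0")
    case True
    then show ?thesis using l nsq_nonneg[of n u] by simp
  next
    case False
    then have pos: "0 < nsq n (cv n f' u)" using nsq_nonneg[of n "cv n f' u"] by simp
    have "nsq n (cv n f' u) = ip n u (cv n f (cv n f' u))" unfolding nsq_eq_ip adj' ..
    then have "(nsq n (cv n f' u))\<^sup>2 \<le> nsq n u * nsq n (cv n f (cv n f' u))"
      using ip_Cauchy_Schwarz[of n u "cv n f (cv n f' u)"] by simp
    also have "\<dots> \<le> nsq n u * (l * nsq n (cv n f' u))"
      by (intro mult_left_mono bound[OF I] cv_pure u nsq_nonneg)
    finally have "nsq n (cv n f' u) * nsq n (cv n f' u) \<le> nsq n (cv n f' u) * (l * nsq n u)"
      by (simp only: power2_eq_square mult_ac)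
    then show ?thesis using pos by (rule mult_left_le_imp_le)
  qed
  have Mp_bound: "nsq n ((M ^^ N) u) \<le> (l ^ N)\<^sup>2 * nsq n u" if I: "I \<subseteq> {1..n}" "card I = d" and u: "u \<in> pure n I" for N I u
  proof (induction N)
    case (Suc N)
    have p: "(M ^^ N) u \<in> pure n I" by (rule Mp_pure[OF u])
    have "nsq n ((M ^^ Suc N) u) \<le> l * nsq n (cv n f ((M ^^ N) u))"
      unfolding funpow.simps o_apply M_def by (rule bound'[OF I cv_pure[OF p[unfolded M_def]]])
    also have "\<dots> \<le> l * (l * nsq n ((M ^^ N) u))"
      by (intro mult_left_mono bound[OF I p] l)
    also have "\<dots> \<le> l * (l * ((l ^ N)\<^sup>2 * nsq n u))"
      by (intro mult_left_mono Suc l)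
    finally show ?case by (simp add: power2_eq_square mult_ac)
  qed simp
  from g have "g \<in> deg_le n (int d)" by (simp add: deg_eq_def)
  then obtain Ms :: "monomial set" and c where Ms: "finite Ms"
    "\<And>m. m \<in> Ms \<Longrightarrow> Poly_Mapping.keys m \<subseteq> {1..n} \<times> {1..n} \<and> card (Poly_Mapping.keys m) \<le> d"
    "\<And>\<sigma>. \<sigma> \<in> Sn n \<Longrightarrow> g \<sigma> = (\<Sum>m\<in>Ms. c m * ind (Poly_Mapping.keys m) \<sigma>)"
  proof (rule deg_le_expansion)
    fix Ms :: "monomial set" and c
    assume "finite Ms" "\<And>m. m \<in> Ms \<Longrightarrow> Poly_Mapping.keys m \<subseteq> {1..n} \<times> {1..n} \<and> card (Poly_Mapping.keys m) \<le> d"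
      "\<And>\<sigma>. \<sigma> \<in> Sn n \<Longrightarrow> g \<sigma> = (\<Sum>m\<in>Ms. c m * ind (Poly_Mapping.keys m) \<sigma>)"
    then show thesis by (rule that)
  qed
  have "\<exists>\<kappa>. \<forall>N. \<bar>ip n ((M ^^ N) g) (ind (Poly_Mapping.keys m))\<bar> \<le> l ^ N * \<kappa>" if m: "m \<in> Ms" for m
  proof -
    let ?Q = "Poly_Mapping.keys m"
    have Q: "?Q \<subseteq> {1..n} \<times> {1..n}" "card ?Q \<le> d" using Ms(2)[OF m] by blast+
    have "card (fst ` ?Q) \<le> d" using card_image_le[OF finite_keys, of fst m] Q(2) by linarith
    moreover have "fst ` ?Q \<subseteq> {1..n}" using Q(1) by auto
    \<comment> \<open>A \<open>d\<close>-set containing the positions of the monomial exists because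
      \<open>d \<le> n\<close>. Then the indicator and its images under \<open>M\<close> depend on
      the restriction to \<open>I\<close> only, so \<open>g\<close> may be replaced by its average,
      which lies in \<open>pure n I\<close>.\<close>
    ultimately obtain I where I: "fst ` ?Q \<subseteq> I" "I \<subseteq> {1..n}" "card I = d"
      using exists_subset_between[of "fst ` ?Q" d "{1..n}"] dn by auto
    let ?u = "avg n I g" and ?e = "ind ?Q"
    have up: "?u \<in> pure n I" by (rule avg_pure[OF g I(2,3)])
    have er: "?e \<in> right_inv n I" by (rule ind_right_inv[OF Q(1) I(1)])
    have "\<bar>ip n ((M ^^ N) g) ?e\<bar> \<le> l ^ N * sqrt (nsq n ?u * nsq n ?e)" for N
    proof -
      have "ip n ((M ^^ N) g) ?e = ip n ?u ((M ^^ N) ?e)"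
        unfolding Mp_adj by (rule ip_avg[OF Mp_right_inv[OF er] I(2), symmetric])
      also have "\<dots> = ip n ((M ^^ N) ?u) ?e" by (rule Mp_adj[symmetric])
      finally have "(ip n ((M ^^ N) g) ?e)\<^sup>2 \<le> nsq n ((M ^^ N) ?u) * nsq n ?e"
        using ip_Cauchy_Schwarz[of n "(M ^^ N) ?u" ?e] by simp
      also have "\<dots> \<le> (l ^ N)\<^sup>2 * nsq n ?u * nsq n ?e"
        by (intro mult_right_mono Mp_bound[OF I(2,3) up] nsq_nonneg)
      finally have "\<bar>ip n ((M ^^ N) g) ?e\<bar> \<le> sqrt ((l ^ N)\<^sup>2 * (nsq n ?u * nsq n ?e))"
        using real_le_rsqrt[of "\<bar>ip n ((M ^^ N) g) ?e\<bar>"] by (simp add: mult.assoc)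
      then show ?thesis using l by (simp add: real_sqrt_mult)
    qed
    then show ?thesis by blast
  qed
  then have "\<forall>m\<in>Ms. \<exists>\<kappa>. \<forall>N. \<bar>ip n ((M ^^ N) g) (ind (Poly_Mapping.keys m))\<bar> \<le> l ^ N * \<kappa>" by blast
  from bchoice[OF this] obtain \<kappa> where
    \<kappa>: "\<forall>m\<in>Ms. \<forall>N. \<bar>ip n ((M ^^ N) g) (ind (Poly_Mapping.keys m))\<bar> \<le> l ^ N * \<kappa> m"
    by (rule exE)
  define K where "K = (\<Sum>m\<in>Ms. \<bar>c m\<bar> * \<kappa> m)"
  have upper: "ip n ((M ^^ N) g) g \<le> l ^ N * K" for N
  proof -
    have "ip n ((M ^^ N) g) g = (\<Sum>\<sigma>\<in>Sn n. \<Sum>m\<in>Ms. c m * ((M ^^ N) g \<sigma> * ind (Poly_Mapping.keys m) \<sigma>))"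
      unfolding ip_def
    proof (rule sum.cong[OF refl])
      fix \<sigma> assume "\<sigma> \<in> Sn n"
      then have "(M ^^ N) g \<sigma> * g \<sigma> = (M ^^ N) g \<sigma> * (\<Sum>m\<in>Ms. c m * ind (Poly_Mapping.keys m) \<sigma>)"
        using Ms(3) by simp
      then show "(M ^^ N) g \<sigma> * g \<sigma> = (\<Sum>m\<in>Ms. c m * ((M ^^ N) g \<sigma> * ind (Poly_Mapping.keys m) \<sigma>))"
        by (simp only: sum_distrib_left mult.left_commute)
    qed
    also have "\<dots> = (\<Sum>m\<in>Ms. c m * ip n ((M ^^ N) g) (ind (Poly_Mapping.keys m)))"
      unfolding ip_def sum_distrib_left by (rule sum.swap)
    also have "\<dots> \<le> (\<Sum>m\<in>Ms. \<bar>c m\<bar> * (l ^ N * \<kappa> m))"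
    proof (rule sum_mono)
      fix m assume "m \<in> Ms"
      then have "\<bar>c m\<bar> * \<bar>ip n ((M ^^ N) g) (ind (Poly_Mapping.keys m))\<bar> \<le> \<bar>c m\<bar> * (l ^ N * \<kappa> m)"
        using \<kappa> by (intro mult_left_mono) simp_all
      then show "c m * ip n ((M ^^ N) g) (ind (Poly_Mapping.keys m)) \<le> \<bar>c m\<bar> * (l ^ N * \<kappa> m)"
        unfolding abs_mult[symmetric] by (rule order_trans[OF abs_ge_self])
    qed
    also have "\<dots> = l ^ N * K" unfolding K_def sum_distrib_left by (simp only: mult.left_commute)
    finally show ?thesis .
  qed
  define x where "x = nsq n (cv n f g) / nsq n g"
  have x0: "0 \<le> x" unfolding x_def using gp nsq_nonneg[of n "cv n f g"] by simp
  \<comment> \<open>Cauchy-Schwarz for the self-adjoint \<open>M\<close> doubles the exponent in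
    each step.\<close>
  have lower: "x ^ (2 ^ j) * nsq n g \<le> ip n ((M ^^ (2 ^ j)) g) g" for j
  proof (induction j)
    case 0
    have "ip n (M g) g = nsq n (cv n f g)" unfolding M_def adj' nsq_eq_ip ..
    then show ?case using gp by (simp add: x_def)
  next
    case (Suc j)
    let ?N = "2 ^ j :: nat" and ?h = "(M ^^ (2 ^ j)) g"
    have "(x ^ ?N * nsq n g)\<^sup>2 \<le> (ip n ?h g)\<^sup>2" using Suc x0 gp by (intro power_mono) simp_all
    also have "\<dots> \<le> nsq n ?h * nsq n g" by (rule ip_Cauchy_Schwarz)
    finally have "(x ^ ?N)\<^sup>2 * nsq n g * nsq n g \<le> nsq n ?h * nsq n g"
      by (simp only: power_mult_distrib power2_eq_square mult_ac)
    then have "(x ^ ?N)\<^sup>2 * nsq n g \<le> nsq n ?h" using gp by (rule mult_right_le_imp_le)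
    moreover have "ip n ((M ^^ (2 ^ Suc j)) g) g = nsq n ?h"
    proof -
      have "(2::nat) ^ Suc j = ?N + ?N" by simp
      then have "ip n ((M ^^ (2 ^ Suc j)) g) g = ip n ((M ^^ ?N) ?h) g"
        by (simp only: funpow_add o_apply)
      also have "\<dots> = ip n ?h ?h" by (rule Mp_adj)
      also have "\<dots> = nsq n ?h" by (rule nsq_eq_ip[symmetric])
      finally show ?thesis .
    qed
    moreover have "x ^ (2 ^ Suc j) = (x ^ ?N)\<^sup>2" by (simp only: power_Suc mult.commute[of 2] power_mult)
    ultimately show ?case by (simp only:)
  qed
  have "x ^ (2 ^ j) \<le> l ^ (2 ^ j) * (K / nsq n g)" for j :: nat
    using order_trans[OF lower[of j] upper[of "2 ^ j"]] gp by (simp add: pos_le_divide_eq)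
  then have "x \<le> l" by (rule le_of_power_two_powers_le[OF l x0])
  then show ?thesis unfolding x_def using gp by (simp add: pos_divide_le_eq)
qed

section \<open>From probabilities to counts, and the final estimate\<close>

lemma expect_eq:
  assumes "finite U" "U \<noteq> {}"
  shows "expect U f = (\<Sum>\<sigma>\<in>U. f \<sigma>) / real (card U)"
  unfolding expect_def by (rule integral_pmf_of_set[OF assms(2,1)])

lemma mu_eq:
  assumes "A \<subseteq> Sn n"
  shows "mu n A = real (card A) / fact n"
proof -
  have "Sn n \<inter> A = A" using assms by blast
  then show ?thesis
    unfolding mu_def using measure_pmf_of_set[OF Sn_nonempty finite_Sn, of n A] by (simp add: card_Sn)
qed

lemma l2norm_Sn: "l2norm (Sn n) g = sqrt (nsq n g / fact n)"
  unfolding l2norm_def expect_eq[OF finite_Sn Sn_nonempty] nsq_def card_Sn by simp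

lemma l2norm_indicator:
  assumes "finite U" "U \<noteq> {}"
  shows "l2norm U (indicator A) = sqrt (real (card (A \<inter> U)) / real (card U))"
proof -
  have "(\<Sum>\<sigma>\<in>U. (indicator A \<sigma> :: real)\<^sup>2) = (\<Sum>\<sigma>\<in>U. indicator A \<sigma>)"
    by (rule sum.cong) (simp_all add: indicator_def)
  also have "\<dots> = real (card (A \<inter> U))"
    using assms(1) by (simp add: indicator_def sum.If_cases Int_commute)
  finally show ?thesis unfolding l2norm_def expect_eq[OF assms] by simp
qed

text \<open>The squared norm of an indicator is a density, whence \<open>r ^ (2 * card Q)\<close>.
  If some permutation satisfies the prescriptions, both projections of \<open>Q\<close> are
  injective and an enumeration of \<open>Q\<close> yields two tuples of distinct elements; otherwise
  the count is zero.\<close>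

lemma global_set_card_le:
  assumes A: "A \<subseteq> Sn n" and glob: "global_set n r A" and Q: "Q \<subseteq> {1..n} \<times> {1..n}"
    and r: "0 < r"
  shows "real (card (A \<inter> perm_ext {1..n} Q)) \<le> mu n A * r ^ (2 * card Q) * fact (n - card Q)"
proof (cases "perm_ext {1..n} Q = {}")
  case True
  have "0 \<le> mu n A" unfolding mu_def by simp
  then show ?thesis unfolding True using r by simp
next
  case False
  let ?U = "perm_ext {1..n} Q"
  obtain \<rho> where \<rho>: "\<rho> \<in> ?U" using False by blast
  have finQ: "finite Q" using Q by (rule finite_subset) simp
  obtain xs where xs: "set xs = Q" "distinct xs" using finite_distinct_list[OF finQ] by blast
  have len: "length xs = card Q" using distinct_card[OF xs(2)] xs(1) by simp
  have inj1: "inj_on fst Q" by (rule perm_ext_inj_on_fst[OF \<rho>])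
  have "inj_on snd Q"
  proof (rule inj_onI)
    fix e e' assume e: "e \<in> Q" "e' \<in> Q" "snd e = snd e'"
    then have "\<rho> (fst e) = \<rho> (fst e')" using perm_extD[OF \<rho>] by simp
    then have "fst e = fst e'" using permutes_inj[OF perm_ext_permutes[OF \<rho>]] by (simp add: inj_eq)
    with e(3) show "e = e'" by (simp add: prod_eq_iff)
  qed
  then have I: "map fst xs \<in> tuples n (card Q)" "map snd xs \<in> tuples n (card Q)"
    unfolding tuples_def using xs len inj1 Q by (auto simp: distinct_map)
  have U: "umvirate n (map fst xs) (map snd xs) = ?U"
  proof (rule set_eqI)
    fix \<sigma>
    have "(\<forall>s<length xs. \<sigma> (fst (xs ! s)) = snd (xs ! s)) \<longleftrightarrow> (\<forall>e\<in>set xs. \<sigma> (fst e) = snd e)"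
      by (simp add: all_set_conv_all_nth)
    then show "\<sigma> \<in> umvirate n (map fst xs) (map snd xs) \<longleftrightarrow> \<sigma> \<in> ?U"
      unfolding umvirate_def perm_ext_def Sn_def xs(1) by simp
  qed
  have fU: "finite ?U" by (rule finite_perm_ext) simp
  have cU: "card ?U = fact (n - card Q)" using card_perm_ext[OF _ Q False] by simp
  have AS: "A \<inter> Sn n = A" using A by blast
  have "l2norm ?U (indicator A) \<le> r ^ card Q * l2norm (Sn n) (indicator A)"
    using glob I U unfolding global_set_def global_fun_def global_with_def by metis
  then have "sqrt (real (card (A \<inter> ?U)) / fact (n - card Q)) \<le> r ^ card Q * sqrt (mu n A)"
    unfolding l2norm_indicator[OF fU False] l2norm_indicator[OF finite_Sn Sn_nonempty] AS
      mu_eq[OF A] cU card_Sn by simp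
  also have "\<dots> = sqrt (r ^ (2 * card Q) * mu n A)"
    using r by (simp add: real_sqrt_mult power_mult real_sqrt_power power_even_eq)
  finally have "real (card (A \<inter> ?U)) / fact (n - card Q) \<le> r ^ (2 * card Q) * mu n A"
    by simp
  then show ?thesis by (simp add: pos_divide_le_eq mult_ac)
qed

text \<open>Prescribing the value at 1 splits \<open>A\<close> into \<open>n\<close> parts, each at
  most \<open>r\<^sup>2\<close> times the average size.\<close>

lemma global_set_ge_1:
  assumes A: "A \<subseteq> Sn n" "A \<noteq> {}" and glob: "global_set n r A" and n: "0 < n" and r: "0 < r"
  shows "1 \<le> r"
proof -
  let ?X = "{1..n}"
  have finA: "finite A" using A(1) finite_Sn by (rule finite_subset)
  have cA: "0 < real (card A)" using A(2) finA by (simp add: card_gt_0_iff)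
  have m: "mu n A * fact n = real (card A)" unfolding mu_eq[OF A(1)] by simp
  have "A = (\<Union>j\<in>?X. A \<inter> perm_ext ?X {(1, j)})"
  proof (rule set_eqI)
    fix \<sigma>
    have "\<sigma> permutes ?X" "\<sigma> 1 \<in> ?X" if "\<sigma> \<in> A"
    proof -
      show p: "\<sigma> permutes ?X" using A(1) that Sn_iff by blast
      show "\<sigma> 1 \<in> ?X" using permutes_in_image[OF p, of 1] n by simp
    qed
    then show "\<sigma> \<in> A \<longleftrightarrow> \<sigma> \<in> (\<Union>j\<in>?X. A \<inter> perm_ext ?X {(1, j)})"
      unfolding perm_ext_def by auto
  qed
  then have "card A \<le> (\<Sum>j\<in>?X. card (A \<inter> perm_ext ?X {(1, j)}))"
    using card_UN_le[of ?X "\<lambda>j. A \<inter> perm_ext ?X {(1, j)}"] by simp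
  then have "real (card A) \<le> (\<Sum>j\<in>?X. real (card (A \<inter> perm_ext ?X {(1, j)})))"
    by (metis of_nat_mono of_nat_sum)
  also have "\<dots> \<le> (\<Sum>j\<in>?X. mu n A * r\<^sup>2 * fact (n - 1))"
  proof (rule sum_mono)
    fix j assume "j \<in> ?X"
    then have "{(1, j)} \<subseteq> ?X \<times> ?X" using n by simp
    from global_set_card_le[OF A(1) glob this r]
    show "real (card (A \<inter> perm_ext ?X {(1, j)})) \<le> mu n A * r\<^sup>2 * fact (n - 1)" by simp
  qed
  also have "\<dots> = r\<^sup>2 * (mu n A * (real n * fact (n - 1)))" by simp
  also have "real n * fact (n - 1) = fact n" using n by (simp add: fact_reduce)
  finally have "1 \<le> r\<^sup>2" unfolding m using cA by simp
  then show ?thesis using r by (intro power2_le_imp_le[of 1 r]) simp_all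
qed

text \<open>The convolution is a sum of \<open>card A\<close> isometries. After normalisation this
  is the trivial bound 1 for the operator norm, used for \<open>d = 0\<close> and whenever the
  claimed bound is at least 1.\<close>

lemma cv_indicator_norm_le:
  assumes "A \<subseteq> Sn n"
  shows "nsq n (cv n (indicator A) g) \<le> (real (card A))\<^sup>2 * nsq n g"
proof -
  have "nsq n (cv n (indicator A) g) \<le> (\<Sum>\<sigma>\<in>Sn n. (\<Sum>\<tau>\<in>A. (g (inv \<tau> \<circ> \<sigma>))\<^sup>2) * card A)"
    unfolding nsq_def cv_indicator[OF assms] by (rule sum_mono) (rule sum_squared_le_sum_of_squares)
  also have "\<dots> = (\<Sum>\<tau>\<in>A. \<Sum>\<sigma>\<in>Sn n. (g (inv \<tau> \<circ> \<sigma>))\<^sup>2) * card A"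
    unfolding sum_distrib_right[symmetric] by (subst sum.swap) (rule refl)
  also have "(\<Sum>\<tau>\<in>A. \<Sum>\<sigma>\<in>Sn n. (g (inv \<tau> \<circ> \<sigma>))\<^sup>2) = (\<Sum>\<tau>\<in>A. nsq n g)"
  proof (rule sum.cong[OF refl])
    fix \<tau> assume "\<tau> \<in> A"
    then have "inv \<tau> \<in> Sn n" using assms Sn_inv by blast
    then show "(\<Sum>\<sigma>\<in>Sn n. (g (inv \<tau> \<circ> \<sigma>))\<^sup>2) = nsq n g"
      unfolding nsq_def by (rule sum_Sn_left)
  qed
  finally show ?thesis by (simp add: power2_eq_square mult_ac)
qed

lemma conv_l2norm_le:
  assumes A: "A \<subseteq> Sn n" "A \<noteq> {}" and g: "l2norm (Sn n) g = 1" and B: "0 \<le> B"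
    and *: "nsq n (cv n (indicator A) g) \<le> B * (real (card A))\<^sup>2 * nsq n g"
  shows "l2norm (Sn n) (conv n (\<lambda>\<sigma>. indicator A \<sigma> / mu n A) g) \<le> sqrt B"
proof -
  have finA: "finite A" using A(1) finite_Sn by (rule finite_subset)
  have cA: "0 < real (card A)" using A(2) finA by (simp add: card_gt_0_iff)
  have ng: "nsq n g = fact n" using g unfolding l2norm_Sn by simp
  have "conv n (\<lambda>\<sigma>. indicator A \<sigma> / mu n A) g \<sigma> = cv n (indicator A) g \<sigma> / real (card A)" for \<sigma>
    unfolding conv_def expect_eq[OF finite_Sn Sn_nonempty] cv_def card_Sn mu_eq[OF A(1)] sum_divide_distrib
    by (intro sum.cong refl) simp
  then have "nsq n (conv n (\<lambda>\<sigma>. indicator A \<sigma> / mu n A) g) = nsq n (cv n (indicator A) g) / (real (card A))\<^sup>2"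
    unfolding nsq_def by (simp add: power_divide sum_divide_distrib)
  also have "\<dots> \<le> B * fact n"
    using * cA unfolding ng by (simp add: pos_divide_le_eq mult_ac)
  finally show ?thesis unfolding l2norm_Sn by (simp add: pos_divide_le_eq)
qed

theorem theorem1p9:
  "\<exists>C::real. C > 0 \<and>
    (\<forall>(n::nat) (r::real) (A :: (nat \<Rightarrow> nat) set) (f :: (nat \<Rightarrow> nat) \<Rightarrow> real) (d::nat).
       n > 0 \<longrightarrow> r > 0 \<longrightarrow> A \<subseteq> Sn n \<longrightarrow> A \<noteq> {} \<longrightarrow> global_set n r A \<longrightarrow>
       f = (\<lambda>\<sigma>. indicator A \<sigma> / mu n A) \<longrightarrow>
       real d \<le> min (1 / 8 * ln (1 / mu n A)) (real n / 10 ^ 5) \<longrightarrow>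
       op_norm_on n (conv n f) (deg_eq n (int d)) \<le>
         ennreal (if d = 0 then 1
                  else (C * r ^ 4 * (1 / real n) * ln (1 / mu n A)) powr (real d / 2)))"
\<comment> \<open>The constant is 16, from the passage to operators, times the
  \<open>8 * exp 16\<close> of the level inequality.\<close>
proof (intro exI[of _ "128 * exp 16"] conjI allI impI)
  fix n d :: nat and r :: real and A :: "(nat \<Rightarrow> nat) set" and f :: "(nat \<Rightarrow> nat) \<Rightarrow> real"
  assume n: "n > 0" and r0: "r > 0" and A: "A \<subseteq> Sn n" "A \<noteq> {}" and glob: "global_set n r A"
    and f: "f = (\<lambda>\<sigma>. indicator A \<sigma> / mu n A)"
    and dmin: "real d \<le> min (1 / 8 * ln (1 / mu n A)) (real n / 10 ^ 5)"
  let ?L = "ln (1 / mu n A)"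
  let ?T = "128 * exp 16 * r ^ 4 * (1 / real n) * ?L"
  have finA: "finite A" using A(1) finite_Sn by (rule finite_subset)
  have mu: "0 < mu n A" unfolding mu_eq[OF A(1)] using A(2) finA by (simp add: card_gt_0_iff)
  have cA: "fact n * mu n A = real (card A)" unfolding mu_eq[OF A(1)] by simp
  have r1: "1 \<le> r" by (rule global_set_ge_1[OF A glob n r0])
  have dL: "8 * real d \<le> ?L" and dn: "real d \<le> real n" using dmin n by simp_all
  have expL: "exp (- ?L) = mu n A" using mu by (simp add: ln_div)
  have *: "l2norm (Sn n) (conv n f g) \<le> (if d = 0 then 1 else ?T powr (real d / 2))"
    if g: "g \<in> deg_eq n (int d)" "l2norm (Sn n) g = 1" for g
  proof -
    have triv: "l2norm (Sn n) (conv n f g) \<le> 1"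
      using conv_l2norm_le[OF A g(2), of 1] cv_indicator_norm_le[OF A(1), of g] f by simp
    \<comment> \<open>If \<open>?T\<close> is below 1, then \<open>8 * ?L \<le> n\<close>, because
      the constant times \<open>r ^ 4\<close> is at least 8. This is the room required by the level
      inequality.\<close>
    consider "d = 0" | "0 < d" "1 \<le> ?T" | "0 < d" "?T < 1" by linarith
    then show ?thesis
    proof cases
      case 1
      then show ?thesis using triv by simp
    next
      case 2
      have "1 \<le> ?T powr (real d / 2)" using 2 by (intro ge_one_powr_ge_zero) simp_all
      then show ?thesis using triv 2 by simp
    next
      case 3
      have Lp: "0 < ?L" using dL 3(1) by simp
      have "8 * ?L \<le> real n"
      proof -
        have "(1::real) \<le> exp 16" "1 \<le> r ^ 4" using r1 by (simp_all add: one_le_power)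
        then have "1 * 1 \<le> exp 16 * r ^ 4" by (intro mult_mono) simp_all
        then have "8 * 1 \<le> 128 * (exp 16 * r ^ 4)" by linarith
        then have "8 * 1 * (?L / real n) \<le> 128 * (exp 16 * r ^ 4) * (?L / real n)"
          using Lp n by (intro mult_right_mono) simp_all
        also have "\<dots> = ?T" by (simp add: mult_ac)
        finally have "8 * (?L / real n) \<le> 1" using 3(2) by simp
        then show ?thesis using n by (simp add: field_simps)
      qed
      then interpret gi: global_indicator n A "mu n A" r ?L d
        using A(1) mu expL r1 global_set_card_le[OF A(1) glob _ r0] 3(1) dL by unfold_locales simp_all
      have Y: "16 * gi.Y = ?T" unfolding gi.Y_def by simp
      have "0 < ?T" using Lp n r0 by simp
      have l0: "0 \<le> (16 * gi.Y) ^ d * (fact n * mu n A)\<^sup>2" using gi.Y_nonneg by simp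
      have "nsq n (cv n (indicator A) g) \<le> (16 * gi.Y) ^ d * (fact n * mu n A)\<^sup>2 * nsq n g"
        using cv_norm_le_of_pure[OF l0 _ gi.cv_pure_norm_le g(1)] dn by simp
      then have "l2norm (Sn n) (conv n f g) \<le> sqrt (?T ^ d)"
        using conv_l2norm_le[OF A g(2), of "?T ^ d"] \<open>0 < ?T\<close> unfolding Y cA f by simp
      also have "\<dots> = ?T powr (real d / 2)"
        using \<open>0 < ?T\<close> by (simp add: powr_half_sqrt[symmetric] powr_powr flip: powr_realpow)
      finally show ?thesis using 3 by simp
    qed
  qed
  show "op_norm_on n (conv n f) (deg_eq n (int d)) \<le> ennreal (if d = 0 then 1 else ?T powr (real d / 2))"
    unfolding op_norm_on_def by (rule SUP_least, rule ennreal_leI, rule *) simp_all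
qed simp

end
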